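(* Let $\mathcal S = (\mathcal U, \mathcal L, \mathcal T(-,-))$ be an abstract tensor system with a choice of canonical labels $\mathcal L_c \subseteq \mathcal L$. Then $\mathbb C[\mathcal S]$, with the objects, hom-sets, composition, identities, monoidal product, symmetry and trace given in the context, is a strict, traced symmetric monoidal category.
   Context: **Abstract tensor systems.** Fix a set $\mathcal U$ of types, a set $\mathcal L$ of labels and a typing function $\tau:\mathcal L\to\mathcal U$ with at least countably infinitely many labels of each type. $\mathcal P_f(\mathcal L)$ is the set of finite subsets of $\mathcal L$. $[x_1\mapsto y_1,\ldots,x_N\mapsto y_N]$ denotes the function sending each $x_i$ to $y_i$ and fixing all other elements of its domain. A (small) abstract tensor system (ATS) consists of: - a set $\mathcal T(\mathbf x,\mathbf y)$ for all $\mathbf x,\mathbf y\in\mathcal P_f(\mathcal L)$ with $\mathbf x\cap\mathbf y=\emptyset$ ($\mathbf x$: lower labels/inputs; $\mathbf y$: upper labels/outputs); for $\psi\in\mathcal T(\mathbf x,\mathbf y)$ write $L(\psi)=\mathbf x\cup\mathbf y$; - a tensor product $(-\cdot-):\mathcal T(\mathbf x,\mathbf y)\times\mathcal T(\mathbf x',\mathbf y')\to\mathcal T(\mathbf x\cup\mathbf x',\mathbf y\cup\mathbf y')$ defined whenever $(\mathbf x\cup\mathbf y)\cap(\mathbf x'\cup\mathbf y')=\emptyset$, written $\psi\phi$; - a contraction $\mathcal K_a^b:\mathcal T(\mathbf x,\mathbf y)\to\mathcal T(\mathbf x-\{a\},\mathbf y-\{b\})$ for $a\in\mathbf x$, $b\in\mathbf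 y$ with $\tau(a)=\tau(b)$; - a bijection (relabelling) $r_f:\mathcal T(\mathbf x,\mathbf y)\to\mathcal T(f(\mathbf x),f(\mathbf y))$, written $\psi[f]:=r_f(\psi)$, for every bijection $f:\mathbf x\cup\mathbf y\to\mathbf z$ with $\tau(f(x))=\tau(x)$ for all $x$; - a chosen element $\delta_a^b\in\mathcal T(\{a\},\{b\})$ for all (distinct) $a,b$ with $\tau(a)=\tau(b)$, and an element $1\in\mathcal T(\emptyset,\emptyset)$. These satisfy the following axioms, whenever the expressions are defined: - T1: $\mathcal K_a^b(\mathcal K_{a'}^{b'}(\psi))=\mathcal K_{a'}^{b'}(\mathcal K_a^b(\psi))$. - T2: $(\psi\phi)\xi=\psi(\phi\xi)$, $\psi1=\psi=1\psi$, $\psi\phi=\phi\psi$. - T3: $\mathcal K_a^b(\psi\phi)=(\mathcal K_a^b(\psi))\phi$ for $a,b\notin L(\phi)$. - T4: $\mathcal K_a^b(\delta_a^c\psi)=\psi[b\mapsto c]$ and $\mathcal K_b^c(\delta_a^c\psi)=\psi[b\mapsto a]$. - L1: $\psi[f][g]=\psi[g\circ f]$ and $\psi[\mathrm{id}]=\psi$. - L2: $(\psi[f])\phi=(\psi\phi)[f]$ where $\mathrm{cod}(f)\cap L(\phi)=\emptyset$ (on the right $f$ is extended by the identity on $L(\phi)$). - L3: $\mathcal K_a^b(\psi)[f']=\mathcal K_{f(a)}^{f(b)}(\psi[f])$ where $f'$ is the restriction of $f$ to $L(\psi)-\{a,b\}$. - L4: $\delta_a^b[a\mapsto a',b\mapsto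 b']=\delta_{a'}^{b'}$. **Einstein notation.** If $\psi\in\mathcal T(\mathbf x,\mathbf y)$ and the elements of $\mathbf x,\mathbf y$ are listed without repetition as $x_1,\ldots,x_m$ and $y_1,\ldots,y_n$, then $\psi_{a_1,\ldots,a_m}^{b_1,\ldots,b_n}$ denotes the relabelling $\psi[x_i\mapsto a_i,\,y_j\mapsto b_j]$. A juxtaposition of such symbols and $\delta$'s in which a label is repeated (once lower, once upper) denotes the tensor obtained by replacing the upper occurrence of each repeated label $a$ by a fresh label $\overline a$ of the same type, taking the tensor product of the resulting tensors, and applying $\mathcal K_a^{\overline a}$ for each repeated label $a$. For lists of labels of equal length and matching types, $\delta_{\vec x}^{\vec y}:=\delta_{x_1}^{y_1}\cdots\delta_{x_n}^{y_n}$ ($=1$ for empty lists). **Canonical labels.** A choice of canonical labels is a subset $\mathcal L_c\subseteq\mathcal L$ with $\mathcal L_c\cong\mathcal U\times\mathbb N\times\{0,1\}$, where $(X,i,0)$, $(X,i,1)$ are written $x_i^{(0)}$, $x_i^{(1)}$ and have type $X$. For a list of types $\vec X=[X_1,\ldots,X_N]$ and $\epsilon\in\{0,1\}$, let $\vec x^{(\epsilon)}$ be the list of labels $(X_1,1,\epsilon),\ldots,(X_N,N,\epsilon)$ and $\mathbf x^{(\epsilon)}$ the set of its elements. For $s\ge 0$, let $\vec x^{(\epsilon)}_{s+1..s+N}$ be the list $(X_1,s+1,\epsilon),\ldots,(X_N,s+N,\epsilon)$ (so $s=0$ gives $\vec x^{(\epsilon)}$). **The category $\mathbb C[\mathcal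 S]$.** Objects: $\mathcal U^*$ (finite lists of types). Morphisms: $\hom(\vec X,\vec Y)=\mathcal T(\mathbf x^{(0)},\mathbf y^{(1)})$. Monoidal product on objects: concatenation, $I=[\,]$. Let $\vec X,\vec Y,\vec U,\vec V$ have lengths as indicated, and let $\vec{x'},\vec{y'}$ be lists of fresh labels (possibly non-canonical) of the appropriate types. - Composition, for $\psi:\vec X\to\vec Y$, $\phi:\vec Y\to\vec Z$: $\phi\circ\psi=\psi_{\vec x^{(0)}}^{\vec{y'}}\phi_{\vec{y'}}^{\vec z^{(1)}}$. - Product, for $\psi:\vec X\to\vec Y$, $\widetilde\psi:\vec U\to\vec V$ with $|\vec X|=m,|\vec Y|=n,|\vec U|=m',|\vec V|=n'$: $\psi\otimes\widetilde\psi=\psi_{\vec x_{1..m}^{(0)}}^{\vec y_{1..n}^{(1)}}\,\widetilde\psi_{\vec u_{m+1..m+m'}^{(0)}}^{\vec v_{n+1..n+n'}^{(1)}}$. - Identity: $\mathrm{id}_{\vec X}=\delta_{\vec x^{(0)}}^{\vec x^{(1)}}$. - Symmetry, for $|\vec X|=m$, $|\vec Y|=n$: $\sigma_{\vec X,\vec Y}=\delta_{\vec x_{1..m}^{(0)}}^{\vec x_{n+1..n+m}^{(1)}}\,\delta_{\vec y_{m+1..m+n}^{(0)}}^{\vec y_{1..n}^{(1)}}$. - Trace, for $\xi:\vec U\otimes\vec X\to\vec V\otimes\vec X$ with $|\vec U|=m,|\vec V|=n,|\vec X|=k$: writing $\xi=\xi_{\vec u_{1..m}^{(0)}\vec x_{m+1..m+k}^{(0)}}^{\vec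 v_{1..n}^{(1)}\vec x_{n+1..n+k}^{(1)}}$, $\mathrm{Tr}^{\vec X}(\xi)=\xi_{\vec u_{1..m}^{(0)}\vec{x'}}^{\vec v_{1..n}^{(1)}\vec{x'}}$. **Traced symmetric monoidal category.** A symmetric monoidal category $\mathcal C$ with functions $\mathrm{Tr}^X:\hom(A\otimes X,B\otimes X)\to\hom(A,B)$ for all objects $A,B,X$ satisfying (structure isomorphisms suppressed): (1) $\mathrm{Tr}^X((g\otimes X)\circ f\circ(h\otimes X))=g\circ\mathrm{Tr}^X(f)\circ h$; (2) $\mathrm{Tr}^Y(f\circ(A\otimes g))=\mathrm{Tr}^X((B\otimes g)\circ f)$; (3) $\mathrm{Tr}^I(f)=f$ and $\mathrm{Tr}^{X\otimes Y}(f)=\mathrm{Tr}^X(\mathrm{Tr}^Y(f))$; (4) $\mathrm{Tr}^X(g\otimes f)=g\otimes\mathrm{Tr}^X(f)$; (5) $\mathrm{Tr}^X(\sigma_{X,X})=1_X$. Strict means the associator and unitors are identities. *)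

theory Defs
  imports Main "HOL-Library.FuncSet"
begin

section \<open>Abstract tensor systems\<close>

text \<open>
  The family of sets T(x, y) and the operations on it are given with explicit index sets, so that
  nothing is assumed about overlaps between different sets T(x, y).  Axioms and later definitions
  use the induced operations on tensors paired with their index sets.
\<close>

record ('u, 'l, 't) ats =
  types :: "'u set"
  labels :: "'l set"
  typing :: "'l \<Rightarrow> 'u"
  tens :: "'l set \<Rightarrow> 'l set \<Rightarrow> 't set"
  tens_mult :: "'l set \<Rightarrow> 'l set \<Rightarrow> 'l set \<Rightarrow> 'l set \<Rightarrow> 't \<Rightarrow> 't \<Rightarrow> 't"
  tens_contract :: "'l set \<Rightarrow> 'l set \<Rightarrow> 'l \<Rightarrow> 'l \<Rightarrow> 't \<Rightarrow> 't"
  tens_relabel :: "'l set \<Rightarrow> 'l set \<Rightarrow> ('l \<Rightarrow> 'l) \<Rightarrow> 't \<Rightarrow> 't"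
  tens_delta :: "'l \<Rightarrow> 'l \<Rightarrow> 't"
  tens_one :: "'t"

text \<open>A tensor together with its set of lower labels and its set of upper labels.\<close>

type_synonym ('l, 't) tensor = "'l set \<times> 'l set \<times> 't"

definition index_sets :: "('u, 'l, 't, 'z) ats_scheme \<Rightarrow> 'l set \<Rightarrow> 'l set \<Rightarrow> bool" where
  "index_sets S x y \<longleftrightarrow>
     finite x \<and> finite y \<and> x \<subseteq> labels S \<and> y \<subseteq> labels S \<and> x \<inter> y = {}"

definition tensors :: "('u, 'l, 't, 'z) ats_scheme \<Rightarrow> ('l, 't) tensor set" where
  "tensors S = {(x, y, t). index_sets S x y \<and> t \<in> tens S x y}"

fun lower :: "('l, 't) tensor \<Rightarrow> 'l set" where "lower (x, y, t) = x"
fun upper :: "('l, 't) tensor \<Rightarrow> 'l set" where "upper (x, y, t) = y"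
fun element :: "('l, 't) tensor \<Rightarrow> 't" where "element (x, y, t) = t"

definition labs :: "('l, 't) tensor \<Rightarrow> 'l set" where
  "labs \<psi> = lower \<psi> \<union> upper \<psi>"

fun mult :: "('u, 'l, 't, 'z) ats_scheme \<Rightarrow> ('l, 't) tensor \<Rightarrow> ('l, 't) tensor \<Rightarrow> ('l, 't) tensor"
  where "mult S (x, y, s) (x', y', t) = (x \<union> x', y \<union> y', tens_mult S x y x' y' s t)"

text \<open>In \<open>contract S a b \<psi>\<close>, \<open>a\<close> is a lower and \<open>b\<close> an upper label;
  in \<open>delta S a b\<close>, \<open>a\<close> is the lower and \<open>b\<close> the upper label.\<close>

fun contract :: "('u, 'l, 't, 'z) ats_scheme \<Rightarrow> 'l \<Rightarrow> 'l \<Rightarrow> ('l, 't) tensor \<Rightarrow> ('l, 't) tensor"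
  where "contract S a b (x, y, t) = (x - {a}, y - {b}, tens_contract S x y a b t)"

text \<open>A function with domain \<open>x \<union> y\<close> is an element of \<open>extensional (x \<union> y)\<close>; restricting \<open>f\<close>
  makes relabelling depend only on the values of \<open>f\<close> on the labels of the tensor.\<close>

fun relabel :: "('u, 'l, 't, 'z) ats_scheme \<Rightarrow> ('l \<Rightarrow> 'l) \<Rightarrow> ('l, 't) tensor \<Rightarrow> ('l, 't) tensor"
  where "relabel S f (x, y, t) = (f ` x, f ` y, tens_relabel S x y (restrict f (x \<union> y)) t)"

definition delta :: "('u, 'l, 't, 'z) ats_scheme \<Rightarrow> 'l \<Rightarrow> 'l \<Rightarrow> ('l, 't) tensor" where
  "delta S a b = ({a}, {b}, tens_delta S a b)"

definition one :: "('u, 'l, 't, 'z) ats_scheme \<Rightarrow> ('l, 't) tensor" where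
  "one S = ({}, {}, tens_one S)"

definition contractible :: "('u, 'l, 't, 'z) ats_scheme \<Rightarrow> 'l \<Rightarrow> 'l \<Rightarrow> ('l, 't) tensor \<Rightarrow> bool" where
  "contractible S a b \<psi> \<longleftrightarrow> a \<in> lower \<psi> \<and> b \<in> upper \<psi> \<and> typing S a = typing S b"

definition relabelling :: "('u, 'l, 't, 'z) ats_scheme \<Rightarrow> ('l \<Rightarrow> 'l) \<Rightarrow> 'l set \<Rightarrow> bool" where
  "relabelling S f A \<longleftrightarrow>
     inj_on f A \<and> f ` A \<subseteq> labels S \<and> (\<forall>a\<in>A. typing S (f a) = typing S a)"

definition delta_pair :: "('u, 'l, 't, 'z) ats_scheme \<Rightarrow> 'l \<Rightarrow> 'l \<Rightarrow> bool" where
  "delta_pair S a b \<longleftrightarrow>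
     a \<in> labels S \<and> b \<in> labels S \<and> a \<noteq> b \<and> typing S a = typing S b"

locale abstract_tensor_system =
  fixes S :: "('u, 'l, 't, 'z) ats_scheme" (structure)
  assumes typing_closed: "a \<in> labels S \<Longrightarrow> typing S a \<in> types S"
    and infinite_labels: "X \<in> types S \<Longrightarrow> infinite {a \<in> labels S. typing S a = X}"
    and mult_closed:
      "\<lbrakk>\<psi> \<in> tensors S; \<phi> \<in> tensors S; labs \<psi> \<inter> labs \<phi> = {}\<rbrakk> \<Longrightarrow> mult S \<psi> \<phi> \<in> tensors S"
    and contract_closed:
      "\<lbrakk>\<psi> \<in> tensors S; contractible S a b \<psi>\<rbrakk> \<Longrightarrow> contract S a b \<psi> \<in> tensors S"
    and relabel_bij:
      "\<lbrakk>index_sets S x y; f \<in> extensional (x \<union> y); relabelling S f (x \<union> y)\<rbrakk>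
       \<Longrightarrow> bij_betw (tens_relabel S x y f) (tens S x y) (tens S (f ` x) (f ` y))"
    and delta_closed: "delta_pair S a b \<Longrightarrow> delta S a b \<in> tensors S"
    and one_closed: "one S \<in> tensors S"
    and T1:
      "\<lbrakk>\<psi> \<in> tensors S; contractible S a b \<psi>; contractible S a' b' \<psi>; a \<noteq> a'; b \<noteq> b'\<rbrakk>
       \<Longrightarrow> contract S a b (contract S a' b' \<psi>) = contract S a' b' (contract S a b \<psi>)"
    and T2_assoc:
      "\<lbrakk>\<psi> \<in> tensors S; \<phi> \<in> tensors S; \<xi> \<in> tensors S;
        labs \<psi> \<inter> labs \<phi> = {}; labs \<psi> \<inter> labs \<xi> = {}; labs \<phi> \<inter> labs \<xi> = {}\<rbrakk>
       \<Longrightarrow> mult S (mult S \<psi> \<phi>) \<xi> = mult S \<psi> (mult S \<phi> \<xi>)"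
    and T2_unit_right: "\<psi> \<in> tensors S \<Longrightarrow> mult S \<psi> (one S) = \<psi>"
    and T2_unit_left: "\<psi> \<in> tensors S \<Longrightarrow> mult S (one S) \<psi> = \<psi>"
    and T2_comm:
      "\<lbrakk>\<psi> \<in> tensors S; \<phi> \<in> tensors S; labs \<psi> \<inter> labs \<phi> = {}\<rbrakk>
       \<Longrightarrow> mult S \<psi> \<phi> = mult S \<phi> \<psi>"
    and T3:
      "\<lbrakk>\<psi> \<in> tensors S; \<phi> \<in> tensors S; labs \<psi> \<inter> labs \<phi> = {}; contractible S a b \<psi>\<rbrakk>
       \<Longrightarrow> contract S a b (mult S \<psi> \<phi>) = mult S (contract S a b \<psi>) \<phi>"
    \<comment> \<open>In T4 the label \<open>b\<close> has to belong to \<open>\<psi>\<close>, as it is in the domain of the relabelling;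
       in particular T4 says nothing about the closed loop obtained by contracting a delta
       with itself.\<close>
    and T4_upper:
      "\<lbrakk>\<psi> \<in> tensors S; delta_pair S a c; a \<notin> labs \<psi>; c \<notin> labs \<psi>;
        b \<in> upper \<psi>; typing S a = typing S b\<rbrakk>
       \<Longrightarrow> contract S a b (mult S (delta S a c) \<psi>) = relabel S (id(b := c)) \<psi>"
    and T4_lower:
      "\<lbrakk>\<psi> \<in> tensors S; delta_pair S a c; a \<notin> labs \<psi>; c \<notin> labs \<psi>;
        b \<in> lower \<psi>; typing S b = typing S c\<rbrakk>
       \<Longrightarrow> contract S b c (mult S (delta S a c) \<psi>) = relabel S (id(b := a)) \<psi>"
    and L1_comp:
      "\<lbrakk>\<psi> \<in> tensors S; relabelling S f (labs \<psi>); relabelling S g (f ` labs \<psi>)\<rbrakk>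
       \<Longrightarrow> relabel S g (relabel S f \<psi>) = relabel S (g \<circ> f) \<psi>"
    and L1_id: "\<psi> \<in> tensors S \<Longrightarrow> relabel S id \<psi> = \<psi>"
    and L2:
      "\<lbrakk>\<psi> \<in> tensors S; \<phi> \<in> tensors S; labs \<psi> \<inter> labs \<phi> = {};
        relabelling S f (labs \<psi>); f ` labs \<psi> \<inter> labs \<phi> = {}\<rbrakk>
       \<Longrightarrow> mult S (relabel S f \<psi>) \<phi> =
           relabel S (\<lambda>l. if l \<in> labs \<phi> then l else f l) (mult S \<psi> \<phi>)"
    and L3:
      "\<lbrakk>\<psi> \<in> tensors S; contractible S a b \<psi>; relabelling S f (labs \<psi>)\<rbrakk>
       \<Longrightarrow> relabel S f (contract S a b \<psi>) = contract S (f a) (f b) (relabel S f \<psi>)"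
    and L4:
      "\<lbrakk>delta_pair S a b; delta_pair S a' b'; typing S a' = typing S a\<rbrakk>
       \<Longrightarrow> relabel S (id(a := a', b := b')) (delta S a b) = delta S a' b'"


section \<open>Einstein notation\<close>

text \<open>The substitution sending \<open>xs ! i\<close> to \<open>as ! i\<close> and fixing all other labels.\<close>

definition subst :: "'l list \<Rightarrow> 'l list \<Rightarrow> 'l \<Rightarrow> 'l" where
  "subst xs as l = (case map_of (zip xs as) l of None \<Rightarrow> l | Some a \<Rightarrow> a)"

definition is_fresh :: "('u, 'l, 't, 'z) ats_scheme \<Rightarrow> 'u list \<Rightarrow> 'l set \<Rightarrow> 'l list \<Rightarrow> bool" where
  "is_fresh S X V xs \<longleftrightarrow>
     distinct xs \<and> set xs \<subseteq> labels S - V \<and> map (typing S) xs = X"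

text \<open>An arbitrary list of pairwise distinct labels of types \<open>X\<close> avoiding \<open>V\<close>.\<close>

definition fresh :: "('u, 'l, 't, 'z) ats_scheme \<Rightarrow> 'u list \<Rightarrow> 'l set \<Rightarrow> 'l list" where
  "fresh S X V = (SOME xs. is_fresh S X V xs)"

text \<open>
  \<open>Symbol \<psi> xs as ys bs\<close> is the symbol \<open>\<psi>\<close> with lower indices \<open>as\<close> and upper indices \<open>bs\<close>, where
  \<open>xs\<close> and \<open>ys\<close> list the lower and upper labels of \<open>\<psi>\<close>.  It is kept as syntax, because it need not
  denote a relabelling of \<open>\<psi>\<close> by itself when \<open>as\<close> and \<open>bs\<close> share labels.
\<close>

datatype ('l, 't) symbol =
  Symbol (base: "('l, 't) tensor")
    (lower_list: "'l list") (lower_inds: "'l list")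
    (upper_list: "'l list") (upper_inds: "'l list")

definition repeated :: "('l, 't) symbol list \<Rightarrow> 'l list" where
  "repeated es =
     filter (\<lambda>a. a \<in> set (concat (map upper_inds es))) (concat (map lower_inds es))"

definition einstein :: "('u, 'l, 't, 'z) ats_scheme \<Rightarrow> ('l, 't) symbol list \<Rightarrow> ('l, 't) tensor" where
  "einstein S es =
     (let as = repeated es;
          bars = fresh S (map (typing S) as)
            (set (concat (map lower_inds es)) \<union> set (concat (map upper_inds es)));
          factor = (\<lambda>e. relabel S
            (subst (lower_list e @ upper_list e)
                   (lower_inds e @ map (subst as bars) (upper_inds e))) (base e))
      in foldr (\<lambda>(a, b). contract S a b) (zip as bars)
           (foldr (mult S) (map factor es) (one S)))"

definition deltas :: "('u, 'l, 't, 'z) ats_scheme \<Rightarrow> 'l list \<Rightarrow> 'l list \<Rightarrow> ('l, 't) tensor" where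
  "deltas S xs ys = foldr (mult S) (map2 (delta S) xs ys) (one S)"


section \<open>Traced symmetric monoidal categories\<close>

record ('o, 'a) category =
  Obj :: "'o set"
  Hom :: "'o \<Rightarrow> 'o \<Rightarrow> 'a set"
  Comp :: "'a \<Rightarrow> 'a \<Rightarrow> 'a" (infixl "\<bullet>\<index>" 65)
  Ident :: "'o \<Rightarrow> 'a"

record ('o, 'a) monoidal_category = "('o, 'a) category" +
  TensObj :: "'o \<Rightarrow> 'o \<Rightarrow> 'o" (infixl "\<otimes>\<index>" 75)
  TensArr :: "'a \<Rightarrow> 'a \<Rightarrow> 'a" (infixl "\<boxtimes>\<index>" 75)
  UnitObj :: "'o"
  Assoc :: "'o \<Rightarrow> 'o \<Rightarrow> 'o \<Rightarrow> 'a"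
  LUnit :: "'o \<Rightarrow> 'a"
  RUnit :: "'o \<Rightarrow> 'a"

record ('o, 'a) symmetric_monoidal_category = "('o, 'a) monoidal_category" +
  Symm :: "'o \<Rightarrow> 'o \<Rightarrow> 'a"

text \<open>\<open>Trace C A B X\<close> maps the hom-set from \<open>A \<otimes> X\<close> to \<open>B \<otimes> X\<close> to the hom-set from \<open>A\<close> to \<open>B\<close>.\<close>

record ('o, 'a) traced_category = "('o, 'a) symmetric_monoidal_category" +
  Trace :: "'o \<Rightarrow> 'o \<Rightarrow> 'o \<Rightarrow> 'a \<Rightarrow> 'a"

definition inverse_arrows :: "('o, 'a, 'z) category_scheme \<Rightarrow> 'o \<Rightarrow> 'o \<Rightarrow> 'a \<Rightarrow> 'a \<Rightarrow> bool" where
  "inverse_arrows C X Y f g \<longleftrightarrow>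
     f \<in> Hom C X Y \<and> g \<in> Hom C Y X \<and>
     g \<bullet>\<^bsub>C\<^esub> f = Ident C X \<and> f \<bullet>\<^bsub>C\<^esub> g = Ident C Y"

definition iso_arrow :: "('o, 'a, 'z) category_scheme \<Rightarrow> 'o \<Rightarrow> 'o \<Rightarrow> 'a \<Rightarrow> bool" where
  "iso_arrow C X Y f \<longleftrightarrow> (\<exists>g. inverse_arrows C X Y f g)"

definition inv_arrow :: "('o, 'a, 'z) category_scheme \<Rightarrow> 'o \<Rightarrow> 'o \<Rightarrow> 'a \<Rightarrow> 'a" where
  "inv_arrow C X Y f = (THE g. inverse_arrows C X Y f g)"

locale category =
  fixes C :: "('o, 'a, 'z) category_scheme" (structure)
  assumes hom_disjoint:
      "\<lbrakk>X \<in> Obj C; Y \<in> Obj C; X' \<in> Obj C; Y' \<in> Obj C; f \<in> Hom C X Y; f \<in> Hom C X' Y'\<rbrakk>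
       \<Longrightarrow> X = X' \<and> Y = Y'"
    and comp_closed:
      "\<lbrakk>X \<in> Obj C; Y \<in> Obj C; Z \<in> Obj C; f \<in> Hom C X Y; g \<in> Hom C Y Z\<rbrakk>
       \<Longrightarrow> g \<bullet> f \<in> Hom C X Z"
    and comp_assoc:
      "\<lbrakk>W \<in> Obj C; X \<in> Obj C; Y \<in> Obj C; Z \<in> Obj C;
        f \<in> Hom C W X; g \<in> Hom C X Y; h \<in> Hom C Y Z\<rbrakk>
       \<Longrightarrow> h \<bullet> (g \<bullet> f) = (h \<bullet> g) \<bullet> f"
    and ident_closed: "X \<in> Obj C \<Longrightarrow> Ident C X \<in> Hom C X X"
    and ident_left:
      "\<lbrakk>X \<in> Obj C; Y \<in> Obj C; f \<in> Hom C X Y\<rbrakk> \<Longrightarrow> Ident C Y \<bullet> f = f"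
    and ident_right:
      "\<lbrakk>X \<in> Obj C; Y \<in> Obj C; f \<in> Hom C X Y\<rbrakk> \<Longrightarrow> f \<bullet> Ident C X = f"

locale monoidal_category = category C
  for C :: "('o, 'a, 'z) monoidal_category_scheme" (structure) +
  assumes unit_closed: "UnitObj C \<in> Obj C"
    and tens_obj_closed: "\<lbrakk>X \<in> Obj C; Y \<in> Obj C\<rbrakk> \<Longrightarrow> X \<otimes> Y \<in> Obj C"
    and tens_arr_closed:
      "\<lbrakk>X \<in> Obj C; Y \<in> Obj C; U \<in> Obj C; V \<in> Obj C; f \<in> Hom C X Y; g \<in> Hom C U V\<rbrakk>
       \<Longrightarrow> f \<boxtimes> g \<in> Hom C (X \<otimes> U) (Y \<otimes> V)"
    and tens_ident:
      "\<lbrakk>X \<in> Obj C; Y \<in> Obj C\<rbrakk> \<Longrightarrow> Ident C X \<boxtimes> Ident C Y = Ident C (X \<otimes> Y)"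
    and interchange:
      "\<lbrakk>X \<in> Obj C; Y \<in> Obj C; Z \<in> Obj C; U \<in> Obj C; V \<in> Obj C; W \<in> Obj C;
        f \<in> Hom C X Y; g \<in> Hom C Y Z; h \<in> Hom C U V; k \<in> Hom C V W\<rbrakk>
       \<Longrightarrow> (g \<bullet> f) \<boxtimes> (k \<bullet> h) = (g \<boxtimes> k) \<bullet> (f \<boxtimes> h)"
    and assoc_iso:
      "\<lbrakk>X \<in> Obj C; Y \<in> Obj C; Z \<in> Obj C\<rbrakk>
       \<Longrightarrow> iso_arrow C ((X \<otimes> Y) \<otimes> Z) (X \<otimes> (Y \<otimes> Z)) (Assoc C X Y Z)"
    and assoc_natural:
      "\<lbrakk>X \<in> Obj C; Y \<in> Obj C; Z \<in> Obj C; X' \<in> Obj C; Y' \<in> Obj C; Z' \<in> Obj C;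
        f \<in> Hom C X X'; g \<in> Hom C Y Y'; h \<in> Hom C Z Z'\<rbrakk>
       \<Longrightarrow> Assoc C X' Y' Z' \<bullet> ((f \<boxtimes> g) \<boxtimes> h) = (f \<boxtimes> (g \<boxtimes> h)) \<bullet> Assoc C X Y Z"
    and lunit_iso: "X \<in> Obj C \<Longrightarrow> iso_arrow C (UnitObj C \<otimes> X) X (LUnit C X)"
    and lunit_natural:
      "\<lbrakk>X \<in> Obj C; Y \<in> Obj C; f \<in> Hom C X Y\<rbrakk>
       \<Longrightarrow> LUnit C Y \<bullet> (Ident C (UnitObj C) \<boxtimes> f) = f \<bullet> LUnit C X"
    and runit_iso: "X \<in> Obj C \<Longrightarrow> iso_arrow C (X \<otimes> UnitObj C) X (RUnit C X)"
    and runit_natural: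
      "\<lbrakk>X \<in> Obj C; Y \<in> Obj C; f \<in> Hom C X Y\<rbrakk>
       \<Longrightarrow> RUnit C Y \<bullet> (f \<boxtimes> Ident C (UnitObj C)) = f \<bullet> RUnit C X"
    and pentagon:
      "\<lbrakk>W \<in> Obj C; X \<in> Obj C; Y \<in> Obj C; Z \<in> Obj C\<rbrakk>
       \<Longrightarrow> Assoc C W X (Y \<otimes> Z) \<bullet> Assoc C (W \<otimes> X) Y Z =
           (Ident C W \<boxtimes> Assoc C X Y Z) \<bullet> Assoc C W (X \<otimes> Y) Z
             \<bullet> (Assoc C W X Y \<boxtimes> Ident C Z)"
    and triangle:
      "\<lbrakk>X \<in> Obj C; Y \<in> Obj C\<rbrakk>
       \<Longrightarrow> (Ident C X \<boxtimes> LUnit C Y) \<bullet> Assoc C X (UnitObj C) Y = RUnit C X \<boxtimes> Ident C Y"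

locale symmetric_monoidal_category = monoidal_category C
  for C :: "('o, 'a, 'z) symmetric_monoidal_category_scheme" (structure) +
  assumes symm_closed:
      "\<lbrakk>X \<in> Obj C; Y \<in> Obj C\<rbrakk> \<Longrightarrow> Symm C X Y \<in> Hom C (X \<otimes> Y) (Y \<otimes> X)"
    and symm_natural:
      "\<lbrakk>X \<in> Obj C; Y \<in> Obj C; X' \<in> Obj C; Y' \<in> Obj C; f \<in> Hom C X X'; g \<in> Hom C Y Y'\<rbrakk>
       \<Longrightarrow> Symm C X' Y' \<bullet> (f \<boxtimes> g) = (g \<boxtimes> f) \<bullet> Symm C X Y"
    and symm_involutive:
      "\<lbrakk>X \<in> Obj C; Y \<in> Obj C\<rbrakk> \<Longrightarrow> Symm C Y X \<bullet> Symm C X Y = Ident C (X \<otimes> Y)"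
    and symm_unit: "X \<in> Obj C \<Longrightarrow> LUnit C X \<bullet> Symm C X (UnitObj C) = RUnit C X"
    and hexagon:
      "\<lbrakk>X \<in> Obj C; Y \<in> Obj C; Z \<in> Obj C\<rbrakk>
       \<Longrightarrow> Assoc C Y Z X \<bullet> Symm C X (Y \<otimes> Z) \<bullet> Assoc C X Y Z =
           (Ident C Y \<boxtimes> Symm C X Z) \<bullet> Assoc C Y X Z \<bullet> (Symm C X Y \<boxtimes> Ident C Z)"

locale traced_symmetric_monoidal_category = symmetric_monoidal_category C
  for C :: "('o, 'a, 'z) traced_category_scheme" (structure) +
  assumes trace_closed:
      "\<lbrakk>A \<in> Obj C; B \<in> Obj C; X \<in> Obj C; f \<in> Hom C (A \<otimes> X) (B \<otimes> X)\<rbrakk>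
       \<Longrightarrow> Trace C A B X f \<in> Hom C A B"
    and trace_natural:
      "\<lbrakk>A \<in> Obj C; B \<in> Obj C; A' \<in> Obj C; B' \<in> Obj C; X \<in> Obj C;
        f \<in> Hom C (A \<otimes> X) (B \<otimes> X); g \<in> Hom C B B'; h \<in> Hom C A' A\<rbrakk>
       \<Longrightarrow> Trace C A' B' X ((g \<boxtimes> Ident C X) \<bullet> f \<bullet> (h \<boxtimes> Ident C X)) =
           g \<bullet> Trace C A B X f \<bullet> h"
    and trace_sliding:
      "\<lbrakk>A \<in> Obj C; B \<in> Obj C; X \<in> Obj C; Y \<in> Obj C;
        f \<in> Hom C (A \<otimes> X) (B \<otimes> Y); g \<in> Hom C Y X\<rbrakk>
       \<Longrightarrow> Trace C A B Y (f \<bullet> (Ident C A \<boxtimes> g)) = Trace C A B X ((Ident C B \<boxtimes> g) \<bullet> f)"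
    and trace_unit:
      "\<lbrakk>A \<in> Obj C; B \<in> Obj C; f \<in> Hom C (A \<otimes> UnitObj C) (B \<otimes> UnitObj C)\<rbrakk>
       \<Longrightarrow> Trace C A B (UnitObj C) f =
           RUnit C B \<bullet> f \<bullet> inv_arrow C (A \<otimes> UnitObj C) A (RUnit C A)"
    and trace_tens:
      "\<lbrakk>A \<in> Obj C; B \<in> Obj C; X \<in> Obj C; Y \<in> Obj C;
        f \<in> Hom C (A \<otimes> (X \<otimes> Y)) (B \<otimes> (X \<otimes> Y))\<rbrakk>
       \<Longrightarrow> Trace C A B (X \<otimes> Y) f =
           Trace C A B X (Trace C (A \<otimes> X) (B \<otimes> X) Y
             (inv_arrow C ((B \<otimes> X) \<otimes> Y) (B \<otimes> (X \<otimes> Y)) (Assoc C B X Y) \<bullet> f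
                \<bullet> Assoc C A X Y))"
    and trace_superposing:
      "\<lbrakk>A \<in> Obj C; B \<in> Obj C; U \<in> Obj C; V \<in> Obj C; X \<in> Obj C;
        f \<in> Hom C (A \<otimes> X) (B \<otimes> X); g \<in> Hom C U V\<rbrakk>
       \<Longrightarrow> Trace C (U \<otimes> A) (V \<otimes> B) X
             (inv_arrow C ((V \<otimes> B) \<otimes> X) (V \<otimes> (B \<otimes> X)) (Assoc C V B X) \<bullet> (g \<boxtimes> f)
                \<bullet> Assoc C U A X) =
           g \<boxtimes> Trace C A B X f"
    and trace_yanking: "X \<in> Obj C \<Longrightarrow> Trace C X X X (Symm C X X) = Ident C X"

locale strict_traced_symmetric_monoidal_category = traced_symmetric_monoidal_category C
  for C :: "('o, 'a, 'z) traced_category_scheme" (structure) +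
  assumes strict_assoc_obj:
      "\<lbrakk>X \<in> Obj C; Y \<in> Obj C; Z \<in> Obj C\<rbrakk> \<Longrightarrow> (X \<otimes> Y) \<otimes> Z = X \<otimes> (Y \<otimes> Z)"
    and strict_lunit_obj: "X \<in> Obj C \<Longrightarrow> UnitObj C \<otimes> X = X"
    and strict_runit_obj: "X \<in> Obj C \<Longrightarrow> X \<otimes> UnitObj C = X"
    and strict_assoc:
      "\<lbrakk>X \<in> Obj C; Y \<in> Obj C; Z \<in> Obj C\<rbrakk> \<Longrightarrow> Assoc C X Y Z = Ident C (X \<otimes> (Y \<otimes> Z))"
    and strict_lunit: "X \<in> Obj C \<Longrightarrow> LUnit C X = Ident C X"
    and strict_runit: "X \<in> Obj C \<Longrightarrow> RUnit C X = Ident C X"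


section \<open>The category of an abstract tensor system\<close>

text \<open>\<open>c (X, i, \<epsilon>)\<close> is the canonical label \<open>x\<^sub>i\<^sup>(\<^sup>\<epsilon>\<^sup>)\<close>.\<close>

definition canonical_labels ::
  "('u, 'l, 't, 'z) ats_scheme \<Rightarrow> 'l set \<Rightarrow> ('u \<times> nat \<times> nat \<Rightarrow> 'l) \<Rightarrow> bool" where
  "canonical_labels S Lc c \<longleftrightarrow>
     Lc \<subseteq> labels S \<and> bij_betw c (types S \<times> UNIV \<times> {0, 1}) Lc \<and>
     (\<forall>X\<in>types S. \<forall>i. \<forall>\<epsilon>\<in>{0, 1}. typing S (c (X, i, \<epsilon>)) = X)"

text \<open>The list of labels \<open>(X\<^sub>1, s+1, \<epsilon>), \<dots>, (X\<^sub>N, s+N, \<epsilon>)\<close>; the list \<open>X\<close> itself is indexed from 0.\<close>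

definition canon :: "('u \<times> nat \<times> nat \<Rightarrow> 'l) \<Rightarrow> nat \<Rightarrow> nat \<Rightarrow> 'u list \<Rightarrow> 'l list" where
  "canon c \<epsilon> s X = map (\<lambda>i. c (X ! i, s + i + 1, \<epsilon>)) [0..<length X]"

text \<open>Arrows are tagged with domain and codomain, which makes the hom-sets disjoint.\<close>

type_synonym ('u, 't) arrow = "'u list \<times> 'u list \<times> 't"

definition ats_hom ::
  "('u, 'l, 't, 'z) ats_scheme \<Rightarrow> ('u \<times> nat \<times> nat \<Rightarrow> 'l) \<Rightarrow>
   'u list \<Rightarrow> 'u list \<Rightarrow> ('u, 't) arrow set" where
  "ats_hom S c X Y = {X} \<times> {Y} \<times> tens S (set (canon c 0 0 X)) (set (canon c 1 0 Y))"

fun arrow_tensor :: "('u \<times> nat \<times> nat \<Rightarrow> 'l) \<Rightarrow> ('u, 't) arrow \<Rightarrow> ('l, 't) tensor" where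
  "arrow_tensor c (X, Y, t) = (set (canon c 0 0 X), set (canon c 1 0 Y), t)"

fun ats_comp ::
  "('u, 'l, 't, 'z) ats_scheme \<Rightarrow> ('u \<times> nat \<times> nat \<Rightarrow> 'l) \<Rightarrow>
   ('u, 't) arrow \<Rightarrow> ('u, 't) arrow \<Rightarrow> ('u, 't) arrow" where
  "ats_comp S c (Y, Z, \<phi>) (X, Y', \<psi>) =
     (let x = canon c 0 0 X; y0 = canon c 0 0 Y; y1 = canon c 1 0 Y; z = canon c 1 0 Z;
          y' = fresh S Y (set x \<union> set y0 \<union> set y1 \<union> set z)
      in (X, Z, element (einstein S
            [Symbol (arrow_tensor c (X, Y, \<psi>)) x x y1 y',
             Symbol (arrow_tensor c (Y, Z, \<phi>)) y0 y' z z])))"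

fun ats_tens ::
  "('u, 'l, 't, 'z) ats_scheme \<Rightarrow> ('u \<times> nat \<times> nat \<Rightarrow> 'l) \<Rightarrow>
   ('u, 't) arrow \<Rightarrow> ('u, 't) arrow \<Rightarrow> ('u, 't) arrow" where
  "ats_tens S c (X, Y, \<psi>) (U, V, \<psi>') =
     (X @ U, Y @ V, element (einstein S
        [Symbol (arrow_tensor c (X, Y, \<psi>))
           (canon c 0 0 X) (canon c 0 0 X) (canon c 1 0 Y) (canon c 1 0 Y),
         Symbol (arrow_tensor c (U, V, \<psi>'))
           (canon c 0 0 U) (canon c 0 (length X) U)
           (canon c 1 0 V) (canon c 1 (length Y) V)]))"

definition ats_ident ::
  "('u, 'l, 't, 'z) ats_scheme \<Rightarrow> ('u \<times> nat \<times> nat \<Rightarrow> 'l) \<Rightarrow> 'u list \<Rightarrow> ('u, 't) arrow" where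
  "ats_ident S c X = (X, X, element (deltas S (canon c 0 0 X) (canon c 1 0 X)))"

definition ats_symm ::
  "('u, 'l, 't, 'z) ats_scheme \<Rightarrow> ('u \<times> nat \<times> nat \<Rightarrow> 'l) \<Rightarrow>
   'u list \<Rightarrow> 'u list \<Rightarrow> ('u, 't) arrow" where
  "ats_symm S c X Y =
     (X @ Y, Y @ X, element (mult S
        (deltas S (canon c 0 0 X) (canon c 1 (length Y) X))
        (deltas S (canon c 0 (length X) Y) (canon c 1 0 Y))))"

fun ats_trace ::
  "('u, 'l, 't, 'z) ats_scheme \<Rightarrow> ('u \<times> nat \<times> nat \<Rightarrow> 'l) \<Rightarrow>
   'u list \<Rightarrow> 'u list \<Rightarrow> 'u list \<Rightarrow> ('u, 't) arrow \<Rightarrow> ('u, 't) arrow" where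
  "ats_trace S c U V X (A, B, \<xi>) =
     (let u = canon c 0 0 U; x0 = canon c 0 (length U) X;
          v = canon c 1 0 V; x1 = canon c 1 (length V) X;
          x' = fresh S X (set u \<union> set x0 \<union> set v \<union> set x1)
      in (U, V, element (einstein S
            [Symbol (arrow_tensor c (U @ X, V @ X, \<xi>)) (u @ x0) (u @ x') (v @ x1) (v @ x')])))"

definition ats_category ::
  "('u, 'l, 't, 'z) ats_scheme \<Rightarrow> ('u \<times> nat \<times> nat \<Rightarrow> 'l) \<Rightarrow>
   ('u list, ('u, 't) arrow) traced_category" where
  "ats_category S c =
     \<lparr> Obj = lists (types S),
       Hom = ats_hom S c,
       Comp = ats_comp S c,
       Ident = ats_ident S c,
       TensObj = (@),
       TensArr = ats_tens S c,
       UnitObj = [],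
       Assoc = (\<lambda>X Y Z. ats_ident S c (X @ Y @ Z)),
       LUnit = ats_ident S c,
       RUnit = ats_ident S c,
       Symm = ats_symm S c,
       Trace = ats_trace S c \<rparr>"

end

theory Submission
  imports Defs
begin

text \<open>
  For an arrow \<open>f\<close> and lists of labels \<open>a\<close>, \<open>b\<close> of the types of its domain and codomain, let
  \<open>place f a b\<close> be the tensor of \<open>f\<close> with lower labels \<open>a\<close> and upper labels \<open>b\<close>.
  The relabelling axioms make the placement of a composite, a product or a trace a contraction of
  placed tensors over arbitrary fresh labels, independent of the labels chosen in the definitions.
  Since relabelling is injective, two arrows are equal as soon as they agree at one placement, so
  every axiom can be checked after giving all occurring wires distinct labels. There it follows
  from the commutation of contractions with each other (T1) and with products (T3), and from the
  fact that contracting with a product of deltas is a relabelling (T4).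
\<close>


section \<open>Substitutions\<close>

text \<open>Direct calculation with the definitions is obstructed in two ways: all arrows draw on
  one stock of canonical labels, so arrows with a common domain of positive length cannot even be
  multiplied, and connecting labels come from \<open>SOME\<close>. Each contracted wire carries two
  labels throughout, one for its upper and one for its lower end, since the index sets of a tensor
  are disjoint. Distinct labels also keep T4 applicable: it requires the labels of a delta to be
  absent from the other factor, so closed loops are never evaluated; in yanking the contraction
  joins two different deltas. The axioms that put an arrow next to an identity produce extra deltas
  on the idle wires. These are eliminated once, for pre- and postcomposition on either side, after
  which the trace axioms compare contractions of the proper arrows only. Strictness rests on the
  shifts in the definition of the product: the canonical labels of a concatenation are the
  concatenated, shifted lists.\<close>

lemma subst_notin: "l \<notin> set xs \<Longrightarrow> subst xs as l = l"
  by (auto simp: subst_def split: option.split dest!: map_of_SomeD dest: set_zip_leftD)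

lemma map_subst_self:
  "distinct xs \<Longrightarrow> length xs = length as \<Longrightarrow> map (subst xs as) xs = as"
  by (auto simp: subst_def map_of_zip_nth intro!: nth_equalityI)

lemma map_subst_disjoint: "set xs \<inter> set ys = {} \<Longrightarrow> map (subst xs as) ys = ys"
  by (rule map_idI, rule subst_notin) auto

text \<open>\<open>map_of\<close> returns the first match, so the first block shadows the second
  even where the two overlap.\<close>

lemma subst_append:
  "length xs = length as \<Longrightarrow>
   subst (xs @ ys) (as @ bs) l = (if l \<in> set xs then subst xs as l else subst ys bs l)"
  by (cases "l \<in> set xs")
    (auto simp: subst_def map_add_def subst_notin[unfolded subst_def] split: option.splits
      dest!: map_of_SomeD dest: set_zip_leftD)

lemma map_subst_append1:
  "distinct xs \<Longrightarrow> length xs = length as \<Longrightarrow> map (subst (xs @ ys) (as @ bs)) xs = as"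
  using map_subst_self[of xs as] by (simp add: subst_append cong: map_cong)

lemma map_subst_append2:
  assumes "distinct (xs @ ys)" "length xs = length as" "length ys = length bs"
  shows "map (subst (xs @ ys) (as @ bs)) ys = bs"
proof -
  have "map (subst (xs @ ys) (as @ bs)) ys = map (subst ys bs) ys"
    using assms by (auto simp: subst_append)
  also have "\<dots> = bs" using assms by (intro map_subst_self) auto
  finally show ?thesis .
qed

lemma subst_in: "length xs = length as \<Longrightarrow> l \<in> set xs \<Longrightarrow> subst xs as l \<in> set as"
  by (induction xs as rule: list_induct2) (auto simp: subst_def)

lemma subst_Cons:
  "subst (x # xs) (a # as) l = (if l = x then a else subst xs as l)"
  by (simp add: subst_def)

lemma subst_Nil: "subst [] [] = id"
  by (auto simp: subst_def)

text \<open>Absorbs a map applied after a substitution into its target list; this is how successive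
  relabellings of a placed arrow merge into one.\<close>

lemma subst_map_in:
  "length xs = length as \<Longrightarrow> l \<in> set xs \<Longrightarrow> subst xs (map g as) l = g (subst xs as l)"
  by (induction xs as rule: list_induct2) (auto simp: subst_Cons)

text \<open>Reads off the effect of one simultaneous substitution on a middle block of wires; with
  empty \<open>vs\<close> and \<open>cs\<close> it also covers the last block.\<close>

lemma map_subst_block:
  assumes "distinct (us @ xs @ vs)" "length us = length as" "length xs = length bs"
  shows "map (subst (us @ xs @ vs) (as @ bs @ cs)) xs = bs"
proof -
  have "map (subst (us @ xs @ vs) (as @ bs @ cs)) xs = map (subst (xs @ vs) (bs @ cs)) xs"
    using assms by (auto simp: subst_append)
  also have "\<dots> = bs" using map_subst_append1[of xs bs vs cs] assms by simp
  finally show ?thesis .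
qed


section \<open>Tensors with their label sets\<close>

lemma lower_mult: "lower (mult S \<psi> \<phi>) = lower \<psi> \<union> lower \<phi>"
  by (cases \<psi>; cases \<phi>) simp

lemma upper_mult: "upper (mult S \<psi> \<phi>) = upper \<psi> \<union> upper \<phi>"
  by (cases \<psi>; cases \<phi>) simp

lemma lower_contract: "lower (contract S a b \<psi>) = lower \<psi> - {a}"
  by (cases \<psi>) simp

lemma upper_contract: "upper (contract S a b \<psi>) = upper \<psi> - {b}"
  by (cases \<psi>) simp

lemma lower_relabel: "lower (relabel S f \<psi>) = f ` lower \<psi>"
  by (cases \<psi>) simp

lemma upper_relabel: "upper (relabel S f \<psi>) = f ` upper \<psi>"
  by (cases \<psi>) simp

lemma labs_mult: "labs (mult S \<psi> \<phi>) = labs \<psi> \<union> labs \<phi>"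
  by (auto simp: labs_def lower_mult upper_mult)

lemma labs_relabel: "labs (relabel S f \<psi>) = f ` labs \<psi>"
  by (auto simp: labs_def lower_relabel upper_relabel)

text \<open>\<open>relabel\<close> restricts its map to the labels of the tensor before passing it
  on, so values elsewhere are irrelevant. This freedom is used to extend substitutions to labels
  that have been contracted away.\<close>

lemma relabel_cong:
  assumes "\<And>l. l \<in> labs \<psi> \<Longrightarrow> f l = g l"
  shows "relabel S f \<psi> = relabel S g \<psi>"
proof (cases \<psi>)
  case (fields x y t)
  with assms have e: "\<And>l. l \<in> x \<union> y \<Longrightarrow> f l = g l" by (auto simp: labs_def)
  then have "restrict f (x \<union> y) = restrict g (x \<union> y)" by (intro restrict_ext) auto
  moreover have "f ` x = g ` x" "f ` y = g ` y" using e by (auto intro!: image_cong)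
  ultimately show ?thesis by (simp add: fields)
qed

context abstract_tensor_system
begin

lemma tensors_index_sets:
  assumes "\<psi> \<in> tensors S"
  shows "finite (labs \<psi>)" "labs \<psi> \<subseteq> labels S" "lower \<psi> \<inter> upper \<psi> = {}"
  using assms by (cases \<psi>; auto simp: tensors_def index_sets_def labs_def)+

lemma relabel_closed:
  assumes "\<psi> \<in> tensors S" "relabelling S f (labs \<psi>)"
  shows "relabel S f \<psi> \<in> tensors S"
proof (cases \<psi>)
  case (fields x y t)
  have i: "index_sets S x y" and t: "t \<in> tens S x y"
    using assms by (auto simp: tensors_def fields)
  have r: "relabelling S f (x \<union> y)" using assms by (simp add: labs_def fields)
  then have "relabelling S (restrict f (x \<union> y)) (x \<union> y)"
    by (auto simp: relabelling_def)
  from relabel_bij[OF i _ this]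
  have "bij_betw (tens_relabel S x y (restrict f (x \<union> y))) (tens S x y) (tens S (f ` x) (f ` y))"
    by simp
  then have "tens_relabel S x y (restrict f (x \<union> y)) t \<in> tens S (f ` x) (f ` y)"
    using t by (auto dest: bij_betwE)
  moreover have "index_sets S (f ` x) (f ` y)"
  proof -
    have "f ` x \<inter> f ` y = f ` (x \<inter> y)"
      using r by (subst inj_on_image_Int[of f "x \<union> y"]) (auto simp: relabelling_def)
    then show ?thesis using i r by (auto simp: relabelling_def index_sets_def)
  qed
  ultimately show ?thesis by (simp add: fields tensors_def)
qed

text \<open>The label sets agree, so the inverse of \<open>f\<close> on them undoes the relabelling
  of both tensors; L1 merges it with \<open>f\<close> into the identity.\<close>

lemma relabel_eqD:
  assumes "\<psi> \<in> tensors S" "\<phi> \<in> tensors S" "lower \<psi> = lower \<phi>" "upper \<psi> = upper \<phi>"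
    "relabelling S f (labs \<psi>)" "relabel S f \<psi> = relabel S f \<phi>"
  shows "\<psi> = \<phi>"
proof -
  let ?g = "inv_into (labs \<psi>) f"
  have l: "labs \<phi> = labs \<psi>" using assms by (simp add: labs_def)
  have inj: "inj_on f (labs \<psi>)" using assms by (simp add: relabelling_def)
  have g: "relabelling S ?g (f ` labs \<psi>)"
    using assms(5) tensors_index_sets(2)[OF assms(1)]
    by (auto simp: relabelling_def intro!: inj_on_inv_into)
  have "relabel S (?g \<circ> f) \<chi> = \<chi>" if "\<chi> \<in> tensors S" "labs \<chi> = labs \<psi>" for \<chi>
    using that L1_id[OF that(1)] relabel_cong[of \<chi> "?g \<circ> f" id S] inj by simp
  then show ?thesis
    using L1_comp[OF assms(1,5) g] L1_comp[OF assms(2), of f ?g] assms l g by metis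
qed


section \<open>Lists of labels\<close>

text \<open>Repetitions are allowed, so that concatenation needs no side condition; distinctness is
  stated separately, once for all wires of a network.\<close>

definition typed_labels :: "'u list \<Rightarrow> 'l list \<Rightarrow> bool" where
  "typed_labels X a \<longleftrightarrow> set a \<subseteq> labels S \<and> map (typing S) a = X"

lemma typed_labels_types: "typed_labels X a \<Longrightarrow> X \<in> lists (types S)"
  by (auto simp: typed_labels_def intro!: typing_closed)

lemma typed_labels_length: "typed_labels X a \<Longrightarrow> length a = length X"
  by (auto simp: typed_labels_def)

lemma typed_labels_length_eq:
  "typed_labels X a \<Longrightarrow> typed_labels X b \<Longrightarrow> length a = length b"
  by (simp add: typed_labels_length)

lemma typed_labels_append:
  "typed_labels X a \<Longrightarrow> typed_labels Y b \<Longrightarrow> typed_labels (X @ Y) (a @ b)"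
  by (auto simp: typed_labels_def)

lemma typed_labels_Nil: "typed_labels [] a \<longleftrightarrow> a = []"
  by (auto simp: typed_labels_def)

text \<open>The infinite supply of labels of each type enters here: finitely many forbidden labels
  cannot exhaust it.\<close>

lemma ex_fresh:
  "X \<in> lists (types S) \<Longrightarrow> finite V \<Longrightarrow> \<exists>a. is_fresh S X V a"
proof (induction X arbitrary: V)
  case Nil
  then show ?case by (auto simp: is_fresh_def)
next
  case (Cons A X)
  then obtain a where a: "is_fresh S X V a" by auto
  have "infinite ({l \<in> labels S. typing S l = A} - (V \<union> set a))"
    using Cons infinite_labels by (intro Diff_infinite_finite) auto
  then obtain l where "l \<in> {l \<in> labels S. typing S l = A} - (V \<union> set a)"
    by (metis all_not_in_conv finite.emptyI)
  with a have "is_fresh S (A # X) V (l # a)" by (auto simp: is_fresh_def)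
  then show ?case by blast
qed

lemma is_fresh_fresh:
  "X \<in> lists (types S) \<Longrightarrow> finite V \<Longrightarrow> is_fresh S X V (fresh S X V)"
  unfolding fresh_def by (rule someI_ex) (rule ex_fresh)

text \<open>Each list avoids \<open>V\<close> and also the lists already chosen for the tail, which
  makes the wire lists disjoint from one another.\<close>

lemma ex_fresh_lists:
  "Xs \<in> lists (lists (types S)) \<Longrightarrow> finite V \<Longrightarrow>
   \<exists>as. list_all2 typed_labels Xs as \<and> distinct (concat as) \<and> set (concat as) \<inter> V = {}"
proof (induction Xs arbitrary: V)
  case Nil
  then show ?case by auto
next
  case (Cons X Xs)
  then obtain as where as: "list_all2 typed_labels Xs as" "distinct (concat as)"
    "set (concat as) \<inter> V = {}" by (meson listsE)
  obtain a where "is_fresh S X (V \<union> set (concat as)) a"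
    using Cons.prems by (meson ex_fresh List.finite_set finite_UnI listsE)
  then have "list_all2 typed_labels (X # Xs) (a # as)" "distinct (concat (a # as))"
    "set (concat (a # as)) \<inter> V = {}"
    using as by (auto simp: is_fresh_def typed_labels_def)
  then show ?case by blast
qed

text \<open>New labels may coincide with labels that are themselves replaced; only collisions with
  labels of \<open>A\<close> left fixed have to be excluded. This also admits permutations of
  labels.\<close>

lemma relabelling_subst:
  assumes "typed_labels X xs" "typed_labels X as" "distinct xs" "distinct as"
    "A \<subseteq> labels S" "set as \<inter> (A - set xs) = {}"
  shows "relabelling S (subst xs as) A"
proof -
  have len: "length xs = length as" using assms by (auto intro: typed_labels_length_eq)
  have m: "map (subst xs as) xs = as" using assms len by (simp add: map_subst_self)
  then have inj: "inj_on (subst xs as) (set xs)"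
    using assms(4) by (metis distinct_map)
  have "map (typing S) (map (subst xs as) xs) = map (typing S) xs"
    using m assms by (simp add: typed_labels_def)
  then have ty: "l \<in> set xs \<Longrightarrow> typing S (subst xs as l) = typing S l" for l by simp
  have "inj_on (subst xs as) A"
  proof (rule inj_onI)
    fix l k assume "l \<in> A" "k \<in> A" "subst xs as l = subst xs as k"
    then show "l = k"
      using inj assms(6) subst_in[OF len] subst_notin[of _ xs as]
      by (cases "l \<in> set xs"; cases "k \<in> set xs") (auto dest: inj_onD)
  qed
  moreover have "subst xs as l \<in> labels S \<and> typing S (subst xs as l) = typing S l" if "l \<in> A" for l
    using that assms subst_in[OF len] subst_notin[of l xs as] ty
    by (cases "l \<in> set xs") (auto simp: typed_labels_def)
  ultimately show ?thesis by (auto simp: relabelling_def)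
qed


section \<open>Relabelling of products\<close>

lemma relabelling_subset: "relabelling S f A \<Longrightarrow> B \<subseteq> A \<Longrightarrow> relabelling S f B"
  by (auto simp: relabelling_def intro: inj_on_subset)

lemma relabel_one: "relabel S f (one S) = one S"
  using L1_id[OF one_closed] relabel_cong[of "one S" f id S]
  by (simp add: one_def labs_def del: relabel.simps)

text \<open>L2 only relabels one factor away from the other. To relabel both, the first factor is moved
  to fresh labels, then the second factor to its target, and finally the first one to its target.\<close>

lemma relabel_mult:
  assumes "\<psi> \<in> tensors S" "\<phi> \<in> tensors S" "labs \<psi> \<inter> labs \<phi> = {}"
    and f: "relabelling S f (labs \<psi> \<union> labs \<phi>)"
  shows "relabel S f (mult S \<psi> \<phi>) = mult S (relabel S f \<psi>) (relabel S f \<phi>)"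
proof -
  note \<psi> = tensors_index_sets[OF assms(1)] and \<phi> = tensors_index_sets[OF assms(2)]
  have f\<psi>: "relabelling S f (labs \<psi>)" and f\<phi>: "relabelling S f (labs \<phi>)"
    using f by (auto intro: relabelling_subset)
  have ff: "f ` labs \<psi> \<inter> f ` labs \<phi> = {}"
    using f assms(3) by (subst inj_on_image_Int[symmetric, of f "labs \<psi> \<union> labs \<phi>"]) (auto simp: relabelling_def)
  obtain xs where xs: "set xs = labs \<psi>" "distinct xs"
    using \<psi> finite_distinct_list by blast
  define X where "X = map (typing S) xs"
  have xX: "typed_labels X xs" using \<psi> xs by (auto simp: typed_labels_def X_def)
  let ?V = "labs \<psi> \<union> labs \<phi> \<union> f ` labs \<psi> \<union> f ` labs \<phi>"
  obtain as where "is_fresh S X ?V as"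
    using ex_fresh[OF typed_labels_types[OF xX], of ?V] \<psi> \<phi> by auto
  then have as: "typed_labels X as" "distinct as" "set as \<inter> ?V = {}"
    by (auto simp: is_fresh_def typed_labels_def)
  define g where "g = subst xs as"
  have len: "length xs = length as" using as xX by (auto intro: typed_labels_length_eq)
  have g_img: "g ` labs \<psi> = set as"
    using map_subst_self[OF xs(2) len] xs(1) unfolding g_def by (metis set_map)
  have g: "relabelling S g (labs \<psi>)"
    unfolding g_def using xX as xs \<psi> by (intro relabelling_subst) auto
  let ?gi = "inv_into (labs \<psi>) g"
  \<comment> \<open>After \<open>g\<close> the first factor sits on fresh labels; its way to the
    target goes back along \<open>g\<close> and then through \<open>f\<close>.\<close>
  define h where "h = f \<circ> ?gi"
  have gi: "?gi (g l) = l" if "l \<in> labs \<psi>" for l using g that by (simp add: relabelling_def)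
  then have hg: "h (g l) = f l" if "l \<in> labs \<psi>" for l using that by (simp add: h_def)
  have h: "relabelling S h (g ` labs \<psi>)"
    using f\<psi> g hg by (auto simp: relabelling_def inj_on_def)
  let ?\<psi> = "relabel S g \<psi>" and ?\<phi> = "relabel S f \<phi>"
  have g\<psi>: "?\<psi> \<in> tensors S" using relabel_closed assms(1) g .
  have f\<phi>T: "?\<phi> \<in> tensors S" using relabel_closed assms(2) f\<phi> .
  have d1: "g ` labs \<psi> \<inter> labs \<phi> = {}" "g ` labs \<psi> \<inter> f ` labs \<phi> = {}"
    using as g_img by auto
  define g' where "g' = (\<lambda>l. if l \<in> labs \<phi> then l else g l)"
  define f' where "f' = (\<lambda>l. if l \<in> labs ?\<psi> then l else f l)"
  define h' where "h' = (\<lambda>l. if l \<in> labs ?\<phi> then l else h l)"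
  have "relabel S f \<psi> = relabel S h ?\<psi>"
    using L1_comp[OF assms(1) g h] relabel_cong[of \<psi> f "h \<circ> g"] hg by simp
  then have "mult S (relabel S f \<psi>) ?\<phi> = mult S (relabel S h ?\<psi>) ?\<phi>" by simp
  also have "\<dots> = relabel S h' (mult S ?\<psi> ?\<phi>)"
  proof -
    have "h ` g ` labs \<psi> = f ` labs \<psi>" using hg by (auto simp: image_image)
    then show ?thesis unfolding h'_def
      using L2[OF g\<psi> f\<phi>T _ h[folded labs_relabel[of S g \<psi>]]] d1 ff by (simp add: labs_relabel)
  qed
  also have "mult S ?\<psi> ?\<phi> = mult S ?\<phi> ?\<psi>"
    using T2_comm[OF g\<psi> f\<phi>T] d1 by (simp add: labs_relabel)
  also have "\<dots> = relabel S f' (mult S \<phi> ?\<psi>)" unfolding f'_def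
    using L2[OF assms(2) g\<psi> _ f\<phi>] d1 by (simp add: labs_relabel Int_commute)
  also have "mult S \<phi> ?\<psi> = mult S ?\<psi> \<phi>"
    using T2_comm[OF g\<psi> assms(2)] d1 by (simp add: labs_relabel)
  also have "\<dots> = relabel S g' (mult S \<psi> \<phi>)" unfolding g'_def
    using L2[OF assms(1-3) g] d1 by simp
  also have "relabel S h' (relabel S f' (relabel S g' (mult S \<psi> \<phi>))) = relabel S (h' \<circ> (f' \<circ> g')) (mult S \<psi> \<phi>)"
  proof -
    have m: "mult S \<psi> \<phi> \<in> tensors S" using assms mult_closed by blast
    have e1: "g' l = (if l \<in> labs \<psi> then g l else l)" if "l \<in> labs \<psi> \<union> labs \<phi>" for l
      using that assms(3) by (auto simp: g'_def)
    have e2: "f' (g' l) = (if l \<in> labs \<psi> then g l else f l)" if "l \<in> labs \<psi> \<union> labs \<phi>" for l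
      using that d1 e1[OF that] assms(3) by (auto simp: f'_def labs_relabel)
    have e3: "h' (f' (g' l)) = f l" if "l \<in> labs \<psi> \<union> labs \<phi>" for l
      using that d1 e2[OF that] hg by (auto simp: h'_def labs_relabel)
    have "inj_on f (labs \<psi> \<union> labs \<phi>)" using f by (simp add: relabelling_def)
    then have "inj_on (h' \<circ> (f' \<circ> g')) (labs \<psi> \<union> labs \<phi>)" using e3 by (subst inj_on_cong[where g = f]) auto
    \<comment> \<open>A composite is injective only if its initial segments are, and the full
      composite agrees with \<open>f\<close>; this spares a case analysis for each intermediate
      map.\<close>
    then have inj: "inj_on g' (labs \<psi> \<union> labs \<phi>)" "inj_on (f' \<circ> g') (labs \<psi> \<union> labs \<phi>)"
      by (metis inj_on_imageI2)+
    have r1: "relabelling S g' (labs \<psi> \<union> labs \<phi>)"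
      using inj g e1 \<phi> by (auto simp: relabelling_def)
    have r2: "relabelling S (f' \<circ> g') (labs \<psi> \<union> labs \<phi>)"
      using inj g f e2 by (auto simp: relabelling_def)
    have r3: "relabelling S (h' \<circ> (f' \<circ> g')) (labs \<psi> \<union> labs \<phi>)"
      using \<open>inj_on (h' \<circ> (f' \<circ> g')) _\<close> f e3 by (auto simp: relabelling_def)
    have c: "relabelling S v (u ` A)" if "relabelling S u A" "relabelling S (v \<circ> u) A" for u v A
      using that by (auto simp: relabelling_def inj_on_def)
    have "relabel S f' (relabel S g' (mult S \<psi> \<phi>)) = relabel S (f' \<circ> g') (mult S \<psi> \<phi>)"
      using L1_comp[OF m] r1 c[OF r1 r2] by (simp add: labs_mult)
    then show ?thesis using L1_comp[OF m] r2 c[OF r2 r3] by (simp add: labs_mult)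
  qed
  also have "\<dots> = relabel S f (mult S \<psi> \<phi>)"
    using d1 hg assms(3)
    by (intro relabel_cong) (auto simp: labs_mult labs_relabel h'_def f'_def g'_def)
  finally show ?thesis by simp
qed


section \<open>Iterated contraction\<close>

text \<open>This is the contraction fold at the end of \<open>einstein\<close>; lower labels come
  first, and the last pair is contracted first.\<close>

definition ctr :: "'l list \<Rightarrow> 'l list \<Rightarrow> ('l, 't) tensor \<Rightarrow> ('l, 't) tensor" where
  "ctr as bs = foldr (\<lambda>(a, b). contract S a b) (zip as bs)"

text \<open>All pairs must be legal on the uncontracted tensor. Distinctness then keeps each pair
  available whatever is contracted before it; \<open>as\<close> and \<open>bs\<close> cannot meet,
  because the index sets of a tensor are disjoint.\<close>

definition ctr_ok :: "'l list \<Rightarrow> 'l list \<Rightarrow> ('l, 't) tensor \<Rightarrow> bool" where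
  "ctr_ok as bs \<psi> \<longleftrightarrow> \<psi> \<in> tensors S \<and> distinct as \<and> distinct bs \<and>
     map (typing S) as = map (typing S) bs \<and> set as \<subseteq> lower \<psi> \<and> set bs \<subseteq> upper \<psi>"

lemma ctr_Nil: "ctr [] [] \<psi> = \<psi>"
  by (simp add: ctr_def)

lemma ctr_Cons: "ctr (a # as) (b # bs) \<psi> = contract S a b (ctr as bs \<psi>)"
  by (simp add: ctr_def)

lemma ctr_append:
  "length as = length bs \<Longrightarrow> ctr (as @ as') (bs @ bs') \<psi> = ctr as bs (ctr as' bs' \<psi>)"
  by (simp add: ctr_def)

lemma lower_ctr: "length as = length bs \<Longrightarrow> lower (ctr as bs \<psi>) = lower \<psi> - set as"
  by (induction as bs rule: list_induct2) (auto simp: ctr_Nil ctr_Cons lower_contract)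

lemma upper_ctr: "length as = length bs \<Longrightarrow> upper (ctr as bs \<psi>) = upper \<psi> - set bs"
  by (induction as bs rule: list_induct2) (auto simp: ctr_Nil ctr_Cons upper_contract)

lemma ctr_ok_length: "ctr_ok as bs \<psi> \<Longrightarrow> length as = length bs"
  unfolding ctr_ok_def by (metis length_map)

lemma ctr_ok_Cons:
  assumes "ctr_ok (a # as) (b # bs) \<psi>"
  shows "ctr_ok as bs \<psi>" "contractible S a b (ctr as bs \<psi>)" "contractible S a b \<psi>"
    "length as = length bs"
  using assms ctr_ok_length[OF assms] by (auto simp: ctr_ok_def contractible_def lower_ctr upper_ctr)

lemma ctr_closed: "ctr_ok as bs \<psi> \<Longrightarrow> ctr as bs \<psi> \<in> tensors S"
proof (induction as arbitrary: bs)
  case Nil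
  then show ?case by (auto simp: ctr_ok_def ctr_Nil)
next
  case (Cons a as)
  then obtain b bs' where bs: "bs = b # bs'" using ctr_ok_length[OF Cons.prems] by (cases bs) auto
  note o = ctr_ok_Cons[OF Cons.prems[unfolded bs]]
  show ?case using contract_closed[OF Cons.IH[OF o(1)] o(2)] by (simp add: bs ctr_Cons)
qed

lemma labs_ctr: "ctr_ok as bs \<psi> \<Longrightarrow> labs (ctr as bs \<psi>) = labs \<psi> - (set as \<union> set bs)"
  using tensors_index_sets(3)[of \<psi>]
  by (auto simp: labs_def lower_ctr[OF ctr_ok_length] upper_ctr[OF ctr_ok_length] ctr_ok_def)

text \<open>Repeated T1: the new pair moves inwards past one pair of the list at a time.\<close>

lemma contract_ctr:
  "ctr_ok (a # as) (b # bs) \<psi> \<Longrightarrow> contract S a b (ctr as bs \<psi>) = ctr as bs (contract S a b \<psi>)"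
proof (induction as arbitrary: bs)
  case Nil
  then show ?case using ctr_ok_length[OF Nil] by (simp add: ctr_Nil)
next
  case (Cons a' as)
  then obtain b' bs' where bs: "bs = b' # bs'" using ctr_ok_length[OF Cons.prems] by (cases bs) auto
  have o: "ctr_ok (a # as) (b # bs') \<psi>" "ctr_ok (a' # as) (b' # bs') \<psi>"
    using Cons.prems by (auto simp: ctr_ok_def bs)
  have "contract S a b (contract S a' b' (ctr as bs' \<psi>)) = contract S a' b' (contract S a b (ctr as bs' \<psi>))"
    using Cons.prems by (intro T1 ctr_closed ctr_ok_Cons(2)[OF o(1)] ctr_ok_Cons(2)[OF o(2)] ctr_ok_Cons(1)[OF o(1)])
      (auto simp: ctr_ok_def bs)
  then show ?case using Cons.IH[OF o(1)] by (simp add: bs ctr_Cons)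
qed

text \<open>T1 for blocks of wires. The side condition concerns both blocks together, so that either
  order of contraction is legal.\<close>

lemma ctr_commute:
  assumes "ctr_ok (as @ as') (bs @ bs') \<psi>" "length as = length bs"
  shows "ctr as bs (ctr as' bs' \<psi>) = ctr as' bs' (ctr as bs \<psi>)"
  using assms(2,1)
proof (induction as bs rule: list_induct2)
  case Nil
  then show ?case by (simp add: ctr_Nil)
next
  case (Cons a as b bs)
  have l: "length as' = length bs'" using Cons ctr_ok_length by fastforce
  have o: "ctr_ok (as @ as') (bs @ bs') \<psi>" "ctr_ok as bs \<psi>"
    using Cons by (auto simp: ctr_ok_def)
  have "ctr_ok (a # as') (b # bs') (ctr as bs \<psi>)"
    using Cons ctr_closed[OF o(2)] l by (auto simp: ctr_ok_def lower_ctr upper_ctr)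
  then show ?case using Cons.IH[OF o(1)] by (simp add: ctr_Cons contract_ctr)
qed

text \<open>Repeated T3; contraction only removes labels, so disjointness from the other factor
  persists at every step.\<close>

lemma ctr_mult_left:
  assumes "ctr_ok as bs \<psi>" "\<phi> \<in> tensors S" "labs \<psi> \<inter> labs \<phi> = {}"
  shows "ctr as bs (mult S \<psi> \<phi>) = mult S (ctr as bs \<psi>) \<phi>"
  using assms(1)
proof (induction as arbitrary: bs)
  case Nil
  then show ?case using ctr_ok_length[OF Nil] by (simp add: ctr_Nil)
next
  case (Cons a as)
  then obtain b bs' where bs: "bs = b # bs'" using ctr_ok_length[OF Cons.prems] by (cases bs) auto
  note o = ctr_ok_Cons[OF Cons.prems[unfolded bs]]
  have "contract S a b (mult S (ctr as bs' \<psi>) \<phi>) = mult S (contract S a b (ctr as bs' \<psi>)) \<phi>"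
    using assms o by (intro T3 ctr_closed) (auto simp: labs_ctr)
  then show ?case using Cons.IH[OF o(1)] by (simp add: bs ctr_Cons)
qed

lemma ctr_mult_right:
  assumes "ctr_ok as bs \<psi>" "\<phi> \<in> tensors S" "labs \<phi> \<inter> labs \<psi> = {}"
  shows "ctr as bs (mult S \<phi> \<psi>) = mult S \<phi> (ctr as bs \<psi>)"
proof -
  have "\<psi> \<in> tensors S" using assms by (simp add: ctr_ok_def)
  moreover have "labs (ctr as bs \<psi>) \<inter> labs \<phi> = {}" using assms by (auto simp: labs_ctr)
  ultimately show ?thesis
    using ctr_mult_left[OF assms(1,2)] assms ctr_closed[OF assms(1)] T2_comm[of \<phi>]
    by (simp add: Int_commute)
qed

lemma relabel_ctr:
  assumes "ctr_ok as bs \<psi>" "relabelling S f (labs \<psi>)"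
  shows "relabel S f (ctr as bs \<psi>) = ctr (map f as) (map f bs) (relabel S f \<psi>)"
  using assms(1)
proof (induction as arbitrary: bs)
  case Nil
  then show ?case using ctr_ok_length[OF Nil] by (simp add: ctr_Nil)
next
  case (Cons a as)
  then obtain b bs' where bs: "bs = b # bs'" using ctr_ok_length[OF Cons.prems] by (cases bs) auto
  note o = ctr_ok_Cons[OF Cons.prems[unfolded bs]]
  have "relabelling S f (labs (ctr as bs' \<psi>))"
    using assms(2) o(1) by (auto simp: labs_ctr intro: relabelling_subset)
  then show ?case using Cons.IH[OF o(1)] L3[OF ctr_closed[OF o(1)] o(2)] by (simp add: bs ctr_Cons)
qed


section \<open>Products of deltas\<close>

lemma deltas_Nil: "deltas S [] [] = one S"
  by (simp add: deltas_def)

lemma deltas_Cons: "deltas S (a # as) (b # bs) = mult S (delta S a b) (deltas S as bs)"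
  by (simp add: deltas_def)

lemma lower_deltas: "length as = length bs \<Longrightarrow> lower (deltas S as bs) = set as"
  by (induction as bs rule: list_induct2)
    (auto simp: deltas_Nil deltas_Cons lower_mult one_def delta_def)

lemma upper_deltas: "length as = length bs \<Longrightarrow> upper (deltas S as bs) = set bs"
  by (induction as bs rule: list_induct2)
    (auto simp: deltas_Nil deltas_Cons upper_mult one_def delta_def)

lemma labs_deltas: "length as = length bs \<Longrightarrow> labs (deltas S as bs) = set as \<union> set bs"
  by (simp add: labs_def lower_deltas upper_deltas)

lemma labs_delta: "labs (delta S a b) = {a, b}"
  by (auto simp: labs_def delta_def)

lemma typed_labels_Cons: "typed_labels X (a # as) \<longleftrightarrow>
    (\<exists>X'. X = typing S a # X' \<and> a \<in> labels S \<and> typed_labels X' as)"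
  by (auto simp: typed_labels_def)

lemma deltas_closed:
  "typed_labels X as \<Longrightarrow> typed_labels X bs \<Longrightarrow> distinct (as @ bs) \<Longrightarrow> deltas S as bs \<in> tensors S"
proof (induction X arbitrary: as bs)
  case Nil
  then show ?case by (simp add: typed_labels_Nil deltas_Nil one_closed)
next
  case (Cons A X)
  then obtain a as' b bs' where ab: "as = a # as'" "bs = b # bs'"
    "typed_labels X as'" "typed_labels X bs'" "delta_pair S a b"
    by (cases as; cases bs) (auto simp: typed_labels_Cons delta_pair_def, simp_all add: typed_labels_def)
  have len: "length as' = length bs'" using ab by (auto intro: typed_labels_length_eq)
  show ?case unfolding ab deltas_Cons
    using Cons ab len by (intro mult_closed delta_closed) (auto simp: labs_deltas labs_delta)
qed

lemma deltas_append:
  assumes "typed_labels X as" "typed_labels X bs" "typed_labels Y as'" "typed_labels Y bs'"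
    "distinct (as @ as' @ bs @ bs')"
  shows "deltas S (as @ as') (bs @ bs') = mult S (deltas S as bs) (deltas S as' bs')"
  using assms(1,2,5)
proof (induction X arbitrary: as bs)
  case Nil
  then show ?case
    using deltas_closed[OF assms(3,4)] by (simp add: typed_labels_Nil deltas_Nil T2_unit_left)
next
  case (Cons A X)
  then obtain a as1 b bs1 where ab: "as = a # as1" "bs = b # bs1"
    "typed_labels X as1" "typed_labels X bs1" "delta_pair S a b"
    by (cases as; cases bs) (auto simp: typed_labels_Cons delta_pair_def, simp_all add: typed_labels_def)
  have len: "length as1 = length bs1" "length as' = length bs'"
    using ab assms by (auto intro: typed_labels_length_eq)
  have "mult S (mult S (delta S a b) (deltas S as1 bs1)) (deltas S as' bs') =
      mult S (delta S a b) (mult S (deltas S as1 bs1) (deltas S as' bs'))"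
    using Cons.prems ab len
    by (intro T2_assoc delta_closed deltas_closed[OF ab(3,4)] deltas_closed[OF assms(3,4)])
      (auto simp: labs_deltas labs_delta)
  then show ?case using Cons ab by (simp add: deltas_Cons)
qed

lemma relabel_deltas:
  assumes "typed_labels X as" "typed_labels X bs" "distinct (as @ bs)"
    "relabelling S f (set as \<union> set bs)"
  shows "relabel S f (deltas S as bs) = deltas S (map f as) (map f bs)"
  using assms
proof (induction X arbitrary: as bs)
  case Nil
  then show ?case by (simp add: typed_labels_Nil deltas_Nil relabel_one)
next
  case (Cons A X)
  then obtain a as' b bs' where ab: "as = a # as'" "bs = b # bs'"
    "typed_labels X as'" "typed_labels X bs'" "delta_pair S a b"
    by (cases as; cases bs) (auto simp: typed_labels_Cons delta_pair_def, simp_all add: typed_labels_def)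
  have len: "length as' = length bs'" using ab by (auto intro: typed_labels_length_eq)
  have f: "relabelling S f (insert a (insert b (set as' \<union> set bs')))"
    using Cons.prems(4) ab by (simp add: insert_commute)
  have "f a \<noteq> f b" using f ab(5) by (auto simp: relabelling_def delta_pair_def inj_on_def)
  then have p: "delta_pair S (f a) (f b)" "typing S (f a) = typing S a"
    using f ab(5) by (auto simp: relabelling_def delta_pair_def)
  \<comment> \<open>L4 treats the substitution at exactly the two labels of the delta, and
    \<open>f\<close> agrees with it there.\<close>
  have "relabel S f (delta S a b) = relabel S (id(a := f a, b := f b)) (delta S a b)"
    by (intro relabel_cong) (auto simp: labs_delta)
  then have "relabel S f (delta S a b) = delta S (f a) (f b)" using L4[OF ab(5) p] by simp
  moreover have "relabel S f (deltas S as' bs') = deltas S (map f as') (map f bs')"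
    using Cons ab f by (intro Cons.IH) (auto intro: relabelling_subset)
  moreover have "relabel S f (mult S (delta S a b) (deltas S as' bs')) =
      mult S (relabel S f (delta S a b)) (relabel S f (deltas S as' bs'))"
    using Cons.prems ab len f
    by (intro relabel_mult delta_closed deltas_closed[OF ab(3,4)]) (auto simp: labs_deltas labs_delta)
  ultimately show ?case by (simp add: ab deltas_Cons)
qed

section \<open>Contraction with products of deltas\<close>

text \<open>T4 wire by wire: the remaining contractions do not touch the outermost delta, so T3 lets
  them act on the rest, and T4 performs the last renaming. Keeping the labels of the deltas away
  from the other factor means that each delta extends an existing wire and never closes up on
  itself.\<close>

lemma ctr_deltas_upper:
  assumes "\<psi> \<in> tensors S" "typed_labels X as" "typed_labels X bs" "typed_labels X cs"
    "distinct (as @ cs)" "distinct bs" "set bs \<subseteq> upper \<psi>" "set (as @ cs) \<inter> labs \<psi> = {}"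
  shows "ctr as bs (mult S \<psi> (deltas S as cs)) = relabel S (subst bs cs) \<psi>"
proof -
  have len: "length as = length cs" using assms by (auto intro: typed_labels_length_eq)
  \<comment> \<open>The deltas are moved to the left, where both \<open>deltas_Cons\<close> and T4
    expect them.\<close>
  have "ctr as bs (mult S (deltas S as cs) \<psi>) = relabel S (subst bs cs) \<psi>"
    using assms(2-)
  proof (induction X arbitrary: as bs cs)
    case Nil
    then show ?case
      using L1_id[OF assms(1)] assms(1)
      by (simp add: typed_labels_Nil ctr_Nil deltas_Nil T2_unit_left subst_Nil id_def)
next
    case (Cons A X)
    then obtain a as' b bs' c cs' where ab: "as = a # as'" "bs = b # bs'" "cs = c # cs'"
      "typed_labels X as'" "typed_labels X bs'" "typed_labels X cs'" "delta_pair S a c"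
      "typing S a = typing S b" "typing S c = typing S b" "c \<in> labels S"
      by (cases as; cases bs; cases cs) (auto simp: typed_labels_Cons delta_pair_def, simp_all add: typed_labels_def)
    have len: "length as' = length bs'" "length as' = length cs'" using ab by (auto intro: typed_labels_length_eq)
    note L = tensors_index_sets[OF assms(1)]
    let ?D = "deltas S as' cs'"
    have D: "?D \<in> tensors S" using Cons.prems ab by (intro deltas_closed) auto
    have d: "delta S a c \<in> tensors S" using ab delta_closed by blast
    have dis: "labs (delta S a c) \<inter> labs ?D = {}" "labs (delta S a c) \<inter> labs \<psi> = {}"
      "labs ?D \<inter> labs \<psi> = {}"
      using Cons.prems ab len by (auto simp: labs_deltas labs_delta)
    have m: "mult S ?D \<psi> \<in> tensors S" using D assms(1) dis by (intro mult_closed)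
    have ok: "ctr_ok as' bs' (mult S ?D \<psi>)"
      using Cons.prems ab len m
      by (auto simp: ctr_ok_def lower_mult upper_mult lower_deltas upper_deltas typed_labels_def)
    have r: "relabelling S (subst bs' cs') (labs \<psi>)"
      using Cons.prems ab L by (intro relabelling_subst[of X]) auto
    have img: "subst bs' cs' l \<in> labs \<psi> - set bs' \<union> set cs'" if "l \<in> labs \<psi>" for l
      using subst_in[of bs' cs' l] subst_notin[of l bs' cs'] that len by (cases "l \<in> set bs'") auto
    \<comment> \<open>The label \<open>b\<close> is not among those renamed so far, hence still
      present for the contraction with the outermost delta.\<close>
    have nb: "subst bs' cs' b = b" using Cons.prems ab by (simp add: subst_notin)
    have sub: "labs (relabel S (subst bs' cs') \<psi>) \<subseteq> labs \<psi> - set bs' \<union> set cs'"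
      unfolding labs_relabel by (intro image_subsetI img)
    have bu: "b \<in> upper (relabel S (subst bs' cs') \<psi>)"
      using imageI[of b "upper \<psi>" "subst bs' cs'"] nb Cons.prems ab by (simp add: upper_relabel)
    have "ctr as bs (mult S (deltas S as cs) \<psi>) =
        contract S a b (ctr as' bs' (mult S (delta S a c) (mult S ?D \<psi>)))"
      using T2_assoc[OF d D assms(1) dis] by (simp add: ab ctr_Cons deltas_Cons)
    also have "\<dots> = contract S a b (mult S (delta S a c) (ctr as' bs' (mult S ?D \<psi>)))"
      using ok d dis by (subst ctr_mult_right) (auto simp: labs_mult)
    also have "ctr as' bs' (mult S ?D \<psi>) = relabel S (subst bs' cs') \<psi>"
      using Cons.prems ab by (intro Cons.IH) auto
    also have "contract S a b (mult S (delta S a c) (relabel S (subst bs' cs') \<psi>)) =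
        relabel S (id(b := c)) (relabel S (subst bs' cs') \<psi>)"
      using Cons.prems ab sub bu
      by (intro T4_upper relabel_closed[OF assms(1) r]) auto
    also have "\<dots> = relabel S (id(b := c) \<circ> subst bs' cs') \<psi>"
    proof (rule L1_comp[OF assms(1) r])
      have "c \<notin> subst bs' cs' ` labs \<psi>" using img Cons.prems ab by auto
      moreover have "subst bs' cs' ` labs \<psi> \<subseteq> labels S" using r by (auto simp: relabelling_def)
      ultimately show "relabelling S (id(b := c)) (subst bs' cs' ` labs \<psi>)"
        using ab by (auto simp: relabelling_def inj_on_def)
    qed
    also have "\<dots> = relabel S (subst bs cs) \<psi>"
    proof (rule relabel_cong)
      fix l assume l: "l \<in> labs \<psi>"
      have "b \<in> labs \<psi>" using Cons.prems ab by (auto simp: labs_def)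
      \<comment> \<open>By injectivity no other label was renamed to \<open>b\<close>, so the final
        renaming of \<open>b\<close> does not disturb the earlier ones.\<close>
      then have "subst bs' cs' l \<noteq> b" if "l \<noteq> b"
        using r that l nb by (metis inj_onD relabelling_def)
      then show "(id(b := c) \<circ> subst bs' cs') l = subst bs cs l"
        by (auto simp: ab subst_Cons nb)
    qed
    finally show ?case .
  qed
  moreover have "mult S (deltas S as cs) \<psi> = mult S \<psi> (deltas S as cs)"
    using assms len by (intro T2_comm deltas_closed[of X]) (auto simp: labs_deltas)
  ultimately show ?thesis by simp
qed

text \<open>The mirror image, from \<open>T4_lower\<close>: the upper ends \<open>cs\<close> of the
  deltas are plugged into the inputs \<open>bs\<close>, which thereby become
  \<open>as\<close>.\<close>

lemma ctr_deltas_lower: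
  assumes "\<psi> \<in> tensors S" "typed_labels X as" "typed_labels X bs" "typed_labels X cs"
    "distinct (as @ cs)" "distinct bs" "set bs \<subseteq> lower \<psi>" "set (as @ cs) \<inter> labs \<psi> = {}"
  shows "ctr bs cs (mult S (deltas S as cs) \<psi>) = relabel S (subst bs as) \<psi>"
  using assms(2-)
proof (induction X arbitrary: as bs cs)
  case Nil
  then show ?case
    using L1_id[OF assms(1)] assms(1)
    by (simp add: typed_labels_Nil ctr_Nil deltas_Nil T2_unit_left subst_Nil id_def)
next
  case (Cons A X)
  then obtain a as' b bs' c cs' where ab: "as = a # as'" "bs = b # bs'" "cs = c # cs'"
    "typed_labels X as'" "typed_labels X bs'" "typed_labels X cs'" "delta_pair S a c"
    "typing S a = typing S b" "typing S c = typing S b" "a \<in> labels S"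
    by (cases as; cases bs; cases cs) (auto simp: typed_labels_Cons delta_pair_def, simp_all add: typed_labels_def)
  have len: "length as' = length bs'" "length as' = length cs'" using ab by (auto intro: typed_labels_length_eq)
  note L = tensors_index_sets[OF assms(1)]
  let ?D = "deltas S as' cs'"
  have D: "?D \<in> tensors S" using Cons.prems ab by (intro deltas_closed) auto
  have d: "delta S a c \<in> tensors S" using ab delta_closed by blast
  have dis: "labs (delta S a c) \<inter> labs ?D = {}" "labs (delta S a c) \<inter> labs \<psi> = {}"
    "labs ?D \<inter> labs \<psi> = {}"
    using Cons.prems ab len by (auto simp: labs_deltas labs_delta)
  have m: "mult S ?D \<psi> \<in> tensors S" using D assms(1) dis by (intro mult_closed)
  have ok: "ctr_ok bs' cs' (mult S ?D \<psi>)"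
    using Cons.prems ab len m
    by (auto simp: ctr_ok_def lower_mult upper_mult lower_deltas upper_deltas typed_labels_def)
  have r: "relabelling S (subst bs' as') (labs \<psi>)"
    using Cons.prems ab L by (intro relabelling_subst[of X]) auto
  have img: "subst bs' as' l \<in> labs \<psi> - set bs' \<union> set as'" if "l \<in> labs \<psi>" for l
    using subst_in[of bs' as' l] subst_notin[of l bs' as'] that len by (cases "l \<in> set bs'") auto
  have nb: "subst bs' as' b = b" using Cons.prems ab by (simp add: subst_notin)
  have sub: "labs (relabel S (subst bs' as') \<psi>) \<subseteq> labs \<psi> - set bs' \<union> set as'"
    unfolding labs_relabel by (intro image_subsetI img)
  have bu: "b \<in> lower (relabel S (subst bs' as') \<psi>)"
    using imageI[of b "lower \<psi>" "subst bs' as'"] nb Cons.prems ab by (simp add: lower_relabel)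
  have "ctr bs cs (mult S (deltas S as cs) \<psi>) =
      contract S b c (ctr bs' cs' (mult S (delta S a c) (mult S ?D \<psi>)))"
    using T2_assoc[OF d D assms(1) dis] by (simp add: ab ctr_Cons deltas_Cons)
  also have "\<dots> = contract S b c (mult S (delta S a c) (ctr bs' cs' (mult S ?D \<psi>)))"
    using ok d dis by (subst ctr_mult_right) (auto simp: labs_mult)
  also have "ctr bs' cs' (mult S ?D \<psi>) = relabel S (subst bs' as') \<psi>"
    using Cons.prems ab by (intro Cons.IH) auto
  also have "contract S b c (mult S (delta S a c) (relabel S (subst bs' as') \<psi>)) =
      relabel S (id(b := a)) (relabel S (subst bs' as') \<psi>)"
    using Cons.prems ab sub bu
    by (intro T4_lower relabel_closed[OF assms(1) r]) auto
  also have "\<dots> = relabel S (id(b := a) \<circ> subst bs' as') \<psi>"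
  proof (rule L1_comp[OF assms(1) r])
    have "a \<notin> subst bs' as' ` labs \<psi>" using img Cons.prems ab by auto
    moreover have "subst bs' as' ` labs \<psi> \<subseteq> labels S" using r by (auto simp: relabelling_def)
    ultimately show "relabelling S (id(b := a)) (subst bs' as' ` labs \<psi>)"
      using ab by (auto simp: relabelling_def inj_on_def)
  qed
  also have "\<dots> = relabel S (subst bs as) \<psi>"
  proof (rule relabel_cong)
    fix l assume l: "l \<in> labs \<psi>"
    have "b \<in> labs \<psi>" using Cons.prems ab by (auto simp: labs_def)
    then have "subst bs' as' l \<noteq> b" if "l \<noteq> b"
      using r that l nb by (metis inj_onD relabelling_def)
    then show "(id(b := a) \<circ> subst bs' as') l = subst bs as l"
      by (auto simp: ab subst_Cons nb)
  qed
  finally show ?case .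
qed

text \<open>Middle-four exchange; in the interchange law it regroups the factors by stage instead of
  by strand.\<close>

lemma mult_swap:
  assumes "\<psi> \<in> tensors S" "\<phi> \<in> tensors S" "\<xi> \<in> tensors S" "\<chi> \<in> tensors S"
    "labs \<psi> \<inter> labs \<phi> = {}" "labs \<psi> \<inter> labs \<xi> = {}" "labs \<psi> \<inter> labs \<chi> = {}"
    "labs \<phi> \<inter> labs \<xi> = {}" "labs \<phi> \<inter> labs \<chi> = {}" "labs \<xi> \<inter> labs \<chi> = {}"
  shows "mult S (mult S \<psi> \<phi>) (mult S \<xi> \<chi>) = mult S (mult S \<psi> \<xi>) (mult S \<phi> \<chi>)"
proof -
  have "mult S (mult S \<psi> \<phi>) (mult S \<xi> \<chi>) = mult S \<psi> (mult S (mult S \<phi> \<xi>) \<chi>)"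
    using assms by (simp add: T2_assoc mult_closed labs_mult Int_Un_distrib Int_Un_distrib2)
  also have "mult S \<phi> \<xi> = mult S \<xi> \<phi>" using assms by (intro T2_comm)
  also have "mult S \<psi> (mult S (mult S \<xi> \<phi>) \<chi>) = mult S (mult S \<psi> \<xi>) (mult S \<phi> \<chi>)"
    using assms by (simp add: T2_assoc mult_closed labs_mult Int_Un_distrib Int_Un_distrib2 Int_commute)
  finally show ?thesis .
qed

lemma relabelling_subst_lists:
  "typed_labels X xs \<Longrightarrow> typed_labels X as \<Longrightarrow> distinct xs \<Longrightarrow> distinct as \<Longrightarrow>
   relabelling S (subst xs as) (set xs)"
  by (rule relabelling_subst) (auto simp: typed_labels_def)

end


section \<open>Arrows with chosen labels\<close>

locale canonical_ats = abstract_tensor_system S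
  for S :: "('u, 'l, 't, 'z) ats_scheme" (structure) +
  fixes Lc :: "'l set" and c :: "'u \<times> nat \<times> nat \<Rightarrow> 'l"
  assumes canonical: "canonical_labels S Lc c"
begin

abbreviation comp (infixl "\<odot>" 65) where "g \<odot> f \<equiv> ats_comp S c g f"
abbreviation tensor (infixl "\<boxplus>" 75) where "f \<boxplus> g \<equiv> ats_tens S c f g"
abbreviation ident ("\<iota>") where "\<iota> X \<equiv> ats_ident S c X"
abbreviation symm where "symm X Y \<equiv> ats_symm S c X Y"
abbreviation tr where "tr A B X f \<equiv> ats_trace S c A B X f"

text \<open>Membership also records that both ends are objects, so that lemmas about an arrow can
  extract this from the arrow itself.\<close>

definition hom :: "'u list \<Rightarrow> 'u list \<Rightarrow> ('u, 't) arrow set" where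
  "hom X Y = {f \<in> ats_hom S c X Y. X \<in> lists (types S) \<and> Y \<in> lists (types S)}"

lemma c_eq_iff:
  assumes "X \<in> types S" "Y \<in> types S" "\<epsilon> \<in> {0, 1}" "\<epsilon>' \<in> {0, 1}"
  shows "c (X, i, \<epsilon>) = c (Y, j, \<epsilon>') \<longleftrightarrow> X = Y \<and> i = j \<and> \<epsilon> = \<epsilon>'"
proof -
  have "inj_on c (types S \<times> UNIV \<times> {0, 1})"
    using canonical by (auto simp: canonical_labels_def bij_betw_def)
  from inj_on_eq_iff[OF this, of "(X, i, \<epsilon>)" "(Y, j, \<epsilon>')"] show ?thesis using assms by auto
qed

lemma length_canon: "length (canon c \<epsilon> s X) = length X"
  by (simp add: canon_def)

lemma typed_canon:
  assumes "X \<in> lists (types S)" "\<epsilon> \<in> {0, 1}"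
  shows "typed_labels X (canon c \<epsilon> s X)"
proof -
  have X: "i < length X \<Longrightarrow> X ! i \<in> types S" for i using assms(1) by (auto simp: in_lists_conv_set)
  have "c (Y, i, \<epsilon>) \<in> labels S \<and> typing S (c (Y, i, \<epsilon>)) = Y" if "Y \<in> types S" for Y i
    using canonical assms(2) that bij_betwE[of c "types S \<times> UNIV \<times> {0, 1}" Lc]
    by (auto simp: canonical_labels_def)
  then show ?thesis using X by (auto simp: typed_labels_def canon_def intro: nth_equalityI)
qed

lemma distinct_canon:
  "X \<in> lists (types S) \<Longrightarrow> \<epsilon> \<in> {0, 1} \<Longrightarrow> distinct (canon c \<epsilon> s X)"
  by (auto simp: canon_def distinct_map inj_on_def c_eq_iff in_lists_conv_set)

text \<open>The last component of a canonical label separates inputs from outputs, so even an arrow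
  from \<open>X\<close> to \<open>X\<close> has disjoint index sets.\<close>

lemma canon_disjoint:
  "X \<in> lists (types S) \<Longrightarrow> Y \<in> lists (types S) \<Longrightarrow>
   set (canon c 0 s X) \<inter> set (canon c 1 s' Y) = {}"
  by (auto simp: canon_def c_eq_iff in_lists_conv_set)

text \<open>The reason for the shift: the labels of a product are those of its factors listed one
  after the other, which is what makes the product strict.\<close>

lemma canon_append: "canon c \<epsilon> s (X @ Y) = canon c \<epsilon> s X @ canon c \<epsilon> (s + length X) Y"
  by (auto simp: canon_def nth_append intro!: nth_equalityI)

lemma distinct_canon_shift:
  "X \<in> lists (types S) \<Longrightarrow> Y \<in> lists (types S) \<Longrightarrow> \<epsilon> \<in> {0, 1} \<Longrightarrow>
   distinct (canon c \<epsilon> 0 X @ canon c \<epsilon> (length X) Y)"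
  using distinct_canon[of "X @ Y" \<epsilon> 0] by (simp add: canon_append)

text \<open>Inputs and outputs are renamed in one simultaneous substitution, so \<open>a\<close> and
  \<open>b\<close> may themselves contain canonical labels, in other positions. The intended use is
  for typed lists with \<open>a @ b\<close> distinct.\<close>

definition place :: "('u, 't) arrow \<Rightarrow> 'l list \<Rightarrow> 'l list \<Rightarrow> ('l, 't) tensor" where
  "place f a b = relabel S
     (subst (canon c 0 0 (fst f) @ canon c 1 0 (fst (snd f))) (a @ b)) (arrow_tensor c f)"

lemma hom_tensor:
  assumes "f \<in> hom X Y"
  shows "arrow_tensor c f \<in> tensors S" "lower (arrow_tensor c f) = set (canon c 0 0 X)"
    "upper (arrow_tensor c f) = set (canon c 1 0 Y)" "fst f = X" "fst (snd f) = Y"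
    "X \<in> lists (types S)" "Y \<in> lists (types S)" "\<exists>t. f = (X, Y, t)"
  using assms typed_canon[of X 0 0] typed_canon[of Y 1 0] canon_disjoint[of X Y 0 0]
  by (auto simp: hom_def ats_hom_def tensors_def index_sets_def typed_labels_def)

text \<open>An arrow stores only the bare element; its index sets are recovered from the objects, so
  nothing is lost when those index sets are the canonical ones.\<close>

lemma arrow_of_tensor:
  assumes "\<psi> \<in> tensors S" "lower \<psi> = set (canon c 0 0 X)" "upper \<psi> = set (canon c 1 0 Y)"
    "X \<in> lists (types S)" "Y \<in> lists (types S)"
  shows "(X, Y, element \<psi>) \<in> hom X Y" "arrow_tensor c (X, Y, element \<psi>) = \<psi>"
  using assms by (cases \<psi>; auto simp: hom_def ats_hom_def tensors_def)+

lemma canon_relabelling: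
  assumes "f \<in> hom X Y" "typed_labels X a" "typed_labels Y b" "distinct (a @ b)"
  shows "relabelling S (subst (canon c 0 0 X @ canon c 1 0 Y) (a @ b)) (labs (arrow_tensor c f))"
proof -
  note f = hom_tensor[OF assms(1)]
  have "labs (arrow_tensor c f) = set (canon c 0 0 X @ canon c 1 0 Y)"
    using f by (simp add: labs_def)
  moreover have "distinct (canon c 0 0 X @ canon c 1 0 Y)"
    using f canon_disjoint by (simp add: distinct_canon)
  ultimately show ?thesis
    using f assms typed_canon[OF f(6), of 0] typed_canon[OF f(7), of 1]
    by (auto intro!: relabelling_subst_lists[of "X @ Y"] typed_labels_append simp del: set_append)
qed

lemma
  assumes "f \<in> hom X Y" "typed_labels X a" "typed_labels Y b" "distinct (a @ b)"
  shows place_closed: "place f a b \<in> tensors S"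
    and lower_place: "lower (place f a b) = set a"
    and upper_place: "upper (place f a b) = set b"
    and labs_place: "labs (place f a b) = set a \<union> set b"
proof -
  note f = hom_tensor[OF assms(1)] and r = canon_relabelling[OF assms]
  show "place f a b \<in> tensors S"
    using relabel_closed[OF f(1) r] by (simp add: place_def f)
  have l: "length (canon c 0 0 X) = length a" "length (canon c 1 0 Y) = length b"
    using assms by (simp_all add: length_canon typed_labels_length)
  have d: "distinct (canon c 0 0 X @ canon c 1 0 Y)"
    using f canon_disjoint by (simp add: distinct_canon)
  let ?s = "subst (canon c 0 0 X @ canon c 1 0 Y) (a @ b)"
  have "map ?s (canon c 0 0 X) = a" "map ?s (canon c 1 0 Y) = b"
    using d l by (auto intro!: map_subst_append1 map_subst_append2)
  then show lo: "lower (place f a b) = set a" and up: "upper (place f a b) = set b"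
    unfolding place_def f lower_relabel upper_relabel by (metis set_map)+
  show "labs (place f a b) = set a \<union> set b" by (simp add: labs_def lo up)
qed

lemmas place_facts = place_closed lower_place upper_place labs_place

text \<open>By L1 the relabelling merges with the substitution in \<open>place\<close>, and the
  merged map is again a substitution on the canonical labels.\<close>

lemma place_relabel:
  assumes "f \<in> hom X Y" "typed_labels X a" "typed_labels Y b" "distinct (a @ b)"
    "relabelling S g (set a \<union> set b)"
  shows "relabel S g (place f a b) = place f (map g a) (map g b)"
proof -
  note f = hom_tensor[OF assms(1)] and r = canon_relabelling[OF assms(1-4)]
  let ?xs = "canon c 0 0 X @ canon c 1 0 Y"
  have len: "length ?xs = length (a @ b)"
    using assms by (simp add: length_canon typed_labels_length)
  have "labs (place f a b) = set a \<union> set b" using assms by (simp add: labs_place)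
  then have "relabelling S g (subst ?xs (a @ b) ` labs (arrow_tensor c f))"
    using assms(5) by (simp add: place_def labs_relabel f)
  from L1_comp[OF f(1) r this]
  have "relabel S g (place f a b) = relabel S (g \<circ> subst ?xs (a @ b)) (arrow_tensor c f)"
    by (simp add: place_def f)
  also have "\<dots> = relabel S (subst ?xs (map g (a @ b))) (arrow_tensor c f)"
    using f subst_map_in[OF len, of _ g]
    by (intro relabel_cong) (auto simp: labs_def)
  finally show ?thesis by (simp add: place_def f)
qed

lemma place_eqI:
  assumes "f \<in> hom X Y" "g \<in> hom X Y" "typed_labels X a" "typed_labels Y b" "distinct (a @ b)"
    "place f a b = place g a b"
  shows "f = g"
proof -
  note f = hom_tensor[OF assms(1)] and g = hom_tensor[OF assms(2)]
  have "arrow_tensor c f = arrow_tensor c g"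
    using relabel_eqD[OF f(1) g(1) _ _ canon_relabelling[OF assms(1,3-5)]] assms(6)
    by (simp add: place_def f g)
  then show ?thesis using f(8) g(8) by auto
qed

lemma place_of_tensor:
  assumes "\<psi> \<in> tensors S" "lower \<psi> = set (canon c 0 0 X)" "upper \<psi> = set (canon c 1 0 Y)"
    "X \<in> lists (types S)" "Y \<in> lists (types S)"
  shows "place (X, Y, element \<psi>) a b = relabel S (subst (canon c 0 0 X @ canon c 1 0 Y) (a @ b)) \<psi>"
  using arrow_of_tensor(2)[OF assms] by (simp add: place_def)

lemma ex_lists:
  assumes "Xs \<in> lists (lists (types S))"
  shows "\<exists>as. list_all2 typed_labels Xs as \<and> distinct (concat as)"
  using ex_fresh_lists[OF assms, of "{}"] by blast


section \<open>Composition\<close>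

text \<open>Evaluates the Einstein expression of a composite once, hiding the \<open>SOME\<close>
  choices behind an existential: \<open>q\<close> are the connecting labels \<open>y'\<close> of the
  definition, and \<open>p\<close> the bars put on their upper occurrences.\<close>

lemma comp_eq:
  assumes "f \<in> hom X Y" "g \<in> hom Y Z"
  obtains p q where "typed_labels Y p" "typed_labels Y q"
    "distinct (canon c 0 0 X @ canon c 1 0 Z @ p @ q)"
    "g \<odot> f = (X, Z, element (ctr q p (mult S (place f (canon c 0 0 X) p) (place g q (canon c 1 0 Z)))))"
proof -
  note f = hom_tensor[OF assms(1)] and g = hom_tensor[OF assms(2)]
  obtain s t where st: "f = (X, Y, s)" "g = (Y, Z, t)" using f(8) g(8) by auto
  define x where "x = canon c 0 0 X"
  define y0 where "y0 = canon c 0 0 Y"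
  define y1 where "y1 = canon c 1 0 Y"
  define z where "z = canon c 1 0 Z"
  note defs = x_def y0_def y1_def z_def
  have ty: "typed_labels X x" "typed_labels Y y0" "typed_labels Y y1" "typed_labels Z z"
    using f g by (auto simp: defs intro!: typed_canon)
  have dx: "distinct (x @ z)"
    using f g canon_disjoint by (auto simp: defs intro!: distinct_canon)
  define q where "q = fresh S Y (set x \<union> set y0 \<union> set y1 \<union> set z)"
  have "is_fresh S Y (set x \<union> set y0 \<union> set y1 \<union> set z) q"
    unfolding q_def using f g by (intro is_fresh_fresh) auto
  then have q: "typed_labels Y q" "distinct q" "set q \<inter> (set x \<union> set z) = {}"
    by (auto simp: is_fresh_def typed_labels_def)
  let ?es = "[Symbol (arrow_tensor c f) x x y1 q, Symbol (arrow_tensor c g) y0 q z z]"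
  \<comment> \<open>The inputs \<open>x\<close> carry flag 0, the outputs \<open>z\<close> flag 1,
    and \<open>q\<close> avoids both, so exactly the connecting labels are repeated.\<close>
  have rep: "repeated ?es = q"
  proof -
    have "filter (\<lambda>a. a \<in> set q \<or> a \<in> set z) x = []" "filter (\<lambda>a. a \<in> set q \<or> a \<in> set z) q = q"
      using q dx by (auto simp: filter_empty_conv filter_id_conv)
    then show ?thesis by (simp add: repeated_def)
  qed
  define p where "p = fresh S (map (typing S) q)
    (set (concat (map lower_inds ?es)) \<union> set (concat (map upper_inds ?es)))"
  have "is_fresh S Y (set (concat (map lower_inds ?es)) \<union> set (concat (map upper_inds ?es))) p"
    using q(1) f unfolding p_def typed_labels_def by (simp add: is_fresh_fresh)
  then have p: "typed_labels Y p" "distinct p" "set p \<inter> (set x \<union> set q \<union> set z) = {}"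
    by (auto simp: is_fresh_def typed_labels_def)
  have len: "length q = length p" using p q by (auto intro: typed_labels_length_eq)
  \<comment> \<open>The bars act on upper indices only: the outputs of \<open>f\<close> move to
    \<open>p\<close> and \<open>z\<close> is fixed, while the inputs of \<open>g\<close> keep
    \<open>q\<close>.\<close>
  have m: "map (subst q p) q = p" "map (subst q p) z = z"
    using q len by (auto intro!: map_subst_self map_subst_disjoint)
  have pf: "relabel S (subst (x @ y1) (x @ p)) (arrow_tensor c f) = place f x p"
    and pg: "relabel S (subst (y0 @ z) (q @ z)) (arrow_tensor c g) = place g q z"
    by (simp_all add: place_def f g defs)
  have "place g q z \<in> tensors S" using assms(2) q ty dx by (intro place_closed) auto
  then have "einstein S ?es = ctr q p (mult S (place f x p) (place g q z))"
    by (simp add: einstein_def rep p_def[symmetric, simplified] m pf pg ctr_def T2_unit_right Let_def)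
  moreover have "g \<odot> f = (X, Z, element (einstein S ?es))"
    by (simp add: st Let_def defs q_def del: arrow_tensor.simps)
  ultimately show thesis
    using p q dx by (intro that[of p q]) (auto simp: defs)
qed

text \<open>Side conditions of the network before and after contraction, shared by the later
  calculations with composites. The two ends \<open>p\<close> and \<open>q\<close> of the connecting
  wires are left arbitrary.\<close>

lemma comp_net_ok:
  assumes "f \<in> hom X Y" "g \<in> hom Y Z" "typed_labels X a" "typed_labels Y p" "typed_labels Y q"
    "typed_labels Z b" "distinct (a @ b @ p @ q)"
  shows "ctr_ok q p (mult S (place f a p) (place g q b))"
    "labs (mult S (place f a p) (place g q b)) = set (a @ b @ p @ q)"
    "lower (ctr q p (mult S (place f a p) (place g q b))) = set a"
    "upper (ctr q p (mult S (place f a p) (place g q b))) = set b"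
proof -
  have d: "distinct (a @ p)" "distinct (q @ b)" using assms by auto
  note F = place_facts[OF assms(1,3,4) d(1)] and G = place_facts[OF assms(2,5,6) d(2)]
  have "mult S (place f a p) (place g q b) \<in> tensors S"
    using assms F G by (intro mult_closed) auto
  then show ok: "ctr_ok q p (mult S (place f a p) (place g q b))"
    using assms F G by (auto simp: ctr_ok_def lower_mult upper_mult typed_labels_def)
  show "labs (mult S (place f a p) (place g q b)) = set (a @ b @ p @ q)"
    using F G by (auto simp: labs_mult)
  show "lower (ctr q p (mult S (place f a p) (place g q b))) = set a"
    "upper (ctr q p (mult S (place f a p) (place g q b))) = set b"
    using assms F G ctr_ok_length[OF ok] by (auto simp: lower_ctr upper_ctr lower_mult upper_mult)
qed

lemma comp_closed: "f \<in> hom X Y \<Longrightarrow> g \<in> hom Y Z \<Longrightarrow> g \<odot> f \<in> hom X Z"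
proof -
  assume fg: "f \<in> hom X Y" "g \<in> hom Y Z"
  note f = hom_tensor[OF fg(1)] and g = hom_tensor[OF fg(2)]
  obtain p q where pq: "typed_labels Y p" "typed_labels Y q"
    "distinct (canon c 0 0 X @ canon c 1 0 Z @ p @ q)"
    "g \<odot> f = (X, Z, element (ctr q p (mult S (place f (canon c 0 0 X) p) (place g q (canon c 1 0 Z)))))"
    by (rule comp_eq[OF fg])
  have ty: "typed_labels X (canon c 0 0 X)" "typed_labels Z (canon c 1 0 Z)"
    using f g by (auto intro!: typed_canon)
  show ?thesis unfolding pq(4)
    using f g comp_net_ok[OF fg ty(1) pq(1,2) ty(2) pq(3)]
    by (intro arrow_of_tensor ctr_closed)
qed

text \<open>Independence of the chosen labels: a single substitution carries the external and the
  connecting labels to their targets at once, and L3 pushes it through the contraction to the placed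
  factors.\<close>

lemma place_comp:
  assumes "f \<in> hom X Y" "g \<in> hom Y Z" "typed_labels X a" "typed_labels Z b"
    "typed_labels Y p" "typed_labels Y q" "distinct (a @ b @ p @ q)"
  shows "place (g \<odot> f) a b = ctr q p (mult S (place f a p) (place g q b))"
proof -
  note f = hom_tensor[OF assms(1)] and g = hom_tensor[OF assms(2)]
  obtain p' q' where pq: "typed_labels Y p'" "typed_labels Y q'"
    "distinct (canon c 0 0 X @ canon c 1 0 Z @ p' @ q')"
    "g \<odot> f = (X, Z, element (ctr q' p' (mult S (place f (canon c 0 0 X) p') (place g q' (canon c 1 0 Z)))))"
    by (rule comp_eq[OF assms(1,2)])
  define x where "x = canon c 0 0 X"
  define z where "z = canon c 1 0 Z"
  have ty: "typed_labels X x" "typed_labels Z z"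
    unfolding x_def z_def using f g by (auto intro!: typed_canon)
  note pq' = pq(3,4)[folded x_def z_def]
  let ?\<sigma> = "subst (x @ z @ p' @ q') (a @ b @ p @ q)"
  let ?\<psi> = "ctr q' p' (mult S (place f x p') (place g q' z))"
  have d: "distinct (x @ p')" "distinct (q' @ z)" using pq' by auto
  note F = place_facts[OF assms(1) ty(1) pq(1) d(1)] and G = place_facts[OF assms(2) pq(2) ty(2) d(2)]
  note ok = comp_net_ok[OF assms(1,2) ty(1) pq(1,2) ty(2) pq'(1)]
  have len: "length x = length a" "length z = length b" "length p' = length p" "length q' = length q"
    using ty pq assms by (auto intro: typed_labels_length_eq)
  have r: "relabelling S ?\<sigma> (set (x @ z @ p' @ q'))"
    using assms ty pq pq'
    by (intro relabelling_subst_lists[of "X @ Z @ Y @ Y"] typed_labels_append) auto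
  have m: "map ?\<sigma> x = a" "map ?\<sigma> z = b" "map ?\<sigma> p' = p" "map ?\<sigma> q' = q"
    using map_subst_append1[of x a "z @ p' @ q'" "b @ p @ q"]
      map_subst_block[of x z "p' @ q'" a b "p @ q"]
      map_subst_block[of "x @ z" p' q' "a @ b" p q]
      map_subst_block[of "x @ z @ p'" q' "[]" "a @ b @ p" q "[]"] pq' len by auto
  have "place (g \<odot> f) a b = relabel S (subst (x @ z) (a @ b)) ?\<psi>"
    unfolding pq' x_def z_def
    by (rule place_of_tensor) (use f g ctr_closed[OF ok(1)] ok in \<open>auto simp: x_def z_def\<close>)
  \<comment> \<open>The connecting labels have been contracted away, so the substitution may be
    extended to them freely.\<close>
  also have "\<dots> = relabel S ?\<sigma> ?\<psi>"
    using len ok subst_append[of "x @ z" "a @ b" "p' @ q'" "p @ q"]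
    by (intro relabel_cong) (auto simp: labs_def)
  also have "\<dots> = ctr q p (relabel S ?\<sigma> (mult S (place f x p') (place g q' z)))"
    using r ok m by (simp add: relabel_ctr)
  also have "relabel S ?\<sigma> (mult S (place f x p') (place g q' z)) =
      mult S (relabel S ?\<sigma> (place f x p')) (relabel S ?\<sigma> (place g q' z))"
    using r F G pq'(1) by (intro relabel_mult) (auto elim: relabelling_subset)
  also have "relabel S ?\<sigma> (place f x p') = place f a p"
    using place_relabel[OF assms(1) ty(1) pq(1) d(1), of ?\<sigma>] relabelling_subset[OF r] m by auto
  also have "relabel S ?\<sigma> (place g q' z) = place g q b"
    using place_relabel[OF assms(2) pq(2) ty(2) d(2), of ?\<sigma>] relabelling_subset[OF r] m by auto
  finally show ?thesis .
qed


section \<open>Products, identities, symmetries and traces\<close>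

lemma tens_net:
  assumes "f \<in> hom X Y" "g \<in> hom U V" "typed_labels X a" "typed_labels Y b"
    "typed_labels U a'" "typed_labels V b'" "distinct (a @ a' @ b @ b')"
  shows "mult S (place f a b) (place g a' b') \<in> tensors S"
    "lower (mult S (place f a b) (place g a' b')) = set (a @ a')"
    "upper (mult S (place f a b) (place g a' b')) = set (b @ b')"
proof -
  have d: "distinct (a @ b)" "distinct (a' @ b')" using assms by auto
  note place_facts[OF assms(1,3,4) d(1)] place_facts[OF assms(2,5,6) d(2)]
  then show "mult S (place f a b) (place g a' b') \<in> tensors S"
    "lower (mult S (place f a b) (place g a' b')) = set (a @ a')"
    "upper (mult S (place f a b) (place g a' b')) = set (b @ b')"
    using assms(7) by (auto intro!: mult_closed simp: lower_mult upper_mult)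
qed

lemma canon_tens:
  assumes "X \<in> lists (types S)" "Y \<in> lists (types S)" "U \<in> lists (types S)" "V \<in> lists (types S)"
  shows "distinct (canon c 0 0 X @ canon c 0 (length X) U @ canon c 1 0 Y @ canon c 1 (length Y) V)"
  using assms distinct_canon_shift[of X U 0] distinct_canon_shift[of Y V 1]
    canon_disjoint[of X Y 0 0] canon_disjoint[of X V 0 "length Y"]
    canon_disjoint[of U Y "length X" 0] canon_disjoint[of U V "length X" "length Y"]
  by (simp add: Int_Un_distrib)

text \<open>No label occurs both below and above, so the Einstein expression involves no bars and no
  contraction.\<close>

lemma tens_eq:
  assumes "f \<in> hom X Y" "g \<in> hom U V"
  shows "f \<boxplus> g = (X @ U, Y @ V, element (mult S (place f (canon c 0 0 X) (canon c 1 0 Y))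
    (place g (canon c 0 (length X) U) (canon c 1 (length Y) V))))"
proof -
  note f = hom_tensor[OF assms(1)] and g = hom_tensor[OF assms(2)]
  obtain s t where st: "f = (X, Y, s)" "g = (U, V, t)" using f(8) g(8) by auto
  let ?x = "canon c 0 0 X" and ?y = "canon c 1 0 Y"
  let ?u' = "canon c 0 0 U" and ?u = "canon c 0 (length X) U"
  let ?v' = "canon c 1 0 V" and ?v = "canon c 1 (length Y) V"
  let ?es = "[Symbol (arrow_tensor c f) ?x ?x ?y ?y, Symbol (arrow_tensor c g) ?u' ?u ?v' ?v]"
  have "(set ?x \<union> set ?u) \<inter> (set ?y \<union> set ?v) = {}"
    using canon_tens[OF f(6,7) g(6,7)] by auto
  then have rep: "repeated ?es = []"
    by (auto simp: repeated_def filter_empty_conv)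
  \<comment> \<open>With nothing repeated the bars are a list of labels for no types, and the only
    such list is empty.\<close>
  have fr: "fresh S [] W = []" for W
    unfolding fresh_def by (rule some_equality) (auto simp: is_fresh_def)
  have "place g ?u ?v \<in> tensors S"
    using canon_tens[OF f(6,7) g(6,7)] g by (intro place_closed[OF assms(2)] typed_canon) auto
  then have "einstein S ?es = mult S (place f ?x ?y) (place g ?u ?v)"
    by (simp add: einstein_def rep fr subst_Nil place_def f g T2_unit_right del: One_nat_def)
  then show ?thesis by (simp add: st del: arrow_tensor.simps)
qed

lemma tens_closed:
  assumes "f \<in> hom X Y" "g \<in> hom U V"
  shows "f \<boxplus> g \<in> hom (X @ U) (Y @ V)"
proof -
  note f = hom_tensor[OF assms(1)] and g = hom_tensor[OF assms(2)]
  have ty: "typed_labels X (canon c 0 0 X)" "typed_labels Y (canon c 1 0 Y)"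
    "typed_labels U (canon c 0 (length X) U)" "typed_labels V (canon c 1 (length Y) V)"
    using f g by (auto intro!: typed_canon)
  note n = tens_net[OF assms ty canon_tens[OF f(6,7) g(6,7)]]
  show ?thesis unfolding tens_eq[OF assms]
    using n f g by (intro arrow_of_tensor) (auto simp: canon_append)
qed

text \<open>The argument of \<open>place_comp\<close> without hidden wires; the substitution
  distributes over the product by \<open>relabel_mult\<close>.\<close>

lemma place_tens:
  assumes "f \<in> hom X Y" "g \<in> hom U V" "typed_labels X a" "typed_labels Y b"
    "typed_labels U a'" "typed_labels V b'" "distinct (a @ a' @ b @ b')"
  shows "place (f \<boxplus> g) (a @ a') (b @ b') = mult S (place f a b) (place g a' b')"
proof -
  note f = hom_tensor[OF assms(1)] and g = hom_tensor[OF assms(2)]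
  define x where "x = canon c 0 0 X"
  define y where "y = canon c 1 0 Y"
  define u where "u = canon c 0 (length X) U"
  define v where "v = canon c 1 (length Y) V"
  note defs = x_def y_def u_def v_def
  have ty: "typed_labels X x" "typed_labels Y y" "typed_labels U u" "typed_labels V v"
    unfolding defs using f g by (auto intro!: typed_canon)
  have d: "distinct (x @ u @ y @ v)" unfolding defs using canon_tens f g by blast
  have dd: "distinct (x @ y)" "distinct (u @ v)" using d by auto
  note F = place_facts[OF assms(1) ty(1,2) dd(1)] and G = place_facts[OF assms(2) ty(3,4) dd(2)]
  note n = tens_net[OF assms(1,2) ty d]
  have len: "length x = length a" "length y = length b" "length u = length a'" "length v = length b'"
    using ty assms by (auto intro: typed_labels_length_eq)
  let ?\<sigma> = "subst (x @ u @ y @ v) (a @ a' @ b @ b')"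
  have r: "relabelling S ?\<sigma> (set (x @ u @ y @ v))"
    using assms ty d
    by (intro relabelling_subst_lists[of "X @ U @ Y @ V"] typed_labels_append) auto
  have m: "map ?\<sigma> x = a" "map ?\<sigma> u = a'" "map ?\<sigma> y = b" "map ?\<sigma> v = b'"
    using map_subst_append1[of x a "u @ y @ v" "a' @ b @ b'"]
      map_subst_block[of x u "y @ v" a a' "b @ b'"]
      map_subst_block[of "x @ u" y v "a @ a'" b b']
      map_subst_block[of "x @ u @ y" v "[]" "a @ a' @ b" b' "[]"] d len by auto
  have "place (f \<boxplus> g) (a @ a') (b @ b') = relabel S ?\<sigma> (mult S (place f x y) (place g u v))"
    unfolding tens_eq[OF assms(1,2)]
    by (subst place_of_tensor) (use n f g in \<open>auto simp: canon_append defs\<close>)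
  also have "\<dots> = mult S (relabel S ?\<sigma> (place f x y)) (relabel S ?\<sigma> (place g u v))"
    using r F G d by (intro relabel_mult) (auto elim: relabelling_subset)
  also have "relabel S ?\<sigma> (place f x y) = place f a b"
    using place_relabel[OF assms(1) ty(1,2) dd(1), of ?\<sigma>] relabelling_subset[OF r] m by auto
  also have "relabel S ?\<sigma> (place g u v) = place g a' b'"
    using place_relabel[OF assms(2) ty(3,4) dd(2), of ?\<sigma>] relabelling_subset[OF r] m by auto
  finally show ?thesis .
qed

section \<open>Identities and symmetries\<close>

lemma
  assumes "X \<in> lists (types S)"
  shows ident_hom: "\<iota> X \<in> hom X X"
    and place_ident: "typed_labels X a \<Longrightarrow> typed_labels X b \<Longrightarrow> distinct (a @ b) \<Longrightarrow>
      place (\<iota> X) a b = deltas S a b"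
proof -
  let ?x = "canon c 0 0 X" and ?y = "canon c 1 0 X"
  have ty: "typed_labels X ?x" "typed_labels X ?y" using assms by (auto intro!: typed_canon)
  have d: "distinct (?x @ ?y)" using assms distinct_canon canon_disjoint by simp
  have l: "length ?x = length ?y" by (simp add: length_canon)
  note t = deltas_closed[OF ty d] lower_deltas[OF l] upper_deltas[OF l] assms
  show "\<iota> X \<in> hom X X" unfolding ats_ident_def using t by (intro arrow_of_tensor)
  assume ab: "typed_labels X a" "typed_labels X b" "distinct (a @ b)"
  let ?\<sigma> = "subst (?x @ ?y) (a @ b)"
  have len: "length ?x = length a" "length ?y = length b"
    using ty ab by (auto intro: typed_labels_length_eq)
  have "relabelling S ?\<sigma> (set (?x @ ?y))"
    using ty ab d by (intro relabelling_subst_lists[of "X @ X"] typed_labels_append)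
  then have "relabel S ?\<sigma> (deltas S ?x ?y) = deltas S (map ?\<sigma> ?x) (map ?\<sigma> ?y)"
    using ty d by (intro relabel_deltas) auto
  also have "\<dots> = deltas S a b" using d len by (simp add: map_subst_append1 map_subst_append2)
  finally show "place (\<iota> X) a b = deltas S a b"
    unfolding ats_ident_def using place_of_tensor[OF t(1-3) assms assms] by simp
qed

text \<open>As a tensor the symmetry is a product of deltas just like an identity; the crossing lies
  only in the order in which its upper labels are listed. Hence \<open>b' @ a'\<close> in the
  placement against \<open>a' @ b'\<close> in the deltas.\<close>

lemma
  assumes "X \<in> lists (types S)" "Y \<in> lists (types S)"
  shows symm_hom: "symm X Y \<in> hom (X @ Y) (Y @ X)"
    and place_symm: "typed_labels X a \<Longrightarrow> typed_labels Y b \<Longrightarrow> typed_labels X a' \<Longrightarrow>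
      typed_labels Y b' \<Longrightarrow> distinct (a @ b @ a' @ b') \<Longrightarrow>
      place (symm X Y) (a @ b) (b' @ a') = deltas S (a @ b) (a' @ b')"
proof -
  define x where "x = canon c 0 0 X"
  define y where "y = canon c 0 (length X) Y"
  define x' where "x' = canon c 1 (length Y) X"
  define y' where "y' = canon c 1 0 Y"
  note defs = x_def y_def x'_def y'_def
  have ty: "typed_labels X x" "typed_labels Y y" "typed_labels X x'" "typed_labels Y y'"
    unfolding defs using assms by (auto intro!: typed_canon)
  have d: "distinct (x @ y @ y' @ x')" unfolding defs using canon_tens assms by blast
  have len: "length x = length x'" "length y = length y'" by (simp_all add: defs length_canon)
  have tyy: "typed_labels (X @ Y) (x @ y)" "typed_labels (X @ Y) (x' @ y')"
    using ty by (auto intro: typed_labels_append)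
  have t1: "deltas S (x @ y) (x' @ y') \<in> tensors S" using tyy d by (intro deltas_closed) auto
  have t2: "lower (deltas S (x @ y) (x' @ y')) = set (canon c 0 0 (X @ Y))"
    "upper (deltas S (x @ y) (x' @ y')) = set (canon c 1 0 (Y @ X))"
    using len by (auto simp: lower_deltas upper_deltas canon_append defs)
  have "X @ Y \<in> lists (types S)" "Y @ X \<in> lists (types S)" using assms by auto
  note t = t1 t2 this
  \<comment> \<open>The two blocks of deltas are merged in the order of the inputs, which lists the
    outputs as \<open>x' @ y'\<close> against their canonical order \<open>y' @ x'\<close>.\<close>
  have s: "symm X Y = (X @ Y, Y @ X, element (deltas S (x @ y) (x' @ y')))"
    unfolding ats_symm_def using ty d by (subst deltas_append[of X _ _ Y]) (auto simp: defs)
  show "symm X Y \<in> hom (X @ Y) (Y @ X)" unfolding s using t by (intro arrow_of_tensor)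
  assume ab: "typed_labels X a" "typed_labels Y b" "typed_labels X a'"
      "typed_labels Y b'" "distinct (a @ b @ a' @ b')"
  let ?\<sigma> = "subst (x @ y @ y' @ x') (a @ b @ b' @ a')"
  have l: "length x = length a" "length y = length b" "length x' = length a'" "length y' = length b'"
    using ty ab by (auto intro: typed_labels_length_eq)
  have m: "map ?\<sigma> x = a" "map ?\<sigma> y = b" "map ?\<sigma> y' = b'" "map ?\<sigma> x' = a'"
    using map_subst_append1[of x a "y @ y' @ x'" "b @ b' @ a'"]
      map_subst_block[of x y "y' @ x'" a b "b' @ a'"]
      map_subst_block[of "x @ y" y' x' "a @ b" b' a']
      map_subst_block[of "x @ y @ y'" x' "[]" "a @ b @ b'" a' "[]"] d l by auto
  have "relabelling S ?\<sigma> (set (x @ y @ y' @ x'))"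
    using ty ab d by (intro relabelling_subst_lists[of "X @ Y @ Y @ X"] typed_labels_append) auto
  then have "relabel S ?\<sigma> (deltas S (x @ y) (x' @ y')) = deltas S (map ?\<sigma> (x @ y)) (map ?\<sigma> (x' @ y'))"
    using tyy d by (intro relabel_deltas) (auto simp: Un_ac)
  then show "place (symm X Y) (a @ b) (b' @ a') = deltas S (a @ b) (a' @ b')"
    unfolding s using place_of_tensor[OF t] m by (simp add: canon_append defs)
qed

section \<open>Traces\<close>

lemma trace_net:
  assumes "f \<in> hom (A @ X) (B @ X)" "typed_labels A a" "typed_labels B b"
    "typed_labels X p" "typed_labels X q" "distinct (a @ b @ p @ q)"
  shows "ctr_ok p q (place f (a @ p) (b @ q))"
    "lower (ctr p q (place f (a @ p) (b @ q))) = set a"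
    "upper (ctr p q (place f (a @ p) (b @ q))) = set b"
    "labs (place f (a @ p) (b @ q)) = set (a @ b @ p @ q)"
proof -
  have ty: "typed_labels (A @ X) (a @ p)" "typed_labels (B @ X) (b @ q)"
    using assms by (auto intro: typed_labels_append)
  have d: "distinct ((a @ p) @ (b @ q))" using assms by auto
  note l = lower_place[OF assms(1) ty d] upper_place[OF assms(1) ty d] labs_place[OF assms(1) ty d]
  show "ctr_ok p q (place f (a @ p) (b @ q))"
    using place_closed[OF assms(1) ty d] l assms by (auto simp: ctr_ok_def typed_labels_def)
  from ctr_ok_length[OF this] show "lower (ctr p q (place f (a @ p) (b @ q))) = set a"
    "upper (ctr p q (place f (a @ p) (b @ q))) = set b"
    using l d by (auto simp: lower_ctr upper_ctr)
  show "labs (place f (a @ p) (b @ q)) = set (a @ b @ p @ q)" using l by auto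
qed

text \<open>As for composites, the choices are hidden: \<open>p\<close> is the list put at both the
  inputs and the outputs to be joined, and \<open>q\<close> are its bars at the outputs.\<close>

lemma trace_eq:
  assumes "f \<in> hom (A @ X) (B @ X)"
    "A \<in> lists (types S)" "B \<in> lists (types S)" "X \<in> lists (types S)"
  obtains p q where "typed_labels X p" "typed_labels X q"
    "distinct (canon c 0 0 A @ canon c 1 0 B @ p @ q)"
    "tr A B X f = (A, B, element (ctr p q (place f (canon c 0 0 A @ p) (canon c 1 0 B @ q))))"
proof -
  note f = hom_tensor[OF assms(1)]
  obtain t where t: "f = (A @ X, B @ X, t)" using f(8) by auto
  define a where "a = canon c 0 0 A"
  define b where "b = canon c 1 0 B"
  define x where "x = canon c 0 (length A) X"
  define y where "y = canon c 1 (length B) X"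
  note defs = a_def b_def x_def y_def
  have dab: "distinct (a @ b)"
    unfolding defs using assms distinct_canon canon_disjoint by auto
  define p where "p = fresh S X (set a \<union> set x \<union> set b \<union> set y)"
  have "is_fresh S X (set a \<union> set x \<union> set b \<union> set y) p"
    unfolding p_def using assms by (intro is_fresh_fresh) auto
  then have p: "typed_labels X p" "distinct p" "set p \<inter> (set a \<union> set b) = {}"
    by (auto simp: is_fresh_def typed_labels_def)
  let ?es = "[Symbol (arrow_tensor c f) (a @ x) (a @ p) (b @ y) (b @ p)]"
  have rep: "repeated ?es = p"
  proof -
    have "filter (\<lambda>l. l \<in> set b \<or> l \<in> set p) a = []" "filter (\<lambda>l. l \<in> set b \<or> l \<in> set p) p = p"
      using p dab by (auto simp: filter_empty_conv filter_id_conv)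
    then show ?thesis by (simp add: repeated_def)
  qed
  define q where "q = fresh S (map (typing S) p)
    (set (concat (map lower_inds ?es)) \<union> set (concat (map upper_inds ?es)))"
  have "is_fresh S X (set (concat (map lower_inds ?es)) \<union> set (concat (map upper_inds ?es))) q"
    using p(1) assms unfolding q_def typed_labels_def by (simp add: is_fresh_fresh)
  then have q: "typed_labels X q" "distinct q" "set q \<inter> (set a \<union> set b \<union> set p) = {}"
    by (auto simp: is_fresh_def typed_labels_def)
  have len: "length p = length q" using p q by (auto intro: typed_labels_length_eq)
  have m: "map (subst p q) p = q" "map (subst p q) b = b"
    using p len by (auto intro!: map_subst_self map_subst_disjoint)
  \<comment> \<open>By \<open>canon_append\<close> the listed labels are the canonical ones of
    \<open>A @ X\<close> and \<open>B @ X\<close>, so the relabelled symbol is a placement.\<close>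
  have pf: "relabel S (subst (a @ x @ b @ y) (a @ p @ b @ q)) (arrow_tensor c f) =
      place f (a @ p) (b @ q)"
    by (simp add: place_def f defs canon_append)
  have ty: "typed_labels A a" "typed_labels B b" unfolding defs using assms by (auto intro!: typed_canon)
  have d: "distinct (a @ b @ p @ q)" using p q dab by auto
  have "place f (a @ p) (b @ q) \<in> tensors S"
    using trace_net(1)[OF assms(1) ty p(1) q(1) d] by (simp add: ctr_ok_def)
  then have "einstein S ?es = ctr p q (place f (a @ p) (b @ q))"
    by (simp add: einstein_def rep q_def[symmetric, simplified] m pf ctr_def T2_unit_right Let_def)
  moreover have "tr A B X f = (A, B, element (einstein S ?es))"
    by (simp add: t Let_def defs p_def del: arrow_tensor.simps)
  ultimately show thesis using p q d by (intro that[of p q]) (auto simp: defs)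
qed

lemma trace_closed:
  assumes "f \<in> hom (A @ X) (B @ X)"
    "A \<in> lists (types S)" "B \<in> lists (types S)" "X \<in> lists (types S)"
  shows "tr A B X f \<in> hom A B"
proof -
  obtain p q where pq: "typed_labels X p" "typed_labels X q"
    "distinct (canon c 0 0 A @ canon c 1 0 B @ p @ q)"
    "tr A B X f = (A, B, element (ctr p q (place f (canon c 0 0 A @ p) (canon c 1 0 B @ q))))"
    by (rule trace_eq[OF assms])
  have "typed_labels A (canon c 0 0 A)" "typed_labels B (canon c 1 0 B)"
    using assms by (auto intro!: typed_canon)
  note n = trace_net[OF assms(1) this pq(1-3)]
  show ?thesis unfolding pq(4) using n assms by (intro arrow_of_tensor ctr_closed)
qed

text \<open>The argument of \<open>place_comp\<close> again; the hidden labels are now the two ends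
  of the traced wires, both on the same tensor.\<close>

lemma place_trace:
  assumes "f \<in> hom (A @ X) (B @ X)" "typed_labels A a" "typed_labels B b"
    "typed_labels X p" "typed_labels X q" "distinct (a @ b @ p @ q)"
  shows "place (tr A B X f) a b = ctr p q (place f (a @ p) (b @ q))"
proof -
  note f = hom_tensor[OF assms(1)]
  have obj: "A \<in> lists (types S)" "B \<in> lists (types S)" "X \<in> lists (types S)"
    using assms by (auto dest: typed_labels_types)
  obtain p' q' where pq: "typed_labels X p'" "typed_labels X q'"
    "distinct (canon c 0 0 A @ canon c 1 0 B @ p' @ q')"
    "tr A B X f = (A, B, element (ctr p' q' (place f (canon c 0 0 A @ p') (canon c 1 0 B @ q'))))"
    by (rule trace_eq[OF assms(1) obj])
  define x where "x = canon c 0 0 A"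
  define z where "z = canon c 1 0 B"
  have ty: "typed_labels A x" "typed_labels B z"
    unfolding x_def z_def using obj by (auto intro!: typed_canon)
  note pq' = pq(3,4)[folded x_def z_def]
  let ?\<sigma> = "subst (x @ z @ p' @ q') (a @ b @ p @ q)"
  let ?\<psi> = "ctr p' q' (place f (x @ p') (z @ q'))"
  note n = trace_net[OF assms(1) ty pq(1,2) pq'(1)]
  have len: "length x = length a" "length z = length b" "length p' = length p" "length q' = length q"
    using ty pq assms by (auto intro: typed_labels_length_eq)
  have r: "relabelling S ?\<sigma> (set (x @ z @ p' @ q'))"
    using assms ty pq pq'
    by (intro relabelling_subst_lists[of "A @ B @ X @ X"] typed_labels_append) auto
  have m: "map ?\<sigma> x = a" "map ?\<sigma> z = b" "map ?\<sigma> p' = p" "map ?\<sigma> q' = q"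
    using map_subst_append1[of x a "z @ p' @ q'" "b @ p @ q"]
      map_subst_block[of x z "p' @ q'" a b "p @ q"]
      map_subst_block[of "x @ z" p' q' "a @ b" p q]
      map_subst_block[of "x @ z @ p'" q' "[]" "a @ b @ p" q "[]"] pq' len by auto
  have "place (tr A B X f) a b = relabel S (subst (x @ z) (a @ b)) ?\<psi>"
    unfolding pq' x_def z_def
    by (rule place_of_tensor) (use obj ctr_closed[OF n(1)] n in \<open>auto simp: x_def z_def\<close>)
  also have "\<dots> = relabel S ?\<sigma> ?\<psi>"
    using len n subst_append[of "x @ z" "a @ b" "p' @ q'" "p @ q"]
    by (intro relabel_cong) (auto simp: labs_def)
  also have "\<dots> = ctr p q (relabel S ?\<sigma> (place f (x @ p') (z @ q')))"
    using r n m by (simp add: relabel_ctr)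
  also have "relabel S ?\<sigma> (place f (x @ p') (z @ q')) = place f (a @ p) (b @ q)"
    using r assms(1) ty pq(1,2) pq'(1) m
    by (subst place_relabel[OF assms(1)])
      (auto intro: typed_labels_append intro!: relabelling_subset[OF r])
  finally show ?thesis .
qed


section \<open>Whiskering\<close>

text \<open>The renaming produced by the deltas is confined to the factor that owns
  \<open>bs\<close>; on the other factor the substitution acts as the identity.\<close>

lemma ctr_deltas_net_upper:
  assumes "\<psi> \<in> tensors S" "\<phi> \<in> tensors S" "labs \<psi> \<inter> labs \<phi> = {}"
    "typed_labels X as" "typed_labels X bs" "typed_labels X cs" "distinct (as @ cs)" "distinct bs"
    "set bs \<subseteq> upper \<psi>" "set (as @ cs) \<inter> (labs \<psi> \<union> labs \<phi>) = {}"
  shows "ctr as bs (mult S \<psi> (mult S \<phi> (deltas S as cs))) = mult S (relabel S (subst bs cs) \<psi>) \<phi>"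
proof -
  have len: "length as = length cs" using assms by (auto intro: typed_labels_length_eq)
  have D: "deltas S as cs \<in> tensors S" using assms by (intro deltas_closed)
  have m: "mult S \<psi> \<phi> \<in> tensors S" using assms by (intro mult_closed)
  have bs: "set bs \<subseteq> labs \<psi>" using assms by (auto simp: labs_def)
  have r: "relabelling S (subst bs cs) (labs \<psi> \<union> labs \<phi>)"
    using assms tensors_index_sets[OF assms(1)] tensors_index_sets[OF assms(2)]
    by (intro relabelling_subst[of X]) auto
  have "mult S \<psi> (mult S \<phi> (deltas S as cs)) = mult S (mult S \<psi> \<phi>) (deltas S as cs)"
    using assms D len by (intro T2_assoc[symmetric]) (auto simp: labs_deltas)
  also have "ctr as bs \<dots> = relabel S (subst bs cs) (mult S \<psi> \<phi>)"
    using assms m by (intro ctr_deltas_upper) (auto simp: labs_mult upper_mult)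
  also have "\<dots> = mult S (relabel S (subst bs cs) \<psi>) (relabel S (subst bs cs) \<phi>)"
    using assms r by (intro relabel_mult)
  also have "relabel S (subst bs cs) \<phi> = \<phi>"
  proof -
    have i: "subst bs cs l = id l" if "l \<in> labs \<phi>" for l
      using that bs assms(3) by (subst subst_notin) auto
    then show ?thesis using L1_id[OF assms(2)] relabel_cong[of \<phi> "subst bs cs" id S, OF i] by simp
  qed
  finally show ?thesis .
qed

lemma ctr_deltas_net_lower:
  assumes "\<psi> \<in> tensors S" "\<phi> \<in> tensors S" "labs \<psi> \<inter> labs \<phi> = {}"
    "typed_labels X as" "typed_labels X bs" "typed_labels X cs" "distinct (as @ cs)" "distinct bs"
    "set bs \<subseteq> lower \<phi>" "set (as @ cs) \<inter> (labs \<psi> \<union> labs \<phi>) = {}"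
  shows "ctr bs cs (mult S (mult S (deltas S as cs) \<psi>) \<phi>) = mult S \<psi> (relabel S (subst bs as) \<phi>)"
proof -
  have len: "length as = length cs" using assms by (auto intro: typed_labels_length_eq)
  have D: "deltas S as cs \<in> tensors S" using assms by (intro deltas_closed)
  have m: "mult S \<psi> \<phi> \<in> tensors S" using assms by (intro mult_closed)
  have bs: "set bs \<subseteq> labs \<phi>" using assms by (auto simp: labs_def)
  have r: "relabelling S (subst bs as) (labs \<psi> \<union> labs \<phi>)"
    using assms tensors_index_sets[OF assms(1)] tensors_index_sets[OF assms(2)]
    by (intro relabelling_subst[of X]) auto
  have "mult S (mult S (deltas S as cs) \<psi>) \<phi> = mult S (deltas S as cs) (mult S \<psi> \<phi>)"
    using assms D len by (intro T2_assoc) (auto simp: labs_deltas)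
  also have "ctr bs cs \<dots> = relabel S (subst bs as) (mult S \<psi> \<phi>)"
    using assms m by (intro ctr_deltas_lower) (auto simp: labs_mult lower_mult)
  also have "\<dots> = mult S (relabel S (subst bs as) \<psi>) (relabel S (subst bs as) \<phi>)"
    using assms r by (intro relabel_mult)
  also have "relabel S (subst bs as) \<psi> = \<psi>"
  proof -
    have i: "subst bs as l = id l" if "l \<in> labs \<psi>" for l
      using that bs assms(3) by (subst subst_notin) auto
    then show ?thesis using L1_id[OF assms(1)] relabel_cong[of \<psi> "subst bs as" id S, OF i] by simp
  qed
  finally show ?thesis .
qed

lemma ex_list_avoiding:
  assumes "U \<in> lists (types S)" "finite V"
  obtains p where "typed_labels U p" "distinct p" "set p \<inter> V = {}"
  using ex_fresh[OF assms] by (auto simp: is_fresh_def typed_labels_def)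

lemma place_subst:
  assumes "f \<in> hom X Y" "typed_labels X a" "typed_labels Y b" "distinct (a @ b)"
    "typed_labels U p" "typed_labels U u" "distinct p" "distinct u"
    "set u \<inter> (set a \<union> set b - set p) = {}"
  shows "relabel S (subst p u) (place f a b) = place f (map (subst p u) a) (map (subst p u) b)"
  using assms
  by (intro place_relabel relabelling_subst) (auto simp: typed_labels_def)

text \<open>Contracting with the identity on the idle wires merely renames them, so only the wires
  entering \<open>g\<close> are really joined. The temporary labels \<open>p'\<close> and
  \<open>q'\<close> give the idle wires the two ends that \<open>place_comp\<close> asks for; the
  deltas rename \<open>p'\<close> to \<open>u\<close> and use up \<open>q'\<close>.\<close>

lemma whisker_post_right:
  assumes "f \<in> hom X (Y @ U)" "g \<in> hom Y Z" "typed_labels X a" "typed_labels Z b"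
    "typed_labels U u" "typed_labels Y p" "typed_labels Y q" "distinct (a @ b @ u @ p @ q)"
  shows "place (g \<boxplus> \<iota> U \<odot> f) a (b @ u) = ctr q p (mult S (place f a (p @ u)) (place g q b))"
proof -
  have U: "U \<in> lists (types S)" using assms typed_labels_types by blast
  obtain p' where p': "typed_labels U p'" "distinct p'" "set p' \<inter> set (a @ b @ u @ p @ q) = {}"
    using ex_list_avoiding[OF U, of "set (a @ b @ u @ p @ q)"] by auto
  obtain q' where q': "typed_labels U q'" "distinct q'" "set q' \<inter> set (a @ b @ u @ p @ q @ p') = {}"
    using ex_list_avoiding[OF U, of "set (a @ b @ u @ p @ q @ p')"] by auto
  have len: "length u = length p'" "length q' = length p'" "length q = length p"
    using assms p' q' by (auto intro: typed_labels_length_eq)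
  note h = tens_closed[OF assms(2) ident_hom[OF U]]
  have ty: "typed_labels (Y @ U) (p @ p')" "typed_labels (Y @ U) (q @ q')" "typed_labels (Z @ U) (b @ u)"
    using assms p' q' by (auto intro: typed_labels_append)
  have d: "distinct (a @ (b @ u) @ (p @ p') @ (q @ q'))" "distinct (a @ p @ p')" "distinct (q @ b)"
    using assms(8) p' q' by auto
  let ?F = "place f a (p @ p')" and ?G = "place g q b"
  note F = place_facts[OF assms(1,3) ty(1) d(2)] and G = place_facts[OF assms(2,7,4) d(3)]
  have "place (g \<boxplus> \<iota> U \<odot> f) a (b @ u) =
      ctr (q @ q') (p @ p') (mult S ?F (place (g \<boxplus> \<iota> U) (q @ q') (b @ u)))"
    using place_comp[OF assms(1) h assms(3) ty(3,1,2)] d(1) by simp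
  also have "place (g \<boxplus> \<iota> U) (q @ q') (b @ u) = mult S ?G (place (\<iota> U) q' u)"
    using assms p' q' by (intro place_tens[OF assms(2) ident_hom[OF U]]) auto
  also have "place (\<iota> U) q' u = deltas S q' u"
    using assms q' U by (intro place_ident) auto
  also have "ctr (q @ q') (p @ p') (mult S ?F (mult S ?G (deltas S q' u))) =
      ctr q p (ctr q' p' (mult S ?F (mult S ?G (deltas S q' u))))"
    using len by (simp add: ctr_append)
  also have "ctr q' p' (mult S ?F (mult S ?G (deltas S q' u))) =
      mult S (relabel S (subst p' u) ?F) ?G"
    using F G p' q' assms(5,8) by (intro ctr_deltas_net_upper[of _ _ U]) auto
  also have "relabel S (subst p' u) ?F = place f a (p @ u)"
  proof -
    have "map (subst p' u) a = a" "map (subst p' u) p = p" "map (subst p' u) p' = u"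
      using p' len by (auto intro!: map_subst_disjoint map_subst_self)
    moreover have "distinct u" "set u \<inter> (set a \<union> set (p @ p') - set p') = {}"
      using assms(8) by auto
    ultimately show ?thesis
      using place_subst[OF assms(1,3) ty(1) d(2) p'(1) assms(5) p'(2)] by simp
  qed
  finally show ?thesis .
qed

lemma whisker_post_left:
  assumes "f \<in> hom X (U @ Y)" "g \<in> hom Y Z" "typed_labels X a" "typed_labels Z b"
    "typed_labels U u" "typed_labels Y p" "typed_labels Y q" "distinct (a @ b @ u @ p @ q)"
  shows "place (\<iota> U \<boxplus> g \<odot> f) a (u @ b) = ctr q p (mult S (place f a (u @ p)) (place g q b))"
proof -
  have U: "U \<in> lists (types S)" using assms typed_labels_types by blast
  obtain p' where p': "typed_labels U p'" "distinct p'" "set p' \<inter> set (a @ b @ u @ p @ q) = {}"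
    using ex_list_avoiding[OF U, of "set (a @ b @ u @ p @ q)"] by auto
  obtain q' where q': "typed_labels U q'" "distinct q'" "set q' \<inter> set (a @ b @ u @ p @ q @ p') = {}"
    using ex_list_avoiding[OF U, of "set (a @ b @ u @ p @ q @ p')"] by auto
  have len: "length u = length p'" "length q' = length p'" "length q = length p"
    using assms p' q' by (auto intro: typed_labels_length_eq)
  note h = tens_closed[OF ident_hom[OF U] assms(2)]
  have ty: "typed_labels (U @ Y) (p' @ p)" "typed_labels (U @ Y) (q' @ q)" "typed_labels (U @ Z) (u @ b)"
    using assms p' q' by (auto intro: typed_labels_append)
  have d: "distinct (a @ (u @ b) @ (p' @ p) @ (q' @ q))" "distinct (a @ p' @ p)" "distinct (q @ b)"
    using assms(8) p' q' by auto
  let ?F = "place f a (p' @ p)" and ?G = "place g q b" and ?D = "deltas S q' u"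
  note F = place_facts[OF assms(1,3) ty(1) d(2)] and G = place_facts[OF assms(2,7,4) d(3)]
  have D: "?D \<in> tensors S" "lower ?D = set q'" "upper ?D = set u" "labs ?D = set q' \<union> set u"
    using assms q' len by (auto simp: lower_deltas upper_deltas labs_deltas intro!: deltas_closed)
  have "place (\<iota> U \<boxplus> g \<odot> f) a (u @ b) =
      ctr (q' @ q) (p' @ p) (mult S ?F (place (\<iota> U \<boxplus> g) (q' @ q) (u @ b)))"
    using place_comp[OF assms(1) h assms(3) ty(3,1,2)] d(1) by simp
  also have "place (\<iota> U \<boxplus> g) (q' @ q) (u @ b) = mult S (place (\<iota> U) q' u) ?G"
    using assms p' q' by (intro place_tens[OF ident_hom[OF U] assms(2)]) auto
  also have "place (\<iota> U) q' u = ?D"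
    using assms q' U by (intro place_ident) auto
  also have "mult S ?D ?G = mult S ?G ?D"
    using D G q' assms(8) by (intro T2_comm) auto
  also have "ctr (q' @ q) (p' @ p) (mult S ?F (mult S ?G ?D)) =
      ctr q' p' (ctr q p (mult S ?F (mult S ?G ?D)))"
    using len by (simp add: ctr_append)
  \<comment> \<open>With the idle wires listed first, their contraction is outermost; T1 brings it
    inside, next to the deltas.\<close>
  also have "\<dots> = ctr q p (ctr q' p' (mult S ?F (mult S ?G ?D)))"
  proof (rule ctr_commute)
    have "mult S ?F (mult S ?G ?D) \<in> tensors S"
      using F G D d by (intro mult_closed) (auto simp: labs_mult)
    then show "ctr_ok (q' @ q) (p' @ p) (mult S ?F (mult S ?G ?D))"
      using F G D d(1) ty by (auto simp: ctr_ok_def lower_mult upper_mult typed_labels_def)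
  qed (use len in simp)
  also have "ctr q' p' (mult S ?F (mult S ?G ?D)) =
      mult S (relabel S (subst p' u) ?F) ?G"
    using F G p' q' assms(5,8) by (intro ctr_deltas_net_upper[of _ _ U]) auto
  also have "relabel S (subst p' u) ?F = place f a (u @ p)"
  proof -
    have "map (subst p' u) a = a" "map (subst p' u) p = p" "map (subst p' u) p' = u"
      using p' len by (auto intro!: map_subst_disjoint map_subst_self)
    moreover have "distinct u" "set u \<inter> (set a \<union> set (p' @ p) - set p') = {}"
      using assms(8) by auto
    ultimately show ?thesis
      using place_subst[OF assms(1,3) ty(1) d(2) p'(1) assms(5) p'(2)] by simp
  qed
  finally show ?thesis .
qed

text \<open>Precomposition uses the lower form of the delta lemma: the idle inputs \<open>q'\<close>
  of \<open>f\<close> are renamed to \<open>u\<close>, and the upper ends \<open>p'\<close> of the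
  deltas disappear.\<close>

lemma whisker_pre_left:
  assumes "h \<in> hom X Y" "f \<in> hom (U @ Y) Z" "typed_labels X a" "typed_labels Z b"
    "typed_labels U u" "typed_labels Y p" "typed_labels Y q" "distinct (a @ b @ u @ p @ q)"
  shows "place (f \<odot> \<iota> U \<boxplus> h) (u @ a) b = ctr q p (mult S (place h a p) (place f (u @ q) b))"
proof -
  have U: "U \<in> lists (types S)" using assms typed_labels_types by blast
  obtain p' where p': "typed_labels U p'" "distinct p'" "set p' \<inter> set (a @ b @ u @ p @ q) = {}"
    using ex_list_avoiding[OF U, of "set (a @ b @ u @ p @ q)"] by auto
  obtain q' where q': "typed_labels U q'" "distinct q'" "set q' \<inter> set (a @ b @ u @ p @ q @ p') = {}"
    using ex_list_avoiding[OF U, of "set (a @ b @ u @ p @ q @ p')"] by auto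
  have len: "length u = length p'" "length q' = length p'" "length q = length p"
    using assms p' q' by (auto intro: typed_labels_length_eq)
  note k = tens_closed[OF ident_hom[OF U] assms(1)]
  have ty: "typed_labels (U @ Y) (p' @ p)" "typed_labels (U @ Y) (q' @ q)" "typed_labels (U @ X) (u @ a)"
    using assms p' q' by (auto intro: typed_labels_append)
  have d: "distinct ((u @ a) @ b @ (p' @ p) @ (q' @ q))" "distinct (a @ p)" "distinct ((q' @ q) @ b)"
    using assms(8) p' q' by auto
  let ?H = "place h a p" and ?F = "place f (q' @ q) b" and ?D = "deltas S u p'"
  note H = place_facts[OF assms(1,3,6) d(2)] and F = place_facts[OF assms(2) ty(2) assms(4) d(3)]
  have D: "?D \<in> tensors S" "lower ?D = set u" "upper ?D = set p'" "labs ?D = set u \<union> set p'"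
    using assms p' len by (auto simp: lower_deltas upper_deltas labs_deltas intro!: deltas_closed)
  have "place (f \<odot> \<iota> U \<boxplus> h) (u @ a) b =
      ctr (q' @ q) (p' @ p) (mult S (place (\<iota> U \<boxplus> h) (u @ a) (p' @ p)) ?F)"
    using place_comp[OF k assms(2) ty(3) assms(4) ty(1,2)] d(1) by simp
  also have "place (\<iota> U \<boxplus> h) (u @ a) (p' @ p) = mult S (place (\<iota> U) u p') ?H"
    using assms p' q' by (intro place_tens[OF ident_hom[OF U] assms(1)]) auto
  also have "place (\<iota> U) u p' = ?D"
    using assms p' U by (intro place_ident) auto
  also have "ctr (q' @ q) (p' @ p) (mult S (mult S ?D ?H) ?F) =
      ctr q' p' (ctr q p (mult S (mult S ?D ?H) ?F))"
    using len by (simp add: ctr_append)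
  also have "\<dots> = ctr q p (ctr q' p' (mult S (mult S ?D ?H) ?F))"
  proof (rule ctr_commute)
    have "mult S (mult S ?D ?H) ?F \<in> tensors S"
      using H F D d by (intro mult_closed) (auto simp: labs_mult)
    then show "ctr_ok (q' @ q) (p' @ p) (mult S (mult S ?D ?H) ?F)"
      using H F D d(1) ty by (auto simp: ctr_ok_def lower_mult upper_mult typed_labels_def)
  qed (use len in simp)
  also have "ctr q' p' (mult S (mult S ?D ?H) ?F) = mult S ?H (relabel S (subst q' u) ?F)"
    using H F p' q' assms(5,8) by (intro ctr_deltas_net_lower[of _ _ U]) auto
  also have "relabel S (subst q' u) ?F = place f (u @ q) b"
  proof -
    have "map (subst q' u) b = b" "map (subst q' u) q = q" "map (subst q' u) q' = u"
      using q' len by (auto intro!: map_subst_disjoint map_subst_self)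
    moreover have "distinct u" "set u \<inter> (set (q' @ q) \<union> set b - set q') = {}"
      using assms(8) by auto
    ultimately show ?thesis
      using place_subst[OF assms(2) ty(2) assms(4) d(3) q'(1) assms(5) q'(2)] by simp
  qed
  finally show ?thesis .
qed

lemma whisker_pre_right:
  assumes "h \<in> hom X Y" "f \<in> hom (Y @ U) Z" "typed_labels X a" "typed_labels Z b"
    "typed_labels U u" "typed_labels Y p" "typed_labels Y q" "distinct (a @ b @ u @ p @ q)"
  shows "place (f \<odot> h \<boxplus> \<iota> U) (a @ u) b = ctr q p (mult S (place h a p) (place f (q @ u) b))"
proof -
  have U: "U \<in> lists (types S)" using assms typed_labels_types by blast
  obtain p' where p': "typed_labels U p'" "distinct p'" "set p' \<inter> set (a @ b @ u @ p @ q) = {}"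
    using ex_list_avoiding[OF U, of "set (a @ b @ u @ p @ q)"] by auto
  obtain q' where q': "typed_labels U q'" "distinct q'" "set q' \<inter> set (a @ b @ u @ p @ q @ p') = {}"
    using ex_list_avoiding[OF U, of "set (a @ b @ u @ p @ q @ p')"] by auto
  have len: "length u = length p'" "length q' = length p'" "length q = length p"
    using assms p' q' by (auto intro: typed_labels_length_eq)
  note k = tens_closed[OF assms(1) ident_hom[OF U]]
  have ty: "typed_labels (Y @ U) (p @ p')" "typed_labels (Y @ U) (q @ q')" "typed_labels (X @ U) (a @ u)"
    using assms p' q' by (auto intro: typed_labels_append)
  have d: "distinct ((a @ u) @ b @ (p @ p') @ (q @ q'))" "distinct (a @ p)" "distinct ((q @ q') @ b)"
    using assms(8) p' q' by auto
  let ?H = "place h a p" and ?F = "place f (q @ q') b" and ?D = "deltas S u p'"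
  note H = place_facts[OF assms(1,3,6) d(2)] and F = place_facts[OF assms(2) ty(2) assms(4) d(3)]
  have D: "?D \<in> tensors S" "labs ?D = set u \<union> set p'"
    using assms p' len by (auto simp: labs_deltas intro!: deltas_closed)
  have "place (f \<odot> h \<boxplus> \<iota> U) (a @ u) b =
      ctr (q @ q') (p @ p') (mult S (place (h \<boxplus> \<iota> U) (a @ u) (p @ p')) ?F)"
    using place_comp[OF k assms(2) ty(3) assms(4) ty(1,2)] d(1) by simp
  also have "place (h \<boxplus> \<iota> U) (a @ u) (p @ p') = mult S ?H (place (\<iota> U) u p')"
    using assms p' q' by (intro place_tens[OF assms(1) ident_hom[OF U]]) auto
  also have "place (\<iota> U) u p' = ?D"
    using assms p' U by (intro place_ident) auto
  \<comment> \<open>The deltas are put in front, the form in which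
    \<open>ctr_deltas_net_lower\<close> absorbs them.\<close>
  also have "mult S ?H ?D = mult S ?D ?H"
    using D H p' assms(8) by (intro T2_comm) auto
  also have "ctr (q @ q') (p @ p') (mult S (mult S ?D ?H) ?F) =
      ctr q p (ctr q' p' (mult S (mult S ?D ?H) ?F))"
    using len by (simp add: ctr_append)
  also have "ctr q' p' (mult S (mult S ?D ?H) ?F) = mult S ?H (relabel S (subst q' u) ?F)"
    using H F p' q' assms(5,8) by (intro ctr_deltas_net_lower[of _ _ U]) auto
  also have "relabel S (subst q' u) ?F = place f (q @ u) b"
  proof -
    have "map (subst q' u) b = b" "map (subst q' u) q = q" "map (subst q' u) q' = u"
      using q' len by (auto intro!: map_subst_disjoint map_subst_self)
    moreover have "distinct u" "set u \<inter> (set (q @ q') \<union> set b - set q') = {}"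
      using assms(8) by auto
    ultimately show ?thesis
      using place_subst[OF assms(2) ty(2) assms(4) d(3) q'(1) assms(5) q'(2)] by simp
  qed
  finally show ?thesis .
qed

section \<open>Composition with symmetries\<close>

text \<open>A placed symmetry is a product of deltas, so composing with it renames each wire to one
  of the same type; all that survives is the exchanged order of the lists.\<close>

lemma place_comp_symm:
  assumes "f \<in> hom W (X @ Y)" "X \<in> lists (types S)" "Y \<in> lists (types S)"
    "typed_labels W a" "typed_labels X x" "typed_labels Y y" "distinct (a @ x @ y)"
  shows "place (symm X Y \<odot> f) a (y @ x) = place f a (x @ y)"
proof -
  have XY: "X @ Y \<in> lists (types S)" using assms by auto
  obtain p1 where p1: "typed_labels X p1" "distinct p1" "set p1 \<inter> set (a @ x @ y) = {}"
    using ex_list_avoiding[OF assms(2), of "set (a @ x @ y)"] by auto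
  obtain p2 where p2: "typed_labels Y p2" "distinct p2" "set p2 \<inter> set (a @ x @ y @ p1) = {}"
    using ex_list_avoiding[OF assms(3), of "set (a @ x @ y @ p1)"] by auto
  obtain q1 where q1: "typed_labels X q1" "distinct q1" "set q1 \<inter> set (a @ x @ y @ p1 @ p2) = {}"
    using ex_list_avoiding[OF assms(2), of "set (a @ x @ y @ p1 @ p2)"] by auto
  obtain q2 where q2: "typed_labels Y q2" "distinct q2" "set q2 \<inter> set (a @ x @ y @ p1 @ p2 @ q1) = {}"
    using ex_list_avoiding[OF assms(3), of "set (a @ x @ y @ p1 @ p2 @ q1)"] by auto
  let ?p = "p1 @ p2" and ?q = "q1 @ q2"
  have ty: "typed_labels (X @ Y) ?p" "typed_labels (X @ Y) ?q" "typed_labels (X @ Y) (x @ y)"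
    "typed_labels (Y @ X) (y @ x)"
    using assms p1 p2 q1 q2 by (auto intro: typed_labels_append)
  have d: "distinct (a @ (y @ x) @ ?p @ ?q)" "distinct (a @ ?p)" "distinct (?q @ (x @ y))"
    using assms(7) p1 p2 q1 q2 by auto
  have len: "length ?p = length (x @ y)" by (rule typed_labels_length_eq[OF ty(1,3)])
  note F = place_facts[OF assms(1,4) ty(1) d(2)]
  have "place (symm X Y \<odot> f) a (y @ x) = ctr ?q ?p (mult S (place f a ?p) (place (symm X Y) ?q (y @ x)))"
    using symm_hom[OF assms(2,3)] by (rule place_comp[OF assms(1) _ assms(4) ty(4,1,2) d(1)])
  also have "place (symm X Y) ?q (y @ x) = deltas S ?q (x @ y)"
    using assms q1 q2 by (intro place_symm) auto
  also have "ctr ?q ?p (mult S (place f a ?p) (deltas S ?q (x @ y))) =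
      relabel S (subst ?p (x @ y)) (place f a ?p)"
    by (rule ctr_deltas_upper[OF F(1) ty(2,1,3)]) (use d F in auto)
  also have "\<dots> = place f a (x @ y)"
  proof -
    have "map (subst ?p (x @ y)) a = a" "map (subst ?p (x @ y)) ?p = x @ y"
      using d len by (intro map_subst_disjoint map_subst_self; auto)+
    moreover have "distinct ?p" "distinct (x @ y)" "set (x @ y) \<inter> (set a \<union> set ?p - set ?p) = {}"
      using d by auto
    ultimately show ?thesis
      using place_subst[OF assms(1,4) ty(1) d(2) ty(1,3)] by simp
  qed
  finally show ?thesis .
qed

lemma place_symm_comp:
  assumes "f \<in> hom (Y @ X) W" "X \<in> lists (types S)" "Y \<in> lists (types S)"
    "typed_labels W b" "typed_labels X x" "typed_labels Y y" "distinct (b @ x @ y)"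
  shows "place (f \<odot> symm X Y) (x @ y) b = place f (y @ x) b"
proof -
  obtain p1 where p1: "typed_labels X p1" "distinct p1" "set p1 \<inter> set (b @ x @ y) = {}"
    using ex_list_avoiding[OF assms(2), of "set (b @ x @ y)"] by auto
  obtain p2 where p2: "typed_labels Y p2" "distinct p2" "set p2 \<inter> set (b @ x @ y @ p1) = {}"
    using ex_list_avoiding[OF assms(3), of "set (b @ x @ y @ p1)"] by auto
  obtain q1 where q1: "typed_labels X q1" "distinct q1" "set q1 \<inter> set (b @ x @ y @ p1 @ p2) = {}"
    using ex_list_avoiding[OF assms(2), of "set (b @ x @ y @ p1 @ p2)"] by auto
  obtain q2 where q2: "typed_labels Y q2" "distinct q2" "set q2 \<inter> set (b @ x @ y @ p1 @ p2 @ q1) = {}"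
    using ex_list_avoiding[OF assms(3), of "set (b @ x @ y @ p1 @ p2 @ q1)"] by auto
  let ?p = "p2 @ p1" and ?q = "q2 @ q1"
  have ty: "typed_labels (Y @ X) ?p" "typed_labels (Y @ X) ?q" "typed_labels (X @ Y) (x @ y)"
    "typed_labels (Y @ X) (y @ x)"
    using assms p1 p2 q1 q2 by (auto intro: typed_labels_append)
  have d: "distinct ((x @ y) @ b @ ?p @ ?q)" "distinct (?q @ b)" "distinct (x @ p1)" "distinct (y @ p2)"
    using assms(7) p1 p2 q1 q2 by auto
  have len: "length ?q = length (y @ x)" "length x = length p1" "length y = length p2"
    by (rule typed_labels_length_eq[OF ty(2,4)] typed_labels_length_eq[OF assms(5) p1(1)]
        typed_labels_length_eq[OF assms(6) p2(1)])+
  note F = place_facts[OF assms(1) ty(2) assms(4) d(2)]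
  have "place (f \<odot> symm X Y) (x @ y) b = ctr ?q ?p (mult S (place (symm X Y) (x @ y) ?p) (place f ?q b))"
    by (rule place_comp[OF symm_hom[OF assms(2,3)] assms(1) ty(3) assms(4) ty(1,2) d(1)])
  also have "place (symm X Y) (x @ y) ?p = deltas S (x @ y) (p1 @ p2)"
    using assms p1 p2 by (intro place_symm) auto
  \<comment> \<open>The deltas come in the order of the inputs \<open>x @ y\<close>, whereas the
    contraction runs along \<open>Y @ X\<close>; splitting and commuting the two blocks aligns
    them.\<close>
  also have "\<dots> = mult S (deltas S x p1) (deltas S y p2)"
    using assms p1 p2 by (intro deltas_append[of X _ _ Y]) auto
  also have "\<dots> = mult S (deltas S y p2) (deltas S x p1)"
    using assms(7) p1 p2 len
    by (intro T2_comm deltas_closed[OF assms(5) p1(1) d(3)] deltas_closed[OF assms(6) p2(1) d(4)])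
      (auto simp: labs_deltas)
  also have "\<dots> = deltas S (y @ x) ?p"
    using assms p1 p2 by (intro deltas_append[of Y _ _ X, symmetric]) auto
  also have "ctr ?q ?p (mult S (deltas S (y @ x) ?p) (place f ?q b)) =
      relabel S (subst ?q (y @ x)) (place f ?q b)"
    by (rule ctr_deltas_lower[OF F(1) ty(4,2,1)]) (use d F in auto)
  also have "\<dots> = place f (y @ x) b"
  proof -
    have "map (subst ?q (y @ x)) b = b" "map (subst ?q (y @ x)) ?q = y @ x"
      using d len by (intro map_subst_disjoint map_subst_self; auto)+
    moreover have "distinct ?q" "distinct (y @ x)" "set (y @ x) \<inter> (set ?q \<union> set b - set ?q) = {}"
      using d by auto
    ultimately show ?thesis
      using place_subst[OF assms(1) ty(2) assms(4) d(2) ty(2,4)] by simp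
  qed
  finally show ?thesis .
qed


section \<open>The axioms of a traced symmetric monoidal category\<close>

text \<open>Either bracketing is the product of all three arrows contracted along both families of
  connecting wires. T3 moves the third factor in or out, T1 exchanges the contractions, and T2
  rebrackets the product.\<close>

lemma comp_assoc:
  assumes "f \<in> hom W X" "g \<in> hom X Y" "h \<in> hom Y Z"
  shows "h \<odot> (g \<odot> f) = h \<odot> g \<odot> f"
proof -
  note F = hom_tensor[OF assms(1)] and H = hom_tensor[OF assms(3)]
  obtain a b p q r s where t: "typed_labels W a" "typed_labels Z b" "typed_labels X p"
    "typed_labels X q" "typed_labels Y r" "typed_labels Y s" and d: "distinct (a @ b @ p @ q @ r @ s)"
    using ex_lists[of "[W, Z, X, X, Y, Y]"] F H by (auto simp: list_all2_Cons1)
  let ?F = "place f a p" and ?G = "place g q r" and ?H = "place h s b"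
  have dd: "distinct (a @ p)" "distinct (q @ r)" "distinct (s @ b)" "distinct (a @ b @ r @ s)"
    "distinct (a @ r @ p @ q)" "distinct (a @ b @ p @ q)" "distinct (q @ b @ r @ s)"
    using d by auto
  note PF = place_facts[OF assms(1) t(1,3) dd(1)] and PG = place_facts[OF assms(2) t(4,5) dd(2)]
    and PH = place_facts[OF assms(3) t(6,2) dd(3)]
  have D: "labs ?F \<inter> labs ?G = {}" "labs ?F \<inter> labs ?H = {}" "labs ?G \<inter> labs ?H = {}"
    using PF PG PH d by auto
  note gf = comp_net_ok[OF assms(1,2) t(1,3,4,5) dd(5)]
    and hg = comp_net_ok[OF assms(2,3) t(4,5,6,2) dd(7)]
  have T: "mult S (mult S ?F ?G) ?H \<in> tensors S"
    using PF PG PH D by (intro mult_closed) (auto simp: labs_mult)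
  have "place (h \<odot> (g \<odot> f)) a b = ctr s r (mult S (place (g \<odot> f) a r) ?H)"
    by (rule place_comp[OF comp_closed[OF assms(1,2)] assms(3) t(1,2,5,6) dd(4)])
  also have "place (g \<odot> f) a r = ctr q p (mult S ?F ?G)"
    by (rule place_comp[OF assms(1,2) t(1,5,3,4) dd(5)])
  also have "mult S \<dots> ?H = ctr q p (mult S (mult S ?F ?G) ?H)"
    using gf PH d by (intro ctr_mult_left[symmetric]) auto
  also have "ctr s r \<dots> = ctr q p (ctr s r (mult S (mult S ?F ?G) ?H))"
  proof (rule ctr_commute)
    show "ctr_ok (s @ q) (r @ p) (mult S (mult S ?F ?G) ?H)"
      using T PF PG PH d t by (auto simp: ctr_ok_def lower_mult upper_mult typed_labels_def)
    show "length s = length r" by (rule typed_labels_length_eq[OF t(6,5)])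
  qed
  also have "mult S (mult S ?F ?G) ?H = mult S ?F (mult S ?G ?H)"
    using PF(1) PG(1) PH(1) D by (rule T2_assoc)
  also have "ctr s r \<dots> = mult S ?F (ctr s r (mult S ?G ?H))"
    using hg PF d by (intro ctr_mult_right) auto
  also have "ctr s r (mult S ?G ?H) = place (h \<odot> g) q b"
    by (rule place_comp[OF assms(2,3) t(4,2,5,6) dd(7), symmetric])
  also have "ctr q p (mult S ?F \<dots>) = place (h \<odot> g \<odot> f) a b"
    by (rule place_comp[OF assms(1) comp_closed[OF assms(2,3)] t(1,2,3,4) dd(6), symmetric])
  finally show ?thesis
    using assms d by (intro place_eqI[OF _ _ t(1,2)] comp_closed) auto
qed

lemma ident_left:
  assumes "f \<in> hom X Y"
  shows "\<iota> Y \<odot> f = f"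
proof -
  note F = hom_tensor[OF assms(1)]
  obtain a b p q where t: "typed_labels X a" "typed_labels Y b" "typed_labels Y p"
    "typed_labels Y q" and d: "distinct (a @ b @ p @ q)"
    using ex_lists[of "[X, Y, Y, Y]"] F by (auto simp: list_all2_Cons1)
  have dd: "distinct (a @ p)" "distinct (q @ b)" "distinct p" "distinct b"
    "set b \<inter> (set a \<union> set p - set p) = {}" "distinct (a @ b)" using d by auto
  note PF = place_facts[OF assms(1) t(1,3) dd(1)]
  have "place (\<iota> Y \<odot> f) a b = ctr q p (mult S (place f a p) (place (\<iota> Y) q b))"
    by (rule place_comp[OF assms ident_hom[OF F(7)] t d])
  also have "place (\<iota> Y) q b = deltas S q b" by (rule place_ident[OF F(7) t(4,2) dd(2)])
  also have "ctr q p (mult S (place f a p) \<dots>) = relabel S (subst p b) (place f a p)"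
    by (rule ctr_deltas_upper[OF PF(1) t(4,3,2) dd(2,3)]) (use PF d in auto)
  also have "\<dots> = place f (map (subst p b) a) (map (subst p b) p)"
    by (rule place_subst[OF assms t(1,3) dd(1) t(3,2) dd(3,4,5)])
  also have "map (subst p b) a = a" by (rule map_subst_disjoint) (use d in auto)
  also have "map (subst p b) p = b" by (rule map_subst_self[OF dd(3) typed_labels_length_eq[OF t(3,2)]])
  finally show ?thesis
    by (rule place_eqI[OF comp_closed[OF assms ident_hom[OF F(7)]] assms t(1,2) dd(6)])
qed

lemma ident_right:
  assumes "f \<in> hom X Y"
  shows "f \<odot> \<iota> X = f"
proof -
  note F = hom_tensor[OF assms(1)]
  obtain a b p q where t: "typed_labels X a" "typed_labels Y b" "typed_labels X p"
    "typed_labels X q" and d: "distinct (a @ b @ p @ q)"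
    using ex_lists[of "[X, Y, X, X]"] F by (auto simp: list_all2_Cons1)
  have dd: "distinct (a @ p)" "distinct (q @ b)" "distinct q" "distinct a"
    "set a \<inter> (set q \<union> set b - set q) = {}" "distinct (a @ b)" using d by auto
  note PF = place_facts[OF assms(1) t(4,2) dd(2)]
  have "place (f \<odot> \<iota> X) a b = ctr q p (mult S (place (\<iota> X) a p) (place f q b))"
    by (rule place_comp[OF ident_hom[OF F(6)] assms t d])
  also have "place (\<iota> X) a p = deltas S a p" by (rule place_ident[OF F(6) t(1,3) dd(1)])
  also have "ctr q p (mult S \<dots> (place f q b)) = relabel S (subst q a) (place f q b)"
    by (rule ctr_deltas_lower[OF PF(1) t(1,4,3) dd(1,3)]) (use PF d in auto)
  also have "\<dots> = place f (map (subst q a) q) (map (subst q a) b)"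
    by (rule place_subst[OF assms t(4,2) dd(2) t(4,1) dd(3,4,5)])
  also have "map (subst q a) b = b" by (rule map_subst_disjoint) (use d in auto)
  also have "map (subst q a) q = a" by (rule map_subst_self[OF dd(3) typed_labels_length_eq[OF t(4,1)]])
  finally show ?thesis
    by (rule place_eqI[OF comp_closed[OF ident_hom[OF F(6)] assms] assms t(1,2) dd(6)])
qed

section \<open>Monoidal structure\<close>

lemma tens_ident:
  assumes "X \<in> lists (types S)" "Y \<in> lists (types S)"
  shows "\<iota> X \<boxplus> \<iota> Y = \<iota> (X @ Y)"
proof -
  have XY: "X @ Y \<in> lists (types S)" using assms by auto
  obtain a b a' b' where t: "typed_labels X a" "typed_labels X b" "typed_labels Y a'"
    "typed_labels Y b'" and d: "distinct (a @ a' @ b @ b')"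
    using ex_lists[of "[X, Y, X, Y]"] assms by (auto simp: list_all2_Cons1)
  have dd: "distinct (a @ b)" "distinct (a' @ b')" "distinct ((a @ a') @ (b @ b'))" using d by auto
  note tt = typed_labels_append[OF t(1,3)] typed_labels_append[OF t(2,4)]
  have "place (\<iota> X \<boxplus> \<iota> Y) (a @ a') (b @ b') = mult S (place (\<iota> X) a b) (place (\<iota> Y) a' b')"
    by (rule place_tens[OF ident_hom[OF assms(1)] ident_hom[OF assms(2)] t d])
  also have "\<dots> = deltas S (a @ a') (b @ b')"
    unfolding place_ident[OF assms(1) t(1,2) dd(1)] place_ident[OF assms(2) t(3,4) dd(2)]
    by (rule deltas_append[OF t d, symmetric])
  also have "\<dots> = place (\<iota> (X @ Y)) (a @ a') (b @ b')"
    by (rule place_ident[OF XY tt dd(3), symmetric])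
  finally show ?thesis
    by (rule place_eqI[OF tens_closed[OF ident_hom[OF assms(1)] ident_hom[OF assms(2)]]
          ident_hom[OF XY] tt dd(3)])
qed

text \<open>Both sides contract the product of all four arrows, grouped by strand on the left and by
  stage on the right. Once T3 has collected the contractions outside, only the grouping of the
  factors differs.\<close>

lemma interchange:
  assumes "f \<in> hom X Y" "g \<in> hom Y Z" "h \<in> hom U V" "k \<in> hom V W"
  shows "(g \<odot> f) \<boxplus> (k \<odot> h) = (g \<boxplus> k) \<odot> (f \<boxplus> h)"
proof -
  note F = hom_tensor[OF assms(1)] and G = hom_tensor[OF assms(2)]
    and H = hom_tensor[OF assms(3)] and K = hom_tensor[OF assms(4)]
  obtain a a' b b' p p' q q' where t: "typed_labels X a" "typed_labels U a'" "typed_labels Z b"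
    "typed_labels W b'" "typed_labels Y p" "typed_labels V p'" "typed_labels Y q" "typed_labels V q'"
    and d: "distinct (a @ a' @ b @ b' @ p @ p' @ q @ q')"
    using ex_lists[of "[X, U, Z, W, Y, V, Y, V]"] F G H K by (auto simp: list_all2_Cons1)
  have d1: "distinct (a @ p)" "distinct (q @ b)" "distinct (a' @ p')" "distinct (q' @ b')"
    "distinct (a @ a' @ b @ b')" "distinct (a @ b @ p @ q)" "distinct (a' @ b' @ p' @ q')"
    "distinct (a @ a' @ p @ p')" "distinct (q @ q' @ b @ b')"
    "distinct ((a @ a') @ (b @ b') @ (p @ p') @ (q @ q'))" "distinct ((a @ a') @ (b @ b'))"
    using d by auto
  let ?F = "place f a p" and ?G = "place g q b" and ?H = "place h a' p'" and ?K = "place k q' b'"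
  note PF = place_facts[OF assms(1) t(1,5) d1(1)] and PG = place_facts[OF assms(2) t(7,3) d1(2)]
    and PH = place_facts[OF assms(3) t(2,6) d1(3)] and PK = place_facts[OF assms(4) t(8,4) d1(4)]
  note gf = comp_net_ok[OF assms(1,2) t(1,5,7,3) d1(6)]
    and kh = comp_net_ok[OF assms(3,4) t(2,6,8,4) d1(7)]
  note tt = typed_labels_append[OF t(1,2)] typed_labels_append[OF t(3,4)]
    typed_labels_append[OF t(5,6)] typed_labels_append[OF t(7,8)]
  have FG: "mult S ?F ?G \<in> tensors S"
    using gf(1) by (auto simp: ctr_ok_def)
  have "place ((g \<odot> f) \<boxplus> (k \<odot> h)) (a @ a') (b @ b') =
      mult S (place (g \<odot> f) a b) (place (k \<odot> h) a' b')"
    by (rule place_tens[OF comp_closed[OF assms(1,2)] comp_closed[OF assms(3,4)] t(1,3,2,4) d1(5)])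
  also have "\<dots> = mult S (ctr q p (mult S ?F ?G)) (ctr q' p' (mult S ?H ?K))"
    unfolding place_comp[OF assms(1,2) t(1,3,5,7) d1(6)] place_comp[OF assms(3,4) t(2,4,6,8) d1(7)] ..
  also have "\<dots> = ctr q p (mult S (mult S ?F ?G) (ctr q' p' (mult S ?H ?K)))"
    using gf kh d by (intro ctr_mult_left[symmetric] ctr_closed) (auto simp: labs_ctr)
  also have "mult S (mult S ?F ?G) (ctr q' p' (mult S ?H ?K)) =
      ctr q' p' (mult S (mult S ?F ?G) (mult S ?H ?K))"
    using gf kh d FG by (intro ctr_mult_right[symmetric]) auto
  also have "mult S (mult S ?F ?G) (mult S ?H ?K) = mult S (mult S ?F ?H) (mult S ?G ?K)"
    using PF PG PH PK d by (intro mult_swap) auto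
  also have "ctr q p (ctr q' p' (mult S (mult S ?F ?H) (mult S ?G ?K))) =
      ctr (q @ q') (p @ p') (mult S (mult S ?F ?H) (mult S ?G ?K))"
    using typed_labels_length_eq[OF t(7,5)] by (simp add: ctr_append)
  also have "mult S ?F ?H = place (f \<boxplus> h) (a @ a') (p @ p')"
    by (rule place_tens[OF assms(1,3) t(1,5,2,6) d1(8), symmetric])
  also have "mult S ?G ?K = place (g \<boxplus> k) (q @ q') (b @ b')"
    by (rule place_tens[OF assms(2,4) t(7,3,8,4) d1(9), symmetric])
  also have "ctr (q @ q') (p @ p') (mult S (place (f \<boxplus> h) (a @ a') (p @ p')) \<dots>) =
      place ((g \<boxplus> k) \<odot> (f \<boxplus> h)) (a @ a') (b @ b')"
    by (rule place_comp[OF tens_closed[OF assms(1,3)] tens_closed[OF assms(2,4)] tt d1(10), symmetric])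
  finally show ?thesis
    by (rule place_eqI[OF tens_closed[OF comp_closed[OF assms(1,2)] comp_closed[OF assms(3,4)]]
          comp_closed[OF tens_closed[OF assms(1,3)] tens_closed[OF assms(2,4)]] tt(1,2) d1(11)])
qed

text \<open>Concatenation is strictly associative for objects and label lists alike, so both sides
  can be placed at the same labels; what remains is T2.\<close>

lemma tens_assoc:
  assumes "f \<in> hom X X'" "g \<in> hom Y Y'" "h \<in> hom Z Z'"
  shows "(f \<boxplus> g) \<boxplus> h = f \<boxplus> (g \<boxplus> h)"
proof -
  note F = hom_tensor[OF assms(1)] and G = hom_tensor[OF assms(2)] and H = hom_tensor[OF assms(3)]
  obtain x y z x' y' z' where t: "typed_labels X x" "typed_labels Y y" "typed_labels Z z"
    "typed_labels X' x'" "typed_labels Y' y'" "typed_labels Z' z'"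
    and d: "distinct (x @ y @ z @ x' @ y' @ z')"
    using ex_lists[of "[X, Y, Z, X', Y', Z']"] F G H by (auto simp: list_all2_Cons1)
  have d1: "distinct (x @ x')" "distinct (y @ y')" "distinct (z @ z')"
    "distinct ((x @ y) @ z @ (x' @ y') @ z')" "distinct (x @ (y @ z) @ x' @ (y' @ z'))"
    "distinct (x @ y @ x' @ y')" "distinct (y @ z @ y' @ z')"
    "distinct ((x @ (y @ z)) @ (x' @ (y' @ z')))"
    using d by auto
  note tt = typed_labels_append[OF t(1,2)] typed_labels_append[OF t(4,5)]
    typed_labels_append[OF t(2,3)] typed_labels_append[OF t(5,6)]
  note ttt = typed_labels_append[OF t(1) tt(3)] typed_labels_append[OF t(4) tt(4)]
  note PF = place_facts[OF assms(1) t(1,4) d1(1)] and PG = place_facts[OF assms(2) t(2,5) d1(2)]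
    and PH = place_facts[OF assms(3) t(3,6) d1(3)]
  note fg = tens_closed[OF assms(1,2)] and gh = tens_closed[OF assms(2,3)]
  have "place ((f \<boxplus> g) \<boxplus> h) ((x @ y) @ z) ((x' @ y') @ z') =
      mult S (mult S (place f x x') (place g y y')) (place h z z')"
    unfolding place_tens[OF fg assms(3) tt(1,2) t(3,6) d1(4)]
      place_tens[OF assms(1,2) t(1,4,2,5) d1(6)] ..
  also have "\<dots> = mult S (place f x x') (mult S (place g y y') (place h z z'))"
    using PF PG PH d by (intro T2_assoc) auto
  also have "\<dots> = place (f \<boxplus> (g \<boxplus> h)) (x @ (y @ z)) (x' @ (y' @ z'))"
    unfolding place_tens[OF assms(1) gh t(1,4) tt(3,4) d1(5)]
      place_tens[OF assms(2,3) t(2,5,3,6) d1(7)] ..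
  finally show ?thesis
    using tens_closed[OF fg assms(3)] tens_closed[OF assms(1) gh]
    by (intro place_eqI[OF _ _ ttt d1(8)]) auto
qed

lemma tens_unit:
  assumes "f \<in> hom X Y"
  shows "\<iota> [] \<boxplus> f = f" "f \<boxplus> \<iota> [] = f"
proof -
  note F = hom_tensor[OF assms]
  obtain a b where t: "typed_labels X a" "typed_labels Y b" and d: "distinct (a @ b)"
    using ex_lists[of "[X, Y]"] F by (auto simp: list_all2_Cons1)
  have e: "[] \<in> lists (types S)" "typed_labels [] []" by (auto simp: typed_labels_Nil)
  \<comment> \<open>The identity on the unit object is the empty product of deltas, that is, the
    unit tensor.\<close>
  have i: "place (\<iota> []) [] [] = one S" using place_ident[OF e(1) e(2) e(2)] by (simp add: deltas_Nil)
  note P = place_closed[OF assms t d]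
  have "place (\<iota> [] \<boxplus> f) a b = place f a b"
    using place_tens[OF ident_hom[OF e(1)] assms e(2,2) t] d T2_unit_left[OF P] i by simp
  moreover have "\<iota> [] \<boxplus> f \<in> hom X Y" using tens_closed[OF ident_hom[OF e(1)] assms] by simp
  ultimately show "\<iota> [] \<boxplus> f = f" by (intro place_eqI[OF _ assms t d])
  have "place (f \<boxplus> \<iota> []) a b = place f a b"
    using place_tens[OF assms ident_hom[OF e(1)] t e(2,2)] d T2_unit_right[OF P] i by simp
  moreover have "f \<boxplus> \<iota> [] \<in> hom X Y" using tens_closed[OF assms ident_hom[OF e(1)]] by simp
  ultimately show "f \<boxplus> \<iota> [] = f" by (intro place_eqI[OF _ assms t d])
qed

section \<open>Symmetry\<close>

text \<open>The symmetry on either side only reorders label lists, so naturality reduces to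
  commutativity of the tensor product.\<close>

lemma symm_natural:
  assumes "f \<in> hom X X'" "g \<in> hom Y Y'"
  shows "symm X' Y' \<odot> f \<boxplus> g = g \<boxplus> f \<odot> symm X Y"
proof -
  note F = hom_tensor[OF assms(1)] and G = hom_tensor[OF assms(2)]
  obtain a b a' b' where t: "typed_labels X a" "typed_labels Y b" "typed_labels X' a'"
    "typed_labels Y' b'" and d: "distinct (a @ b @ a' @ b')"
    using ex_lists[of "[X, Y, X', Y']"] F G by (auto simp: list_all2_Cons1)
  have d1: "distinct ((a @ b) @ a' @ b')" "distinct (a @ a')" "distinct (b @ b')"
    "distinct ((b' @ a') @ a @ b)" "distinct (b @ a @ b' @ a')" "distinct ((a @ b) @ (b' @ a'))"
    using d by auto
  note tt = typed_labels_append[OF t(1,2)] typed_labels_append[OF t(4,3)]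
  note PF = place_facts[OF assms(1) t(1,3) d1(2)] and PG = place_facts[OF assms(2) t(2,4) d1(3)]
  note fg = tens_closed[OF assms] and gf = tens_closed[OF assms(2,1)]
  have "place (symm X' Y' \<odot> f \<boxplus> g) (a @ b) (b' @ a') = place (f \<boxplus> g) (a @ b) (a' @ b')"
    by (rule place_comp_symm[OF fg F(7) G(7) tt(1) t(3,4) d1(1)])
  also have "\<dots> = mult S (place f a a') (place g b b')"
    by (rule place_tens[OF assms t(1,3,2,4) d])
  also have "\<dots> = mult S (place g b b') (place f a a')"
    using PF PG d by (intro T2_comm) auto
  also have "\<dots> = place (g \<boxplus> f) (b @ a) (b' @ a')"
    by (rule place_tens[OF assms(2,1) t(2,4,1,3) d1(5), symmetric])
  also have "\<dots> = place (g \<boxplus> f \<odot> symm X Y) (a @ b) (b' @ a')"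
    by (rule place_symm_comp[OF gf F(6) G(6) tt(2) t(1,2) d1(4), symmetric])
  finally show ?thesis
    by (rule place_eqI[OF comp_closed[OF fg symm_hom[OF F(7) G(7)]]
          comp_closed[OF symm_hom[OF F(6) G(6)] gf] tt d1(6)])
qed

lemma symm_involutive:
  assumes "X \<in> lists (types S)" "Y \<in> lists (types S)"
  shows "symm Y X \<odot> symm X Y = \<iota> (X @ Y)"
proof -
  have XY: "X @ Y \<in> lists (types S)" using assms by auto
  obtain a b a' b' where t: "typed_labels X a" "typed_labels Y b" "typed_labels X a'"
    "typed_labels Y b'" and d: "distinct (a @ b @ a' @ b')"
    using ex_lists[of "[X, Y, X, Y]"] assms by (auto simp: list_all2_Cons1)
  have d1: "distinct ((a @ b) @ b' @ a')" "distinct ((a @ b) @ (a' @ b'))" using d by auto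
  note tt = typed_labels_append[OF t(1,2)] typed_labels_append[OF t(3,4)]
  have "place (symm Y X \<odot> symm X Y) (a @ b) (a' @ b') = place (symm X Y) (a @ b) (b' @ a')"
    by (rule place_comp_symm[OF symm_hom[OF assms] assms(2,1) tt(1) t(4,3) d1(1)])
  also have "\<dots> = deltas S (a @ b) (a' @ b')" by (rule place_symm[OF assms t d])
  also have "\<dots> = place (\<iota> (X @ Y)) (a @ b) (a' @ b')"
    by (rule place_ident[OF XY tt d1(2), symmetric])
  finally show ?thesis
    by (rule place_eqI[OF comp_closed[OF symm_hom[OF assms] symm_hom[OF assms(2,1)]]
          ident_hom[OF XY] tt d1(2)])
qed

lemma symm_unit:
  assumes "X \<in> lists (types S)"
  shows "symm X [] = \<iota> X"
proof -
  obtain a b where t: "typed_labels X a" "typed_labels X b" and d: "distinct (a @ b)"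
    using ex_lists[of "[X, X]"] assms by (auto simp: list_all2_Cons1)
  have e: "[] \<in> lists (types S)" "typed_labels [] []" by (auto simp: typed_labels_Nil)
  have "place (symm X []) a b = place (\<iota> X) a b"
    using place_symm[OF assms e(1) t(1) e(2) t(2) e(2)] place_ident[OF assms t d] d by simp
  moreover have "symm X [] \<in> hom X X" using symm_hom[OF assms e(1)] by simp
  ultimately show ?thesis by (intro place_eqI[OF _ ident_hom[OF assms] t d])
qed

text \<open>The hexagon with the associators suppressed. All arrows involved are products of deltas,
  and following each wire through the two crossings gives the same pairing of labels as the single
  crossing.\<close>

lemma hexagon:
  assumes "X \<in> lists (types S)" "Y \<in> lists (types S)" "Z \<in> lists (types S)"
  shows "symm X (Y @ Z) = \<iota> Y \<boxplus> symm X Z \<odot> symm X Y \<boxplus> \<iota> Z"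
proof -
  have YZ: "Y @ Z \<in> lists (types S)" using assms by auto
  obtain x y z x' y' z' p1 p2 q1 q2 where t: "typed_labels X x" "typed_labels Y y" "typed_labels Z z"
    "typed_labels X x'" "typed_labels Y y'" "typed_labels Z z'" "typed_labels X p1" "typed_labels Z p2"
    "typed_labels X q1" "typed_labels Z q2"
    and d: "distinct (x @ y @ z @ x' @ y' @ z' @ p1 @ p2 @ q1 @ q2)"
    using ex_lists[of "[X, Y, Z, X, Y, Z, X, Z, X, Z]"] assms by (auto simp: list_all2_Cons1)
  let ?p = "p1 @ p2" and ?q = "q1 @ q2"
  let ?f = "symm X Y \<boxplus> \<iota> Z"
  have f: "?f \<in> hom (X @ Y @ Z) (Y @ X @ Z)"
    using tens_closed[OF symm_hom[OF assms(1,2)] ident_hom[OF assms(3)]] by simp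
  note tt = typed_labels_append[OF t(1) typed_labels_append[OF t(2,3)]]
    typed_labels_append[OF t(6,4)] typed_labels_append[OF t(7,8)] typed_labels_append[OF t(9,10)]
    typed_labels_append[OF t(4,6)] typed_labels_append[OF t(2,3)] typed_labels_append[OF t(5,6)]
  note ty = typed_labels_append[OF t(5) tt(2)] typed_labels_append[OF t(5) tt(3)]
    typed_labels_append[OF t(5) tt(5)]
  have d1: "distinct ((x @ y @ z) @ (z' @ x') @ y' @ ?p @ ?q)" "distinct (q1 @ q2 @ x' @ z')"
    "distinct (?q @ (x' @ z'))" "distinct ?p" "distinct (x' @ z')" "distinct ((x @ y @ z) @ (y' @ ?p))"
    "set (x' @ z') \<inter> (set (x @ y @ z) \<union> set (y' @ ?p) - set ?p) = {}"
    "distinct ((x @ y) @ z @ (y' @ x') @ z')" "distinct (x @ y @ x' @ y')" "distinct (z @ z')"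
    "distinct (x @ (y @ z) @ x' @ (y' @ z'))" "distinct ((x @ y @ z) @ (y' @ z' @ x'))"
    "distinct ((x @ y) @ z @ (x' @ y') @ z')" "distinct ((x @ y) @ (x' @ y'))"
    using d by auto
  note PF = place_facts[OF f tt(1) ty(2) d1(6)]
  note PQ = symm_hom[OF assms(1,3)]
  have "place (\<iota> Y \<boxplus> symm X Z \<odot> ?f) (x @ y @ z) (y' @ z' @ x') =
      ctr ?q ?p (mult S (place ?f (x @ y @ z) (y' @ ?p)) (place (symm X Z) ?q (z' @ x')))"
    by (rule whisker_post_left[OF f PQ tt(1,2) t(5) tt(3,4) d1(1)])
  also have "place (symm X Z) ?q (z' @ x') = deltas S ?q (x' @ z')"
    by (rule place_symm[OF assms(1,3) t(9,10,4,6) d1(2)])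
  \<comment> \<open>The second crossing is absorbed: its deltas rename the outputs
    \<open>p1 @ p2\<close> of the first stage to \<open>x' @ z'\<close>.\<close>
  also have "ctr ?q ?p (mult S (place ?f (x @ y @ z) (y' @ ?p)) \<dots>) =
      relabel S (subst ?p (x' @ z')) (place ?f (x @ y @ z) (y' @ ?p))"
    by (rule ctr_deltas_upper[OF PF(1) tt(4,3,5) d1(3,4)]) (use PF d in auto)
  also have "\<dots> = place ?f (map (subst ?p (x' @ z')) (x @ y @ z)) (map (subst ?p (x' @ z')) (y' @ ?p))"
    by (rule place_subst[OF f tt(1) ty(2) d1(6) tt(3,5) d1(4,5,7)])
  also have "map (subst ?p (x' @ z')) (x @ y @ z) = x @ y @ z"
    by (rule map_subst_disjoint) (use d in auto)
  also have "map (subst ?p (x' @ z')) (y' @ ?p) = y' @ x' @ z'"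
  proof -
    have "map (subst ?p (x' @ z')) y' = y'" by (rule map_subst_disjoint) (use d in auto)
    moreover have "map (subst ?p (x' @ z')) ?p = x' @ z'"
      by (rule map_subst_self[OF d1(4) typed_labels_length_eq[OF tt(3,5)]])
    ultimately show ?thesis by simp
  qed
  also have "place ?f (x @ y @ z) (y' @ x' @ z') = mult S (place (symm X Y) (x @ y) (y' @ x')) (place (\<iota> Z) z z')"
    using place_tens[OF symm_hom[OF assms(1,2)] ident_hom[OF assms(3)]
        typed_labels_append[OF t(1,2)] typed_labels_append[OF t(5,4)] t(3,6) d1(8)] by simp
  also have "\<dots> = mult S (deltas S (x @ y) (x' @ y')) (deltas S z z')"
    unfolding place_symm[OF assms(1,2) t(1,2,4,5) d1(9)] place_ident[OF assms(3) t(3,6) d1(10)] ..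
  also have "\<dots> = deltas S (x @ (y @ z)) (x' @ (y' @ z'))"
    using deltas_append[OF typed_labels_append[OF t(1,2)] typed_labels_append[OF t(4,5)] t(3,6) d1(13)]
    by simp
  also have "\<dots> = place (symm X (Y @ Z)) (x @ y @ z) (y' @ z' @ x')"
    using place_symm[OF assms(1) YZ t(1) tt(6) t(4) tt(7) d1(11)] by simp
  finally show ?thesis
  proof -
    assume eq: "place (\<iota> Y \<boxplus> symm X Z \<odot> ?f) (x @ y @ z) (y' @ z' @ x') = \<dots>"
    have "symm X (Y @ Z) \<in> hom (X @ Y @ Z) (Y @ Z @ X)" using symm_hom[OF assms(1) YZ] by simp
    moreover have "\<iota> Y \<boxplus> symm X Z \<odot> ?f \<in> hom (X @ Y @ Z) (Y @ Z @ X)"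
      using comp_closed[OF f tens_closed[OF ident_hom[OF assms(2)] PQ]] by simp
    ultimately show ?thesis using eq by (intro place_eqI[OF _ _ tt(1) ty(1) d1(12)]) auto
  qed
qed

section \<open>Axioms of the trace\<close>

text \<open>After the identities are eliminated, both sides contract the product of
  \<open>h\<close>, \<open>f\<close> and \<open>g\<close> along three families of wires. The traced
  labels \<open>x\<close>, \<open>y\<close> belong to \<open>f\<close> alone, so T1 and T3 bring
  their contraction down to \<open>f\<close>, where it is the trace.\<close>

lemma trace_natural:
  assumes "f \<in> hom (A @ X) (B @ X)" "g \<in> hom B B'" "h \<in> hom A' A"
    "X \<in> lists (types S)"
  shows "tr A' B' X (g \<boxplus> \<iota> X \<odot> f \<odot> h \<boxplus> \<iota> X) = g \<odot> tr A B X f \<odot> h"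
proof -
  note G = hom_tensor[OF assms(2)] and H = hom_tensor[OF assms(3)]
  obtain a b x y p q r s where t: "typed_labels A' a" "typed_labels B' b" "typed_labels X x"
    "typed_labels X y" "typed_labels A p" "typed_labels A q" "typed_labels B r" "typed_labels B s"
    and d: "distinct (a @ b @ x @ y @ p @ q @ r @ s)"
    using ex_lists[of "[A', B', X, X, A, A, B, B]"] assms(4) G H by (auto simp: list_all2_Cons1)
  note tt = typed_labels_append[OF t(6,3)] typed_labels_append[OF t(7,4)] typed_labels_append[OF t(2,4)]
  have d1: "distinct (a @ b @ x @ y)" "distinct (a @ (b @ y) @ x @ p @ q)"
    "distinct ((q @ x) @ b @ y @ r @ s)" "distinct (a @ b @ p @ q)" "distinct (q @ b @ r @ s)"
    "distinct (q @ r @ x @ y)" "distinct (a @ p)" "distinct (s @ b)" "distinct (q @ b)"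
    "distinct ((q @ x) @ (r @ y))" "distinct (a @ b)"
    using d by auto
  let ?H = "place h a p" and ?F = "place f (q @ x) (r @ y)" and ?G = "place g s b"
  note PF = place_facts[OF assms(1) tt(1,2) d1(10)] and PG = place_facts[OF assms(2) t(8,2) d1(8)]
    and PH = place_facts[OF assms(3) t(1,5) d1(7)]
  note len = typed_labels_length_eq[OF t(3,4)]
  note n = trace_net[OF assms(1) t(6,7,3,4) d1(6)]
  have gX: "g \<boxplus> \<iota> X \<odot> f \<in> hom (A @ X) (B' @ X)"
    by (rule comp_closed[OF assms(1) tens_closed[OF assms(2) ident_hom[OF assms(4)]]])
  have gXh: "g \<boxplus> \<iota> X \<odot> f \<odot> h \<boxplus> \<iota> X \<in> hom (A' @ X) (B' @ X)"
    by (rule comp_closed[OF tens_closed[OF assms(3) ident_hom[OF assms(4)]] gX])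
  note trf = trace_closed[OF assms(1) H(7) G(6) assms(4)]
  have FG: "mult S ?F ?G \<in> tensors S" using PF PG d by (intro mult_closed) auto
  have HFG: "mult S ?H (mult S ?F ?G) \<in> tensors S"
    using PF PG PH FG d by (intro mult_closed) (auto simp: labs_mult)
  \<comment> \<open>The joint condition for both families implies the condition for each and permits
    their exchange.\<close>
  have ok: "ctr_ok (s @ x) (r @ y) (mult S ?F ?G)"
    using FG PF PG d t by (auto simp: ctr_ok_def lower_mult upper_mult typed_labels_def)
  then have okx: "ctr_ok x y (mult S ?F ?G)" and oks: "ctr_ok s r (mult S ?F ?G)"
    using d t by (auto simp: ctr_ok_def typed_labels_def)
  have okH: "ctr_ok (x @ q) (y @ p) (mult S ?H (ctr s r (mult S ?F ?G)))"
  proof -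
    have "mult S ?H (ctr s r (mult S ?F ?G)) \<in> tensors S"
      using ctr_closed[OF oks] PH PF PG d by (intro mult_closed) (auto simp: labs_ctr[OF oks] labs_mult)
    then show ?thesis
      using PF PG PH d t typed_labels_length_eq[OF t(8,7)]
      by (auto simp: ctr_ok_def lower_mult upper_mult lower_ctr upper_ctr typed_labels_def)
  qed
  have "place (tr A' B' X (g \<boxplus> \<iota> X \<odot> f \<odot> h \<boxplus> \<iota> X)) a b =
      ctr x y (place (g \<boxplus> \<iota> X \<odot> f \<odot> h \<boxplus> \<iota> X) (a @ x) (b @ y))"
    by (rule place_trace[OF gXh t(1-4) d1(1)])
  also have "place (g \<boxplus> \<iota> X \<odot> f \<odot> h \<boxplus> \<iota> X) (a @ x) (b @ y) =
      ctr q p (mult S ?H (place (g \<boxplus> \<iota> X \<odot> f) (q @ x) (b @ y)))"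
    by (rule whisker_pre_right[OF assms(3) gX t(1) tt(3) t(3,5,6) d1(2)])
  also have "place (g \<boxplus> \<iota> X \<odot> f) (q @ x) (b @ y) = ctr s r (mult S ?F ?G)"
    by (rule whisker_post_right[OF assms(1,2) tt(1) t(2,4,7,8) d1(3)])
  also have "ctr x y (ctr q p (mult S ?H (ctr s r (mult S ?F ?G)))) =
      ctr q p (ctr x y (mult S ?H (ctr s r (mult S ?F ?G))))"
    by (rule ctr_commute[OF okH len])
  also have "ctr x y (mult S ?H (ctr s r (mult S ?F ?G))) = mult S ?H (ctr x y (ctr s r (mult S ?F ?G)))"
  proof (rule ctr_mult_right[OF _ PH(1)])
    show "ctr_ok x y (ctr s r (mult S ?F ?G))"
      using ctr_closed[OF oks] okx d typed_labels_length_eq[OF t(8,7)]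
      by (auto simp: ctr_ok_def lower_ctr upper_ctr)
    show "labs ?H \<inter> labs (ctr s r (mult S ?F ?G)) = {}"
      using PH PF PG d by (auto simp: labs_ctr[OF oks] labs_mult)
  qed
  also have "ctr x y (ctr s r (mult S ?F ?G)) = ctr s r (ctr x y (mult S ?F ?G))"
    using ok typed_labels_length_eq[OF t(8,7)] by (rule ctr_commute[symmetric])
  also have "ctr x y (mult S ?F ?G) = mult S (ctr x y ?F) ?G"
    using n PG d by (intro ctr_mult_left) auto
  also have "ctr x y ?F = place (tr A B X f) q r"
    by (rule place_trace[OF assms(1) t(6,7,3,4) d1(6), symmetric])
  also have "ctr s r (mult S \<dots> ?G) = place (g \<odot> tr A B X f) q b"
    by (rule place_comp[OF trf assms(2) t(6,2,7,8) d1(5), symmetric])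
  also have "ctr q p (mult S ?H \<dots>) = place (g \<odot> tr A B X f \<odot> h) a b"
    by (rule place_comp[OF assms(3) comp_closed[OF trf assms(2)] t(1,2,5,6) d1(4), symmetric])
  finally show ?thesis
    by (rule place_eqI[OF trace_closed[OF gXh H(6) G(7) assms(4)]
          comp_closed[OF assms(3) comp_closed[OF trf assms(2)]] t(1,2) d1(11)])
qed

text \<open>Joining \<open>f\<close> and \<open>g\<close> along the wires of types \<open>X\<close>
  and of types \<open>Y\<close> gives one cycle of two arrows; the sides differ only in which family
  counts as composition and which as trace. T1 and commutativity of the product identify
  them.\<close>

lemma trace_sliding:
  assumes "f \<in> hom (A @ X) (B @ Y)" "g \<in> hom Y X" "A \<in> lists (types S)" "B \<in> lists (types S)"
  shows "tr A B Y (f \<odot> \<iota> A \<boxplus> g) = tr A B X (\<iota> B \<boxplus> g \<odot> f)"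
proof -
  note G = hom_tensor[OF assms(2)]
  obtain a b y y' p q where t: "typed_labels A a" "typed_labels B b" "typed_labels Y y"
    "typed_labels Y y'" "typed_labels X p" "typed_labels X q"
    and d: "distinct (a @ b @ y @ y' @ p @ q)"
    using ex_lists[of "[A, B, Y, Y, X, X]"] assms(3,4) G by (auto simp: list_all2_Cons1)
  note tt = typed_labels_append[OF t(1,6)] typed_labels_append[OF t(2,4)]
  have d1: "distinct (a @ b @ y @ y')" "distinct (y @ (b @ y') @ a @ p @ q)"
    "distinct (a @ b @ q @ p)" "distinct ((a @ q) @ p @ b @ y' @ y)"
    "distinct ((a @ q) @ (b @ y'))" "distinct (y @ p)" "distinct (a @ b)"
    using d by auto
  let ?F = "place f (a @ q) (b @ y')" and ?G = "place g y p"
  note PF = place_facts[OF assms(1) tt d1(5)] and PG = place_facts[OF assms(2) t(3,5) d1(6)]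
  have f1: "f \<odot> \<iota> A \<boxplus> g \<in> hom (A @ Y) (B @ Y)"
    by (rule comp_closed[OF tens_closed[OF ident_hom[OF assms(3)] assms(2)] assms(1)])
  have f2: "\<iota> B \<boxplus> g \<odot> f \<in> hom (A @ X) (B @ X)"
    by (rule comp_closed[OF assms(1) tens_closed[OF ident_hom[OF assms(4)] assms(2)]])
  have GF: "mult S ?G ?F \<in> tensors S" using PF PG d by (intro mult_closed) auto
  have "place (tr A B Y (f \<odot> \<iota> A \<boxplus> g)) a b = ctr y y' (place (f \<odot> \<iota> A \<boxplus> g) (a @ y) (b @ y'))"
    by (rule place_trace[OF f1 t(1-4) d1(1)])
  also have "place (f \<odot> \<iota> A \<boxplus> g) (a @ y) (b @ y') = ctr q p (mult S ?G ?F)"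
    by (rule whisker_pre_left[OF assms(2,1) t(3) tt(2) t(1,5,6) d1(2)])
  also have "ctr y y' \<dots> = ctr q p (ctr y y' (mult S ?G ?F))"
  proof (rule ctr_commute)
    show "ctr_ok (y @ q) (y' @ p) (mult S ?G ?F)"
      using GF PF PG d t by (auto simp: ctr_ok_def lower_mult upper_mult typed_labels_def)
    show "length y = length y'" by (rule typed_labels_length_eq[OF t(3,4)])
  qed
  also have "mult S ?G ?F = mult S ?F ?G" using PF PG d by (intro T2_comm) auto
  also have "ctr y y' \<dots> = place (\<iota> B \<boxplus> g \<odot> f) (a @ q) (b @ p)"
    by (rule whisker_post_left[OF assms(1,2) tt(1) t(5,2,4,3), symmetric]) (use d in auto)
  also have "ctr q p \<dots> = place (tr A B X (\<iota> B \<boxplus> g \<odot> f)) a b"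
    by (rule place_trace[OF f2 t(1,2,6,5) d1(3), symmetric])
  finally show ?thesis
    by (rule place_eqI[OF trace_closed[OF f1 assms(3,4) G(6)] trace_closed[OF f2 assms(3,4) G(7)]
          t(1,2) d1(7)])
qed

lemma trace_unit:
  assumes "f \<in> hom A B"
  shows "tr A B [] f = f"
proof -
  note F = hom_tensor[OF assms]
  obtain a b where t: "typed_labels A a" "typed_labels B b" and d: "distinct (a @ b)"
    using ex_lists[of "[A, B]"] F by (auto simp: list_all2_Cons1)
  have e: "[] \<in> lists (types S)" "typed_labels [] []" by (auto simp: typed_labels_Nil)
  have f: "f \<in> hom (A @ []) (B @ [])" using assms by simp
  have "place (tr A B [] f) a b = place f a b"
    using place_trace[OF f t e(2,2)] d by (simp add: ctr_Nil)
  then show ?thesis by (rule place_eqI[OF trace_closed[OF f F(6,7) e(1)] assms t d])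
qed

text \<open>A contraction over a concatenated list is an iterated one with the last block innermost,
  hence the inner trace is over \<open>Y\<close>.\<close>

lemma trace_tens:
  assumes "f \<in> hom (A @ X @ Y) (B @ X @ Y)" "A \<in> lists (types S)" "B \<in> lists (types S)"
    "X \<in> lists (types S)" "Y \<in> lists (types S)"
  shows "tr A B (X @ Y) f = tr A B X (tr (A @ X) (B @ X) Y f)"
proof -
  obtain a b x y x' y' where t: "typed_labels A a" "typed_labels B b" "typed_labels X x"
    "typed_labels Y y" "typed_labels X x'" "typed_labels Y y'"
    and d: "distinct (a @ b @ x @ y @ x' @ y')"
    using ex_lists[of "[A, B, X, Y, X, Y]"] assms by (auto simp: list_all2_Cons1)
  note tt = typed_labels_append[OF t(3,4)] typed_labels_append[OF t(5,6)]
    typed_labels_append[OF t(1,3)] typed_labels_append[OF t(2,5)]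
  have d1: "distinct (a @ b @ (x @ y) @ (x' @ y'))" "distinct (a @ b @ x @ x')"
    "distinct ((a @ x) @ (b @ x') @ y @ y')" "distinct (a @ b)"
    using d by auto
  have f: "f \<in> hom ((A @ X) @ Y) ((B @ X) @ Y)" using assms(1) by simp
  have obj: "A @ X \<in> lists (types S)" "B @ X \<in> lists (types S)" "X @ Y \<in> lists (types S)"
    using assms by auto
  note tf = trace_closed[OF f obj(1,2) assms(5)]
  have "place (tr A B (X @ Y) f) a b = ctr (x @ y) (x' @ y') (place f (a @ x @ y) (b @ x' @ y'))"
    by (rule place_trace[OF assms(1) t(1,2) tt(1,2) d1(1)])
  also have "\<dots> = ctr x x' (ctr y y' (place f ((a @ x) @ y) ((b @ x') @ y')))"
    using typed_labels_length_eq[OF t(3,5)] by (simp add: ctr_append)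
  also have "ctr y y' (place f ((a @ x) @ y) ((b @ x') @ y')) =
      place (tr (A @ X) (B @ X) Y f) (a @ x) (b @ x')"
    by (rule place_trace[OF f tt(3,4) t(4,6) d1(3), symmetric])
  also have "ctr x x' \<dots> = place (tr A B X (tr (A @ X) (B @ X) Y f)) a b"
    by (rule place_trace[OF tf t(1,2,3,5) d1(2), symmetric])
  finally show ?thesis
    by (rule place_eqI[OF trace_closed[OF assms(1-3) obj(3)] trace_closed[OF tf assms(2-4)] t(1,2) d1(4)])
qed

text \<open>This is T3: the traced labels occur only in the second factor.\<close>

lemma trace_superposing:
  assumes "f \<in> hom (A @ X) (B @ X)" "g \<in> hom U V" "A \<in> lists (types S)" "B \<in> lists (types S)"
    "X \<in> lists (types S)"
  shows "tr (U @ A) (V @ B) X (g \<boxplus> f) = g \<boxplus> tr A B X f"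
proof -
  note G = hom_tensor[OF assms(2)]
  obtain a b x x' u v where t: "typed_labels A a" "typed_labels B b" "typed_labels X x"
    "typed_labels X x'" "typed_labels U u" "typed_labels V v"
    and d: "distinct (a @ b @ x @ x' @ u @ v)"
    using ex_lists[of "[A, B, X, X, U, V]"] assms G by (auto simp: list_all2_Cons1)
  note tt = typed_labels_append[OF t(5,1)] typed_labels_append[OF t(6,2)]
    typed_labels_append[OF t(1,3)] typed_labels_append[OF t(2,4)]
  have d1: "distinct ((u @ a) @ (v @ b) @ x @ x')" "distinct (u @ (a @ x) @ v @ (b @ x'))"
    "distinct (a @ b @ x @ x')" "distinct (u @ a @ v @ b)" "distinct (u @ v)"
    "distinct ((u @ a) @ (v @ b))"
    using d by auto
  have gf: "g \<boxplus> f \<in> hom ((U @ A) @ X) ((V @ B) @ X)"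
    using tens_closed[OF assms(2,1)] by simp
  have obj: "U @ A \<in> lists (types S)" "V @ B \<in> lists (types S)" using assms G by auto
  note tf = trace_closed[OF assms(1,3,4,5)]
  note n = trace_net[OF assms(1) t(1-4) d1(3)] and PG = place_facts[OF assms(2) t(5,6) d1(5)]
  have "place (tr (U @ A) (V @ B) X (g \<boxplus> f)) (u @ a) (v @ b) =
      ctr x x' (place (g \<boxplus> f) ((u @ a) @ x) ((v @ b) @ x'))"
    by (rule place_trace[OF gf tt(1,2) t(3,4) d1(1)])
  also have "place (g \<boxplus> f) ((u @ a) @ x) ((v @ b) @ x') = mult S (place g u v) (place f (a @ x) (b @ x'))"
    using place_tens[OF assms(2,1) t(5,6) tt(3,4) d1(2)] by simp
  also have "ctr x x' \<dots> = mult S (place g u v) (ctr x x' (place f (a @ x) (b @ x')))"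
    using n PG d by (intro ctr_mult_right) auto
  also have "ctr x x' (place f (a @ x) (b @ x')) = place (tr A B X f) a b"
    by (rule place_trace[OF assms(1) t(1-4) d1(3), symmetric])
  also have "mult S (place g u v) \<dots> = place (g \<boxplus> tr A B X f) (u @ a) (v @ b)"
    by (rule place_tens[OF assms(2) tf t(5,6,1,2) d1(4), symmetric])
  finally show ?thesis
    by (rule place_eqI[OF trace_closed[OF gf obj assms(5)] tens_closed[OF assms(2) tf] tt(1,2) d1(6)])
qed

text \<open>Each traced wire runs from the upper end of one delta to the lower end of another, so T4
  straightens the chain into a single delta; no delta is contracted with itself.\<close>

lemma trace_yanking:
  assumes "X \<in> lists (types S)"
  shows "tr X X X (symm X X) = \<iota> X"
proof -
  obtain a b p q where t: "typed_labels X a" "typed_labels X b" "typed_labels X p"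
    "typed_labels X q" and d: "distinct (a @ b @ p @ q)"
    using ex_lists[of "[X, X, X, X]"] assms by (auto simp: list_all2_Cons1)
  have d1: "distinct (a @ p @ q @ b)" "distinct (a @ q)" "distinct (p @ b)" "distinct q" "distinct (a @ b)"
    using d by auto
  note len = typed_labels_length_eq[OF t(1,4)] typed_labels_length_eq[OF t(4,2)]
  have "place (tr X X X (symm X X)) a b = ctr p q (place (symm X X) (a @ p) (b @ q))"
    by (rule place_trace[OF symm_hom[OF assms assms] t d])
  also have "place (symm X X) (a @ p) (b @ q) = deltas S (a @ p) (q @ b)"
    by (rule place_symm[OF assms assms t(1,3,4,2) d1(1)])
  also have "\<dots> = mult S (deltas S a q) (deltas S p b)"
    by (rule deltas_append[OF t(1,4,3,2) d1(1)])
  \<comment> \<open>The deltas from \<open>a\<close> to \<open>q\<close> take the part of the tensor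
    whose outputs are extended by the deltas from \<open>p\<close> to \<open>b\<close>.\<close>
  also have "ctr p q \<dots> = relabel S (subst q b) (deltas S a q)"
    by (rule ctr_deltas_upper[OF deltas_closed[OF t(1,4) d1(2)] t(3,4,2) d1(3,4)])
      (use d len in \<open>auto simp: upper_deltas labs_deltas\<close>)
  also have "\<dots> = deltas S (map (subst q b) a) (map (subst q b) q)"
    by (rule relabel_deltas[OF t(1,4) d1(2)], rule relabelling_subst[OF t(4,2)])
      (use d t in \<open>auto simp: typed_labels_def\<close>)
  also have "map (subst q b) a = a" by (rule map_subst_disjoint) (use d in auto)
  also have "map (subst q b) q = b" by (rule map_subst_self[OF d1(4) len(2)])
  also have "deltas S a b = place (\<iota> X) a b" by (rule place_ident[OF assms t(1,2) d1(5), symmetric])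
  finally show ?thesis
    by (rule place_eqI[OF trace_closed[OF symm_hom[OF assms assms] assms assms assms]
          ident_hom[OF assms] t(1,2) d1(5)])
qed

section \<open>Strict structure arrows and assembly of the axioms\<close>

lemma hom_eq:
  "X \<in> lists (types S) \<Longrightarrow> Y \<in> lists (types S) \<Longrightarrow> f \<in> ats_hom S c X Y \<longleftrightarrow> f \<in> hom X Y"
  by (simp add: hom_def)

lemma ats_category_simps:
  "Obj (ats_category S c) = lists (types S)"
  "Hom (ats_category S c) = ats_hom S c"
  "Comp (ats_category S c) = ats_comp S c"
  "Ident (ats_category S c) = ats_ident S c"
  "TensObj (ats_category S c) = (@)"
  "TensArr (ats_category S c) = ats_tens S c"
  "UnitObj (ats_category S c) = []"
  "Assoc (ats_category S c) = (\<lambda>X Y Z. ats_ident S c (X @ Y @ Z))"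
  "LUnit (ats_category S c) = ats_ident S c"
  "RUnit (ats_category S c) = ats_ident S c"
  "Symm (ats_category S c) = ats_symm S c"
  "Trace (ats_category S c) = ats_trace S c"
  by (simp_all add: ats_category_def)

text \<open>The axioms refer to inverses of structure arrows by a definite description; an identity
  is its own only inverse, so the description can be evaluated.\<close>

lemma inverse_arrows_ident:
  assumes "X \<in> lists (types S)"
  shows "inverse_arrows (ats_category S c) X X (\<iota> X) g \<longleftrightarrow> g = \<iota> X"
  using assms ident_hom[OF assms] ident_left[of g X X] ident_left[of "\<iota> X" X X]
  by (auto simp: inverse_arrows_def ats_category_simps hom_eq)

lemma iso_arrow_ident: "X \<in> lists (types S) \<Longrightarrow> iso_arrow (ats_category S c) X X (\<iota> X)"
  by (simp add: iso_arrow_def inverse_arrows_ident)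

lemma inv_arrow_ident: "X \<in> lists (types S) \<Longrightarrow> inv_arrow (ats_category S c) X X (\<iota> X) = \<iota> X"
  by (simp add: inv_arrow_def inverse_arrows_ident)

lemma ident_ident: "X \<in> lists (types S) \<Longrightarrow> \<iota> X \<odot> \<iota> X = \<iota> X"
  using ident_hom ident_left by blast

text \<open>Strict structure arrows still occur in the axioms as composites with identities. This
  form, like \<open>hexagon_strict\<close> and \<open>trace_superposing_strict\<close>, keeps them
  so as to match the axioms after unfolding.\<close>

lemma assoc_natural:
  assumes "f \<in> hom X X'" "g \<in> hom Y Y'" "h \<in> hom Z Z'"
  shows "\<iota> (X' @ Y' @ Z') \<odot> f \<boxplus> (g \<boxplus> h) = f \<boxplus> (g \<boxplus> h) \<odot> \<iota> (X @ Y @ Z)"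
proof -
  have "f \<boxplus> (g \<boxplus> h) \<in> hom (X @ Y @ Z) (X' @ Y' @ Z')" using assms by (intro tens_closed)
  then show ?thesis by (simp add: ident_left ident_right)
qed

lemma hexagon_strict:
  assumes "X \<in> lists (types S)" "Y \<in> lists (types S)" "Z \<in> lists (types S)"
  shows "\<iota> (Y @ Z @ X) \<odot> symm X (Y @ Z) \<odot> \<iota> (X @ Y @ Z) =
    \<iota> Y \<boxplus> symm X Z \<odot> \<iota> (Y @ X @ Z) \<odot> symm X Y \<boxplus> \<iota> Z"
proof -
  have "symm X (Y @ Z) \<in> hom (X @ Y @ Z) (Y @ Z @ X)"
    using assms symm_hom[of X "Y @ Z"] by simp
  moreover have "\<iota> Y \<boxplus> symm X Z \<in> hom (Y @ X @ Z) (Y @ Z @ X)"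
    using assms by (intro tens_closed ident_hom symm_hom)
  ultimately show ?thesis
    using hexagon[OF assms] by (simp add: ident_left ident_right)
qed

lemma trace_superposing_strict:
  assumes "f \<in> hom (A @ X) (B @ X)" "g \<in> hom U V" "A \<in> lists (types S)" "B \<in> lists (types S)"
    "X \<in> lists (types S)"
  shows "tr (U @ A) (V @ B) X (\<iota> (V @ B @ X) \<odot> g \<boxplus> f \<odot> \<iota> (U @ A @ X)) = g \<boxplus> tr A B X f"
  using tens_closed[OF assms(2,1)] trace_superposing[OF assms]
  by (simp add: ident_left ident_right)

text \<open>Pentagon and triangle hold because products and composites of identities are identities.
  Disjointness of the hom-sets, left to \<open>metis\<close>, comes from the domain and codomain
  tags of the arrows.\<close>

lemma strict_traced: "strict_traced_symmetric_monoidal_category (ats_category S c)"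
  by unfold_locales
    (unfold ats_category_simps,
     simp_all add: hom_eq comp_closed ident_hom comp_assoc ident_left ident_right ident_ident
       tens_closed tens_ident interchange iso_arrow_ident tens_assoc assoc_natural tens_unit
       symm_hom symm_natural symm_involutive symm_unit hexagon_strict trace_closed
       inv_arrow_ident trace_sliding trace_natural trace_unit trace_tens
       trace_superposing_strict trace_yanking,
     metis hom_tensor(4,5))

end

theorem theorem5p3:
  fixes S :: "('u, 'l, 't) ats"
    and Lc :: "'l set"
    and c :: "'u \<times> nat \<times> nat \<Rightarrow> 'l"
  assumes "abstract_tensor_system S"
    and "canonical_labels S Lc c"
  shows "strict_traced_symmetric_monoidal_category (ats_category S c)"
proof -
  interpret abstract_tensor_system S by fact
  interpret canonical_ats S Lc c by unfold_locales fact
  show ?thesis by (rule strict_traced)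
qed

end
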